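(* Let $M$ be a complex manifold. Then: (1) $\mathsf{sq}_M(z_0)\le\mathsf{wsq}_M(z_0)\le1$ for all $z_0\in M$. (2) $M$ is a weakly holomorphic homogeneous regular (wHHR) manifold if and only if $\mathsf{wsq}_M$ has a positive lower bound on $M$.
   Context: $\mathbb{B}^m\subset\mathbb{C}^m$ is the open unit ball and $g_{\mathrm{Euc}}$ is the Euclidean metric on $\mathbb{C}^m$. Levi form: for a $\mathcal{C}^2$ real-valued function $f$ on a complex $m$-manifold, $\mathscr{L}(f)=\sum_{1\le j,k\le m}\frac{\partial^2 f}{\partial z^j\partial\bar z^k}\,dz^j\otimes d\bar z^k$ in local holomorphic coordinates. For $f$ on $\mathbb{B}^m$, the inequality $\mathscr{L}(f)\ge c\, g_{\mathrm{Euc}}$ means $\sum_{j,k}\frac{\partial^2 f}{\partial z^j\partial\bar z^k}(w)\,x_j\bar x_k\ge c\sum_j|x_j|^2$ for all $w\in\mathbb{B}^m$ and $x\in\mathbb{C}^m$. wHHR: a complex $m$-manifold $M$ is a wHHR manifold if there exists $s>0$ such that for every $\zeta\in M$ there exist a holomorphic embedding $\Phi:\mathbb{B}^m\to M$ and a $\mathcal{C}^2$ plurisubharmonic function $\phi:M\to[0,1]$ with $\Phi(0)=\zeta$ and $\mathscr{L}(\phi\circ\Phi)\ge s^2 g_{\mathrm{Euc}}$ on $\mathbb{B}^m$. Squeezing function: for a complex $m$-manifold $M$, $\mathsf{sq}_M(\zeta)$ is the supremum of all radii $r$ for which there exists a holomorphic embedding $f:M\to\mathbb{B}^m$ with $f(\zeta)=0$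 and $r\mathbb{B}^m\subset f(M)$; if $M$ admits no bounded holomorphic embedding into $\mathbb{C}^m$ then $\mathsf{sq}_M\equiv-\infty$. Weak squeezing function: for a complex $m$-manifold $M$ and $\zeta\in M$, $\mathsf{wsq}_M(\zeta)\in[0,1]$ is the supremum of all $s\in[0,1]$ for which there exist a holomorphic embedding $\Phi:\mathbb{B}^m\to M$ and a $\mathcal{C}^2$ function $\phi:M\to[0,1]$ with $\Phi(0)=\zeta$, $\phi(\zeta)=0$, $\log\phi$ plurisubharmonic, and $\mathscr{L}(\phi\circ\Phi)\ge s^2g_{\mathrm{Euc}}$ on $\mathbb{B}^m$. (The constant function $-\infty$ counts as plurisubharmonic.) *)

theory Defs
  imports "HOL-Analysis.Analysis"
begin

section \<open>Complex manifolds and holomorphic embeddings\<close>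

text \<open>
  The matrix \<open>J\<close> is the complex Jacobian, so holomorphic means real differentiable with a
  complex-linear derivative.  Only used for open \<open>S\<close>.
\<close>

definition holo_on :: "(complex^'m) set \<Rightarrow> (complex^'m \<Rightarrow> complex^'k) \<Rightarrow> bool" where
  "holo_on S F \<longleftrightarrow> (\<forall>w\<in>S. \<exists>J. (F has_derivative (\<lambda>x. J *v x)) (at w))"

text \<open>
  A complex manifold modelled on \<open>complex^'m\<close> is a topology together with a holomorphic atlas,
  which is not required to be maximal.  A chart is a pair of its domain and its coordinate map;
  the coordinate map is meaningful only on the domain.
\<close>

type_synonym ('a, 'm) chart = "'a set \<times> ('a \<Rightarrow> complex^'m)"

definition complex_manifold :: "'a topology \<Rightarrow> ('a, 'm::finite) chart set \<Rightarrow> bool" where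
  "complex_manifold M A \<longleftrightarrow>
     Hausdorff_space M \<and> second_countable M \<and>
     (\<forall>(U, \<kappa>)\<in>A. openin M U \<and> open (\<kappa> ` U) \<and>
        homeomorphic_map (subtopology M U) (top_of_set (\<kappa> ` U)) \<kappa>) \<and>
     (\<Union>(U, \<kappa>)\<in>A. U) = topspace M \<and>
     (\<forall>(U, \<kappa>)\<in>A. \<forall>(V, \<psi>)\<in>A. holo_on (\<kappa> ` (U \<inter> V)) (\<psi> \<circ> inv_into U \<kappa>))"

definition holo_map ::
  "'a topology \<Rightarrow> ('a, 'm::finite) chart set \<Rightarrow> 'b topology \<Rightarrow> ('b, 'k::finite) chart set
    \<Rightarrow> ('a \<Rightarrow> 'b) \<Rightarrow> bool" where
  "holo_map M A N B f \<longleftrightarrow> continuous_map M N f \<and>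
     (\<forall>(U, \<kappa>)\<in>A. \<forall>(V, \<psi>)\<in>B. holo_on (\<kappa> ` (U \<inter> f -` V)) (\<psi> \<circ> f \<circ> inv_into U \<kappa>))"

definition holo_immersion ::
  "'a topology \<Rightarrow> ('a, 'm::finite) chart set \<Rightarrow> 'b topology \<Rightarrow> ('b, 'k::finite) chart set
    \<Rightarrow> ('a \<Rightarrow> 'b) \<Rightarrow> bool" where
  "holo_immersion M A N B f \<longleftrightarrow> holo_map M A N B f \<and>
     (\<forall>(U, \<kappa>)\<in>A. \<forall>(V, \<psi>)\<in>B. \<forall>w\<in>\<kappa> ` (U \<inter> f -` V).
        \<exists>J. ((\<psi> \<circ> f \<circ> inv_into U \<kappa>) has_derivative (\<lambda>x. J *v x)) (at w) \<and>
            inj (\<lambda>x. J *v x))"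

definition holo_embedding ::
  "'a topology \<Rightarrow> ('a, 'm::finite) chart set \<Rightarrow> 'b topology \<Rightarrow> ('b, 'k::finite) chart set
    \<Rightarrow> ('a \<Rightarrow> 'b) \<Rightarrow> bool" where
  "holo_embedding M A N B f \<longleftrightarrow> holo_immersion M A N B f \<and> embedding_map M N f"

text \<open>The standard atlas of an open set \<open>S\<close>, whose topology is \<open>top_of_set S\<close>.\<close>

definition std_atlas :: "(complex^'m) set \<Rightarrow> (complex^'m, 'm::finite) chart set" where
  "std_atlas S = {(S, id)}"

definition unit_ball :: "(complex^'m) set" where
  "unit_ball = ball 0 1"


section \<open>Functions of class C2 and the Levi form\<close>

definition C2_on :: "'v::real_normed_vector set \<Rightarrow> ('v \<Rightarrow> real) \<Rightarrow> bool" where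
  "C2_on S f \<longleftrightarrow>
     (\<exists>(D :: 'v \<Rightarrow> 'v \<Rightarrow>\<^sub>L real) (D2 :: 'v \<Rightarrow> 'v \<Rightarrow>\<^sub>L ('v \<Rightarrow>\<^sub>L real)).
        (\<forall>x\<in>S. (f has_derivative blinfun_apply (D x)) (at x)) \<and>
        (\<forall>x\<in>S. (D has_derivative blinfun_apply (D2 x)) (at x)) \<and>
        continuous_on S D2)"

definition C2_fun :: "('a, 'm::finite) chart set \<Rightarrow> ('a \<Rightarrow> real) \<Rightarrow> bool" where
  "C2_fun A \<phi> \<longleftrightarrow> (\<forall>(U, \<kappa>)\<in>A. C2_on (\<kappa> ` U) (\<phi> \<circ> inv_into U \<kappa>))"

definition dir_deriv ::
  "'v::real_normed_vector \<Rightarrow> ('v \<Rightarrow> 'w::real_normed_vector) \<Rightarrow> 'v \<Rightarrow> 'w" where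
  "dir_deriv v f w = vector_derivative (\<lambda>t::real. f (w + t *\<^sub>R v)) (at 0)"

text \<open>The Wirtinger derivatives with respect to \<open>z\<^sub>j\<close> and the conjugate of \<open>z\<^sub>j\<close>.\<close>

definition d_z :: "'m::finite \<Rightarrow> (complex^'m \<Rightarrow> complex) \<Rightarrow> complex^'m \<Rightarrow> complex" where
  "d_z j f w = (dir_deriv (axis j 1) f w - \<i> * dir_deriv (axis j \<i>) f w) / 2"

definition d_zbar :: "'m::finite \<Rightarrow> (complex^'m \<Rightarrow> complex) \<Rightarrow> complex^'m \<Rightarrow> complex" where
  "d_zbar j f w = (dir_deriv (axis j 1) f w + \<i> * dir_deriv (axis j \<i>) f w) / 2"

definition levi_form :: "(complex^'m \<Rightarrow> real) \<Rightarrow> complex^'m \<Rightarrow> complex^'m::finite \<Rightarrow> complex" where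
  "levi_form f w x =
     (\<Sum>j\<in>UNIV. \<Sum>k\<in>UNIV. d_z j (d_zbar k (\<lambda>z. complex_of_real (f z))) w * x $ j * cnj (x $ k))"

text \<open>
  For a function of class C2 the Levi form takes real values, so \<open>Re\<close> loses nothing.
\<close>

definition levi_ge :: "(complex^'m::finite) set \<Rightarrow> (complex^'m \<Rightarrow> real) \<Rightarrow> real \<Rightarrow> bool" where
  "levi_ge S f c \<longleftrightarrow>
     (\<forall>w\<in>S. \<forall>x. Re (levi_form f w x) \<ge> c * (\<Sum>j\<in>UNIV. (cmod (x $ j))\<^sup>2))"


section \<open>Plurisubharmonic functions\<close>

definition usc_on :: "'v::topological_space set \<Rightarrow> ('v \<Rightarrow> ereal) \<Rightarrow> bool" where
  "usc_on S u \<longleftrightarrow> (\<forall>t. openin (top_of_set S) {z \<in> S. u z < t})"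

definition harmonic_on :: "complex set \<Rightarrow> (complex \<Rightarrow> real) \<Rightarrow> bool" where
  "harmonic_on S h \<longleftrightarrow> C2_on S h \<and>
     (\<forall>z\<in>S. dir_deriv 1 (dir_deriv 1 h) z + dir_deriv \<i> (dir_deriv \<i> h) z = 0)"

text \<open>
  Values lie in \<open>[-\<infinity>, \<infinity>)\<close>; the constant function \<open>-\<infinity>\<close> is subharmonic.
\<close>

definition subharmonic_on :: "complex set \<Rightarrow> (complex \<Rightarrow> ereal) \<Rightarrow> bool" where
  "subharmonic_on D u \<longleftrightarrow>
     (\<forall>\<tau>\<in>D. u \<tau> < \<infinity>) \<and> usc_on D u \<and>
     (\<forall>c r h. 0 < r \<and> cball c r \<subseteq> D \<and> continuous_on (cball c r) h \<and> harmonic_on (ball c r) h \<and>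
        (\<forall>\<tau>\<in>sphere c r. u \<tau> \<le> ereal (h \<tau>)) \<longrightarrow> (\<forall>\<tau>\<in>ball c r. u \<tau> \<le> ereal (h \<tau>)))"

definition psh_on :: "(complex^'m) set \<Rightarrow> (complex^'m \<Rightarrow> ereal) \<Rightarrow> bool" where
  "psh_on S u \<longleftrightarrow>
     (\<forall>z\<in>S. u z < \<infinity>) \<and> usc_on S u \<and>
     (\<forall>a v. subharmonic_on {\<tau>. a + \<tau> *s v \<in> S} (\<lambda>\<tau>. u (a + \<tau> *s v)))"

definition psh_fun :: "('a, 'm::finite) chart set \<Rightarrow> ('a \<Rightarrow> ereal) \<Rightarrow> bool" where
  "psh_fun A u \<longleftrightarrow> (\<forall>(U, \<kappa>)\<in>A. psh_on (\<kappa> ` U) (u \<circ> inv_into U \<kappa>))"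

definition log_ereal :: "real \<Rightarrow> ereal" where
  "log_ereal t = (if t = 0 then - \<infinity> else ereal (ln t))"


section \<open>wHHR manifolds and squeezing functions\<close>

definition wHHR :: "'a topology \<Rightarrow> ('a, 'm::finite) chart set \<Rightarrow> bool" where
  "wHHR M A \<longleftrightarrow>
     (\<exists>s>0. \<forall>\<zeta>\<in>topspace M. \<exists>(\<Phi> :: complex^'m \<Rightarrow> 'a) \<phi>.
        holo_embedding (top_of_set unit_ball) (std_atlas unit_ball) M A \<Phi> \<and>
        C2_fun A \<phi> \<and> psh_fun A (\<lambda>p. ereal (\<phi> p)) \<and> \<phi> ` topspace M \<subseteq> {0..1} \<and>
        \<Phi> 0 = \<zeta> \<and> levi_ge unit_ball (\<phi> \<circ> \<Phi>) (s\<^sup>2))"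

definition sq :: "'a topology \<Rightarrow> ('a, 'm::finite) chart set \<Rightarrow> 'a \<Rightarrow> ereal" where
  "sq M A \<zeta> =
     (if \<exists>f :: 'a \<Rightarrow> complex^'m.
           holo_embedding M A euclidean (std_atlas UNIV) f \<and> bounded (f ` topspace M)
      then Sup {ereal r | r. 0 < r \<and>
             (\<exists>f :: 'a \<Rightarrow> complex^'m.
                holo_embedding M A (top_of_set unit_ball) (std_atlas unit_ball) f \<and>
                f \<zeta> = 0 \<and> (*\<^sub>R) r ` unit_ball \<subseteq> f ` topspace M)}
      else - \<infinity>)"

definition wsq :: "'a topology \<Rightarrow> ('a, 'm::finite) chart set \<Rightarrow> 'a \<Rightarrow> ereal" where
  "wsq M A \<zeta> =
     Sup {ereal s | s. 0 \<le> s \<and> s \<le> 1 \<and>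
       (\<exists>(\<Phi> :: complex^'m \<Rightarrow> 'a) \<phi>.
          holo_embedding (top_of_set unit_ball) (std_atlas unit_ball) M A \<Phi> \<and>
          C2_fun A \<phi> \<and> \<phi> ` topspace M \<subseteq> {0..1} \<and>
          \<Phi> 0 = \<zeta> \<and> \<phi> \<zeta> = 0 \<and> psh_fun A (\<lambda>p. log_ereal (\<phi> p)) \<and>
          levi_ge unit_ball (\<phi> \<circ> \<Phi>) (s\<^sup>2))}"

end

theory Submission
  imports Defs "HOL-Complex_Analysis.Complex_Analysis"
begin

text \<open>
  Plurisubharmonicity is tested through a viscosity criterion: an upper semicontinuous \<open>u\<close> is
  subharmonic iff no function \<open>h - \<epsilon>|\<tau> - p|\<^sup>2\<close> with \<open>h\<close> harmonic and \<open>\<epsilon> > 0\<close> touches it from above at a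
  point.  This notion is local, holds for C2 functions with nonnegative Laplacian, and passes from
  \<open>log \<phi>\<close> to \<open>\<phi>\<close>, so a lower bound for the weak squeezing function gives wHHR.

  If \<open>f\<close> embeds \<open>M\<close> into the ball with \<open>f \<zeta> = 0\<close> and \<open>r\<close> times the ball lies in the image, then
  \<open>\<phi> = |f|\<^sup>2\<close> and \<open>\<Phi> w = f\<^sup>-\<^sup>1 (r w)\<close> show that the weak squeezing function is at least \<open>r\<close>.

  If \<open>M\<close> is wHHR with \<open>\<Phi>\<close>, \<open>\<phi>\<close>, \<open>s\<close> at \<open>\<zeta>\<close>, take \<open>\<psi> = \<theta>(4|w|\<^sup>2) exp (K \<phi> + \<phi>\<^sup>2 - K - 1)\<close>, where \<open>w = \<Phi>\<^sup>-\<^sup>1\<close> and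
  \<open>\<theta>\<close> is a C2 cutoff with \<open>\<theta>(t) \<sim> t\<close> at \<open>0\<close> up to a factor and \<open>\<theta> = 1\<close> for \<open>t \<ge> 1\<close>.  A multiple \<open>K\<close> of order \<open>1/s\<^sup>2\<close>
  compensates the negative part of the Levi form of \<open>log \<theta>\<close>.  The gradient of \<open>\<phi>\<close> is not controlled, so
  \<open>|w|\<^sup>2 exp (K \<phi>)\<close> may have a degenerate Levi form arbitrarily near \<open>\<zeta>\<close>; the term \<open>\<phi>\<^sup>2\<close> makes the exponent
  strictly convex in \<open>\<phi>\<close>, which absorbs the mixed gradient terms and yields a bound depending on \<open>s\<close> only.
\<close>

section \<open>Second derivatives and functions of class C2\<close>

text \<open>Subharmonicity is defined by comparison on whole discs, which is not visibly local,
  whereas \<open>\<psi>\<close> is given by one formula near \<open>\<zeta>\<close> and by another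
  far away; a condition tested at single points makes this gluing harmless. Off the embedded ball no
  strict Levi bound for \<open>\<phi>\<close> is known, so there \<open>ln \<psi>\<close> has to be
  an increasing convex function of \<open>\<phi>\<close>, which restricts the shape of the exponent.
  On the ball the strict bound has to pay twice with one \<open>K\<close>: for the concavity of
  \<open>ln \<theta>\<close>, and for a surplus that survives at \<open>\<zeta>\<close> itself,
  where \<open>ln \<psi>\<close> is \<open>-\<infinity>\<close> and says nothing about the Levi form
  of \<open>\<psi>\<close>. Apart from one conversion lemma, Levi forms are handled along complex
  lines, as second derivatives in two real directions, by the one-variable calculus of
  \<open>has_d2\<close>. Since \<open>holo_on\<close> asks for one derivative only, Cauchy's formula
  has to supply the second one before functions of class C2 can be pulled back.\<close>

definition has_d2 :: "(real \<Rightarrow> real) \<Rightarrow> real \<Rightarrow> real \<Rightarrow> bool" where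
  "has_d2 g a b \<longleftrightarrow>
     (\<exists>g1. (\<forall>\<^sub>F t in nhds 0. (g has_real_derivative g1 t) (at t)) \<and> g1 0 = a \<and>
           (g1 has_real_derivative b) (at 0))"

lemma has_d2I:
  assumes "\<forall>\<^sub>F t in nhds 0. (g has_real_derivative g1 t) (at t)" "g1 0 = a"
    "(g1 has_real_derivative b) (at 0)"
  shows "has_d2 g a b"
  using assms unfolding has_d2_def by blast

lemma has_d2_cong:
  assumes "has_d2 g a b" "\<forall>\<^sub>F t in nhds 0. g t = h t"
  shows "has_d2 h a b"
proof -
  obtain g1 where g: "\<forall>\<^sub>F t in nhds 0. (g has_real_derivative g1 t) (at t)" "g1 0 = a"
    "(g1 has_real_derivative b) (at 0)"
    using assms(1) unfolding has_d2_def by blast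
  have "\<forall>\<^sub>F t in nhds 0. \<forall>\<^sub>F s in nhds t. g s = h s"
    using assms(2) by (simp add: eventually_eventually)
  then have "\<forall>\<^sub>F t in nhds 0. (h has_real_derivative g1 t) (at t)"
    using g(1)
    by eventually_elim (metis DERIV_cong_ev)
  then show ?thesis using g by (intro has_d2I) auto
qed

lemma has_d2_unique:
  assumes "has_d2 g a b" "has_d2 g a' b'"
  shows "a = a'" "b = b'"
proof -
  obtain g1 where g: "\<forall>\<^sub>F t in nhds 0. (g has_real_derivative g1 t) (at t)" "g1 0 = a"
    "(g1 has_real_derivative b) (at 0)"
    using assms(1) unfolding has_d2_def by blast
  obtain h1 where h: "\<forall>\<^sub>F t in nhds 0. (g has_real_derivative h1 t) (at t)" "h1 0 = a'"
    "(h1 has_real_derivative b') (at 0)"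
    using assms(2) unfolding has_d2_def by blast
  have ev: "\<forall>\<^sub>F t in nhds 0. g1 t = h1 t"
    using g(1) h(1) by eventually_elim (rule DERIV_unique)
  show "a = a'" using eventually_nhds_x_imp_x[OF ev] g h by simp
  have "(h1 has_real_derivative b) (at 0)"
    using DERIV_cong_ev[OF refl ev refl] g(3) by simp
  then show "b = b'" using h(3) DERIV_unique by blast
qed

lemma has_d2_add:
  assumes "has_d2 g a b" "has_d2 h a' b'"
  shows "has_d2 (\<lambda>t. g t + h t) (a + a') (b + b')"
proof -
  obtain g1 where g: "\<forall>\<^sub>F t in nhds 0. (g has_real_derivative g1 t) (at t)" "g1 0 = a"
    "(g1 has_real_derivative b) (at 0)"
    using assms(1) unfolding has_d2_def by blast
  obtain h1 where h: "\<forall>\<^sub>F t in nhds 0. (h has_real_derivative h1 t) (at t)" "h1 0 = a'"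
    "(h1 has_real_derivative b') (at 0)"
    using assms(2) unfolding has_d2_def by blast
  show ?thesis
  proof (rule has_d2I[where ?g1.0 = "\<lambda>t. g1 t + h1 t"])
    show "\<forall>\<^sub>F t in nhds 0. ((\<lambda>t. g t + h t) has_real_derivative g1 t + h1 t) (at t)"
      using g(1) h(1) by eventually_elim (rule DERIV_add)
  qed (use g h in \<open>auto intro!: DERIV_add\<close>)
qed

lemma has_d2_mult:
  assumes "has_d2 g a b" "has_d2 h a' b'"
  shows "has_d2 (\<lambda>t. g t * h t) (a * h 0 + g 0 * a') (b * h 0 + 2 * a * a' + g 0 * b')"
proof -
  obtain g1 where g: "\<forall>\<^sub>F t in nhds 0. (g has_real_derivative g1 t) (at t)" "g1 0 = a"
    "(g1 has_real_derivative b) (at 0)"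
    using assms(1) unfolding has_d2_def by blast
  obtain h1 where h: "\<forall>\<^sub>F t in nhds 0. (h has_real_derivative h1 t) (at t)" "h1 0 = a'"
    "(h1 has_real_derivative b') (at 0)"
    using assms(2) unfolding has_d2_def by blast
  have g0: "(g has_real_derivative g1 0) (at 0)" and h0: "(h has_real_derivative h1 0) (at 0)"
    using eventually_nhds_x_imp_x[OF g(1)] eventually_nhds_x_imp_x[OF h(1)] by auto
  show ?thesis
  proof (rule has_d2I[where ?g1.0 = "\<lambda>t. g1 t * h t + g t * h1 t"])
    show "\<forall>\<^sub>F t in nhds 0. ((\<lambda>t. g t * h t) has_real_derivative g1 t * h t + g t * h1 t) (at t)"
      using g(1) h(1)
      by eventually_elim (auto intro!: derivative_eq_intros)
    show "((\<lambda>t. g1 t * h t + g t * h1 t) has_real_derivative b * h 0 + 2 * a * a' + g 0 * b') (at 0)"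
      using g h by (auto intro!: derivative_eq_intros g0 h0 simp: algebra_simps)
  qed (use g h in auto)
qed

lemma has_d2_const: "has_d2 (\<lambda>t. c) 0 0"
  by (rule has_d2I[where ?g1.0 = "\<lambda>t. 0"]) auto

lemma has_d2_quadratic: "has_d2 (\<lambda>t. c + a * t + b * t\<^sup>2) a (2 * b)"
  by (rule has_d2I[where ?g1.0 = "\<lambda>t. a + 2 * b * t"]) (auto intro!: derivative_eq_intros always_eventually)

lemma has_d2_compose:
  fixes f :: "real \<Rightarrow> real"
  assumes "has_d2 g a b" "\<forall>\<^sub>F y in nhds (g 0). (f has_real_derivative f1 y) (at y)"
    "(f1 has_real_derivative c) (at (g 0))"
  shows "has_d2 (\<lambda>t. f (g t)) (f1 (g 0) * a) (c * a\<^sup>2 + f1 (g 0) * b)"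
proof -
  obtain g1 where g: "\<forall>\<^sub>F t in nhds 0. (g has_real_derivative g1 t) (at t)" "g1 0 = a"
    "(g1 has_real_derivative b) (at 0)"
    using assms(1) unfolding has_d2_def by blast
  have g0: "(g has_real_derivative g1 0) (at 0)"
    using eventually_nhds_x_imp_x[OF g(1)] by auto
  have "(g \<longlongrightarrow> g 0) (nhds 0)"
    using DERIV_isCont[OF g0] by (simp add: isCont_def tendsto_at_iff_tendsto_nhds)
  then have "\<forall>\<^sub>F t in nhds 0. (f has_real_derivative f1 (g t)) (at (g t))"
    using assms(2) by (rule eventually_compose_filterlim[rotated])
  with g(1) have 1: "\<forall>\<^sub>F t in nhds 0. ((\<lambda>t. f (g t)) has_real_derivative f1 (g t) * g1 t) (at t)"
    by eventually_elim (rule DERIV_chain2)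
  have "((\<lambda>t. f1 (g t)) has_real_derivative c * g1 0) (at 0)"
    using DERIV_chain2[OF assms(3) g0] by simp
  then have "((\<lambda>t. f1 (g t) * g1 t) has_real_derivative c * a\<^sup>2 + f1 (g 0) * b) (at 0)"
    using g by (auto intro!: derivative_eq_intros simp: power2_eq_square)
  with 1 g(2) show ?thesis by (intro has_d2I) auto
qed

lemma has_d2_cmult: "has_d2 g a b \<Longrightarrow> has_d2 (\<lambda>t. c * g t) (c * a) (c * b)"
  using has_d2_mult[OF has_d2_const[of c]] by fastforce

lemma has_d2_compose_at:
  fixes f :: "real \<Rightarrow> real"
  assumes "has_d2 g a b" "g 0 = y" "\<forall>\<^sub>F y in nhds y. (f has_real_derivative f1 y) (at y)"
    "(f1 has_real_derivative c) (at y)"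
  shows "has_d2 (\<lambda>t. f (g t)) (f1 y * a) (c * a\<^sup>2 + f1 y * b)"
  using has_d2_compose assms by blast

text \<open>If \<open>b\<close> were positive, \<open>g1\<close>, which vanishes at a maximum, would
  be positive just to the right of 0, and \<open>g\<close> would rise there.\<close>

lemma has_d2_local_max:
  assumes "has_d2 g a b" "\<forall>\<^sub>F t in nhds 0. g t \<le> g 0"
  shows "b \<le> 0"
proof (rule ccontr)
  assume "\<not> b \<le> 0"
  obtain g1 where g: "\<forall>\<^sub>F t in nhds 0. (g has_real_derivative g1 t) (at t)" "g1 0 = a"
    "(g1 has_real_derivative b) (at 0)"
    using assms(1) unfolding has_d2_def by blast
  obtain d where d: "d > 0" "\<And>t. \<bar>t\<bar> < d \<Longrightarrow> (g has_real_derivative g1 t) (at t) \<and> g t \<le> g 0"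
    using eventually_conj[OF g(1) assms(2)] by (auto simp: eventually_nhds_metric dist_real_def)
  have "g1 0 = 0"
    using DERIV_local_max[of g "g1 0" 0 d] d by auto
  obtain e where e: "e > 0" "\<And>h. 0 < h \<Longrightarrow> h < e \<Longrightarrow> g1 0 < g1 (0 + h)"
    using DERIV_pos_inc_right[OF g(3)] \<open>\<not> b \<le> 0\<close> by (metis not_le)
  define t where "t = min d e / 2"
  have t: "0 < t" "t < d" "t < e" using d e by (auto simp: t_def min_def)
  have "g 0 < g t"
  proof (rule DERIV_pos_imp_increasing_open[OF t(1)])
    fix x assume x: "0 < x" "x < t"
    show "\<exists>y. (g has_real_derivative y) (at x) \<and> y > 0"
      using d(2)[of x] e(2)[of x] x t \<open>g1 0 = 0\<close> by (intro exI[of _ "g1 x"]) auto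
  next
    show "continuous_on {0..t} g"
      by (rule DERIV_continuous_on[where D = g1]) (use d t in \<open>auto intro: has_field_derivative_at_within\<close>)
  qed
  then show False using d(2)[of t] t by auto
qed

text \<open>Scalar counterpart of the operator-valued derivatives in \<open>C2_on\<close>:
  continuity is asked for each fixed pair of directions, which suffices in finite dimension and
  keeps product and chain rules elementary.\<close>

definition C2_hess ::
  "'v::euclidean_space set \<Rightarrow> ('v \<Rightarrow> real) \<Rightarrow> ('v \<Rightarrow> 'v \<Rightarrow> real) \<Rightarrow> ('v \<Rightarrow> 'v \<Rightarrow> 'v \<Rightarrow> real) \<Rightarrow> bool" where
  "C2_hess S f D H \<longleftrightarrow>
     (\<forall>x\<in>S. (f has_derivative D x) (at x)) \<and>
     (\<forall>v. \<forall>x\<in>S. ((\<lambda>x. D x v) has_derivative (\<lambda>u. H x u v)) (at x)) \<and>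
     (\<forall>u v. continuous_on S (\<lambda>x. H x u v))"

text \<open>The operators are rebuilt from their values on \<open>Basis\<close>: \<open>DB\<close>
  is a finite sum of scalar functions times fixed functionals, so it is differentiated term by term,
  and continuity of \<open>HB\<close> reduces to components.\<close>

lemma C2_hess_imp_C2_on:
  assumes "C2_hess S f D H"  "open S"
  shows "C2_on S f"
proof -
  have D: "\<And>x. x \<in> S \<Longrightarrow> (f has_derivative D x) (at x)"
    and H: "\<And>x v. x \<in> S \<Longrightarrow> ((\<lambda>x. D x v) has_derivative (\<lambda>u. H x u v)) (at x)"
    and cH: "\<And>u v. continuous_on S (\<lambda>x. H x u v)"
    using assms(1) by (auto simp: C2_hess_def)
  define DB where "DB x = (\<Sum>b\<in>Basis. D x b *\<^sub>R blinfun_inner_left b)" for x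
  define HB where "HB x = Blinfun (\<lambda>u. \<Sum>b\<in>Basis. H x u b *\<^sub>R blinfun_inner_left b)" for x
  have "blinfun_apply (DB x) = D x" if "x \<in> S" for x
  proof
    fix v
    have lin: "linear (D x)" using D[OF that] has_derivative_linear by blast
    have "D x v = D x (\<Sum>b\<in>Basis. (v \<bullet> b) *\<^sub>R b)" by (simp add: euclidean_representation)
    also have "\<dots> = (\<Sum>b\<in>Basis. (v \<bullet> b) * D x b)"
      by (simp add: linear_sum[OF lin] linear_cmul[OF lin])
    finally show "blinfun_apply (DB x) v = D x v"
      by (simp add: DB_def blinfun.sum_left blinfun.scaleR_left mult.commute)
  qed
  moreover have der: "(DB has_derivative (\<lambda>u. \<Sum>b\<in>Basis. H x u b *\<^sub>R blinfun_inner_left b)) (at x)"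
    if "x \<in> S" for x
    unfolding DB_def[abs_def] by (auto intro!: derivative_eq_intros H that)
  moreover have HB: "blinfun_apply (HB x) = (\<lambda>u. \<Sum>b\<in>Basis. H x u b *\<^sub>R blinfun_inner_left b)"
    if "x \<in> S" for x
    unfolding HB_def using has_derivative_bounded_linear[OF der[OF that]]
    by (rule bounded_linear_Blinfun_apply)
  moreover have "continuous_on S HB"
  proof (rule continuous_on_blinfun_componentwise)
    fix i :: 'a
    have "continuous_on S (\<lambda>x. \<Sum>b\<in>Basis. H x i b *\<^sub>R (blinfun_inner_left b :: 'a \<Rightarrow>\<^sub>L real))"
      by (intro continuous_intros cH)
    then show "continuous_on S (\<lambda>x. blinfun_apply (HB x) i)"
      by (subst continuous_on_cong[OF refl]) (auto simp: HB)
  qed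
  ultimately show ?thesis
    unfolding C2_on_def using D by (intro exI[of _ DB] exI[of _ HB]) auto
qed

lemma C2_on_imp_C2_hess:
  fixes f :: "'v::euclidean_space \<Rightarrow> real"
  assumes "C2_on S f"
  obtains D H where "C2_hess S f D H"
proof -
  obtain D :: "'v \<Rightarrow> 'v \<Rightarrow>\<^sub>L real" and H :: "'v \<Rightarrow> 'v \<Rightarrow>\<^sub>L ('v \<Rightarrow>\<^sub>L real)" where
    D: "\<And>x. x \<in> S \<Longrightarrow> (f has_derivative blinfun_apply (D x)) (at x)"
    and H: "\<And>x. x \<in> S \<Longrightarrow> (D has_derivative blinfun_apply (H x)) (at x)" and c: "continuous_on S H"
    using assms unfolding C2_on_def by blast
  have "C2_hess S f (\<lambda>x. blinfun_apply (D x)) (\<lambda>x u v. blinfun_apply (blinfun_apply (H x) u) v)"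
    unfolding C2_hess_def
    by (auto intro!: D H derivative_eq_intros continuous_intros c simp: blinfun.zero_right)
  then show ?thesis by (rule that)
qed

lemma C2_on_subset: "C2_on S f \<Longrightarrow> T \<subseteq> S \<Longrightarrow> C2_on T f"
  unfolding C2_on_def using continuous_on_subset by (meson subsetD)

lemma C2_on_imp_continuous_on: "C2_on S f \<Longrightarrow> continuous_on S f"
  unfolding C2_on_def
  by (meson continuous_at_imp_continuous_on has_derivative_continuous)

lemma C2_on_cong:
  assumes "C2_on S f" "open S" "\<And>x. x \<in> S \<Longrightarrow> f x = g x"
  shows "C2_on S g"
proof -
  have "(g has_derivative D) (at x)" if "x \<in> S" "(f has_derivative D) (at x)" for x D
    using has_derivative_transform_within_open[OF that(2) assms(2) that(1)] assms(3) by blast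
  with assms(1) show ?thesis unfolding C2_on_def by meson
qed

text \<open>Different neighbourhoods come with different witnesses;
  \<open>frechet_derivative\<close> is a canonical global choice that agrees with each of them by
  uniqueness of derivatives.\<close>

lemma C2_on_locally:
  fixes f :: "'v::euclidean_space \<Rightarrow> real"
  assumes "open S" "\<And>x. x \<in> S \<Longrightarrow> \<exists>T. open T \<and> x \<in> T \<and> C2_on T f"
  shows "C2_on S f"
proof -
  define D where "D x = frechet_derivative f (at x)" for x
  define H where "H x u v = frechet_derivative (\<lambda>x. D x v) (at x) u" for x u v
  have *: "\<exists>D' H'. C2_hess T f D' H' \<and> (\<forall>y\<in>T. D y = D' y \<and> (\<forall>u v. H y u v = H' y u v))"
    if "open T" and T: "C2_on T f" for T
  proof -
    obtain D' H' where h: "C2_hess T f D' H'" using C2_on_imp_C2_hess[OF T] by blast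
    have D: "D y = D' y" if "y \<in> T" for y
      using h frechet_derivative_at[of f "D' y" y] that by (auto simp: C2_hess_def D_def)
    have "H y u v = H' y u v" if "y \<in> T" for y u v
    proof -
      have "((\<lambda>x. D' x v) has_derivative (\<lambda>u. H' y u v)) (at y)"
        using h that by (auto simp: C2_hess_def)
      then have "((\<lambda>x. D x v) has_derivative (\<lambda>u. H' y u v)) (at y)"
        by (rule has_derivative_transform_within_open[OF _ \<open>open T\<close> that]) (simp add: D)
      from frechet_derivative_at[OF this] show ?thesis unfolding H_def by (rule fun_cong[symmetric])
    qed
    with h D show ?thesis by blast
  qed
  have "C2_hess S f D H"
    unfolding C2_hess_def
  proof (intro conjI ballI allI)
    fix x assume "x \<in> S"
    then obtain T where T: "open T" "x \<in> T" "C2_on T f" using assms by blast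
    obtain D' H' where h: "C2_hess T f D' H'" "\<And>y. y \<in> T \<Longrightarrow> D y = D' y"
      "\<And>y u v. y \<in> T \<Longrightarrow> H y u v = H' y u v"
      using *[OF T(1,3)] by blast
    show "(f has_derivative D x) (at x)" using h T by (auto simp: C2_hess_def)
    fix v
    have "((\<lambda>x. D' x v) has_derivative (\<lambda>u. H' x u v)) (at x)"
      using h T by (auto simp: C2_hess_def)
    then have "((\<lambda>x. D x v) has_derivative (\<lambda>u. H' x u v)) (at x)"
      by (rule has_derivative_transform_within_open[OF _ T(1,2)]) (simp add: h)
    then show "((\<lambda>x. D x v) has_derivative (\<lambda>u. H x u v)) (at x)" using h T by simp
  next
    fix u v
    show "continuous_on S (\<lambda>x. H x u v)"
    proof (rule continuous_at_imp_continuous_on, rule ballI)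
      fix x assume "x \<in> S"
      then obtain T where T: "open T" "x \<in> T" "C2_on T f" using assms by blast
      obtain D' H' where h: "C2_hess T f D' H'" "\<And>y. y \<in> T \<Longrightarrow> D y = D' y"
        "\<And>y u v. y \<in> T \<Longrightarrow> H y u v = H' y u v"
        using *[OF T(1,3)] by blast
      have "continuous_on T (\<lambda>x. H' x u v)" using h by (auto simp: C2_hess_def)
      then have "continuous_on T (\<lambda>x. H x u v)"
        by (subst continuous_on_cong[OF refl]) (auto simp: h)
      then show "isCont (\<lambda>x. H x u v) x" using T continuous_on_eq_continuous_at by blast
    qed
  qed
  then show ?thesis using C2_hess_imp_C2_on assms(1) by blast
qed

lemma C2_on_mult:
  fixes f g :: "'v::euclidean_space \<Rightarrow> real"
  assumes "C2_on S f" "C2_on S g" "open S"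
  shows "C2_on S (\<lambda>x. f x * g x)"
proof -
  obtain D H where f: "C2_hess S f D H" using C2_on_imp_C2_hess[OF assms(1)] by blast
  obtain D' H' where g: "C2_hess S g D' H'" using C2_on_imp_C2_hess[OF assms(2)] by blast
  have c: "continuous_on S f" "continuous_on S g"
    using assms C2_on_imp_continuous_on by auto
  have cD: "continuous_on S (\<lambda>x. D x v)" "continuous_on S (\<lambda>x. D' x v)" for v
    using f g has_derivative_continuous
    by (auto intro!: continuous_at_imp_continuous_on simp: C2_hess_def) blast+
  have "C2_hess S (\<lambda>x. f x * g x) (\<lambda>x v. f x * D' x v + D x v * g x)
     (\<lambda>x u v. f x * H' x u v + D x u * D' x v + (D x v * D' x u + H x u v * g x))"
    using f g unfolding C2_hess_def
    by (auto intro!: derivative_intros continuous_intros c cD)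
  then show ?thesis using C2_hess_imp_C2_on assms(3) by blast
qed

lemma C2_on_compose_real:
  fixes f :: "'v::euclidean_space \<Rightarrow> real"
  assumes "C2_on S f" "open S" "f ` S \<subseteq> T"
    and h1: "\<And>y. y \<in> T \<Longrightarrow> (h has_real_derivative h1 y) (at y)"
    and h2: "\<And>y. y \<in> T \<Longrightarrow> (h1 has_real_derivative h2 y) (at y)" and c: "continuous_on T h2"
  shows "C2_on S (\<lambda>x. h (f x))"
proof -
  obtain D H where f: "C2_hess S f D H" using C2_on_imp_C2_hess[OF assms(1)] by blast
  have c: "continuous_on S (\<lambda>x. h2 (f x))"
    using continuous_on_compose2[OF c C2_on_imp_continuous_on[OF assms(1)]] assms(3) by blast
  have c1: "continuous_on S (\<lambda>x. h1 (f x))"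
    using continuous_on_compose2[OF _ C2_on_imp_continuous_on[OF assms(1)] assms(3), of h1]
      h2 DERIV_isCont continuous_at_imp_continuous_on by blast
  have cD: "continuous_on S (\<lambda>x. D x v)" for v
    using f has_derivative_continuous
    by (auto intro!: continuous_at_imp_continuous_on simp: C2_hess_def) blast+
  have chain: "((\<lambda>x. g (f x)) has_derivative (\<lambda>u. d * D x u)) (at x)"
    if "x \<in> S" "(g has_real_derivative d) (at (f x))" for x g d
    using has_derivative_compose[of f "D x" x UNIV g "\<lambda>y. d * y"] f that
    by (simp add: C2_hess_def has_field_derivative_def)
  have "C2_hess S (\<lambda>x. h (f x)) (\<lambda>x v. h1 (f x) * D x v)
     (\<lambda>x u v. h1 (f x) * H x u v + h2 (f x) * D x u * D x v)"
    using f assms(3) unfolding C2_hess_def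
    by (auto intro!: continuous_intros c c1 cD chain h1 h2 has_derivative_mult)
  then show ?thesis using C2_hess_imp_C2_on assms(2) by blast
qed

section \<open>Directional derivatives along real lines\<close>

lemma dir_deriv_eq:
  assumes "(F has_derivative F') (at w)"
  shows "dir_deriv v F w = F' v"
proof -
  have "((\<lambda>t. F (w + t *\<^sub>R v)) has_derivative (\<lambda>t. F' (t *\<^sub>R v))) (at 0)"
    by (rule has_derivative_compose[of "\<lambda>t. w + t *\<^sub>R v" "\<lambda>t. t *\<^sub>R v" 0 UNIV F F'])
       (use assms in \<open>auto intro!: derivative_eq_intros\<close>)
  then have "((\<lambda>t. F (w + t *\<^sub>R v)) has_vector_derivative F' v) (at 0)"
    using linear_cmul[OF has_derivative_linear[OF assms]] by (simp add: has_vector_derivative_def)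
  then show ?thesis unfolding dir_deriv_def by (rule vector_derivative_at)
qed

lemma dir_deriv_cong:
  assumes "\<forall>\<^sub>F z in nhds w. f z = g z"
  shows "dir_deriv v f w = dir_deriv v g w"
proof -
  have "((\<lambda>t. w + t *\<^sub>R v) \<longlongrightarrow> w + 0 *\<^sub>R v) (nhds 0)"
    by (intro tendsto_intros filterlim_ident)
  then have "\<forall>\<^sub>F t::real in nhds 0. f (w + t *\<^sub>R v) = g (w + t *\<^sub>R v)"
    using eventually_compose_filterlim[OF assms] by simp
  then show ?thesis unfolding dir_deriv_def by (intro vector_derivative_cong_eq) auto
qed

lemma dir_deriv_dir_deriv_eq:
  assumes "open S" "w \<in> S" "\<And>x. x \<in> S \<Longrightarrow> (f has_derivative D x) (at x)"
    "((\<lambda>x. D x v) has_derivative H) (at w)"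
  shows "dir_deriv u (dir_deriv v f) w = H u"
proof -
  have "\<forall>\<^sub>F z in nhds w. dir_deriv v f z = D z v"
    using eventually_nhds_in_open[OF assms(1,2)]
    by eventually_elim (rule dir_deriv_eq[OF assms(3)])
  from dir_deriv_cong[OF this] dir_deriv_eq[OF assms(4)] show ?thesis by simp
qed

lemma C2_hess_dir_deriv:
  assumes "C2_hess S f D H" "open S" "w \<in> S"
  shows "dir_deriv u (dir_deriv v f) w = H w u v" "dir_deriv v f w = D w v"
proof -
  have D: "\<And>x. x \<in> S \<Longrightarrow> (f has_derivative D x) (at x)"
    and H: "((\<lambda>x. D x v) has_derivative (\<lambda>u. H w u v)) (at w)"
    using assms by (auto simp: C2_hess_def)
  show "dir_deriv u (dir_deriv v f) w = H w u v"
    using dir_deriv_dir_deriv_eq[OF assms(2,3) D H] by simp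
  show "dir_deriv v f w = D w v" by (rule dir_deriv_eq[OF D[OF assms(3)]])
qed

lemma C2_on_has_d2:
  fixes f :: "'v::euclidean_space \<Rightarrow> real"
  assumes "C2_on S f" "open S" "w \<in> S"
  shows "has_d2 (\<lambda>t. f (w + t *\<^sub>R x)) (dir_deriv x f w) (dir_deriv x (dir_deriv x f) w)"
proof -
  obtain D H where f: "C2_hess S f D H" using C2_on_imp_C2_hess[OF assms(1)] by blast
  have line: "((\<lambda>t. g (w + t *\<^sub>R x)) has_real_derivative G x) (at t)"
    if "(g has_derivative G) (at (w + t *\<^sub>R x))" for g :: "'v \<Rightarrow> real" and G t
  proof -
    have "((\<lambda>t. g (w + t *\<^sub>R x)) has_derivative (\<lambda>t. G (t *\<^sub>R x))) (at t)"
      by (rule has_derivative_compose[of "\<lambda>t. w + t *\<^sub>R x" "\<lambda>t. t *\<^sub>R x" t UNIV g G])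
         (use that in \<open>auto intro!: derivative_eq_intros\<close>)
    then show ?thesis
      using linear_cmul[OF has_derivative_linear[OF that]]
      by (simp add: has_field_derivative_def mult_commute_abs)
  qed
  have "((\<lambda>t. w + t *\<^sub>R x) \<longlongrightarrow> w + 0 *\<^sub>R x) (nhds 0)"
    by (intro tendsto_intros filterlim_ident)
  then have "\<forall>\<^sub>F t::real in nhds 0. w + t *\<^sub>R x \<in> S"
    using topological_tendstoD[OF _ assms(2)] assms(3) by fastforce
  then have "\<forall>\<^sub>F t in nhds 0. ((\<lambda>t. f (w + t *\<^sub>R x)) has_real_derivative D (w + t *\<^sub>R x) x) (at t)"
  proof eventually_elim
    case (elim t)
    then show ?case using line[of f "D (w + t *\<^sub>R x)" t] f by (auto simp: C2_hess_def)
  qed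
  moreover have "((\<lambda>t. D (w + t *\<^sub>R x) x) has_real_derivative H w x x) (at 0)"
    using line[of "\<lambda>z. D z x" "\<lambda>u. H w u x" 0] f assms(3) by (auto simp: C2_hess_def)
  ultimately show ?thesis
    using C2_hess_dir_deriv[OF f assms(2,3)] by (intro has_d2I) auto
qed

section \<open>Holomorphic maps and the Levi form\<close>

lemma norm_vector_scalar_mult: "norm (c *s (x :: complex^'m)) = cmod c * norm x"
  by (simp add: norm_vec_def norm_mult L2_set_right_distrib)

lemma bounded_bilinear_vector_scalar_mult:
  "bounded_bilinear (\<lambda>c (x :: complex^'m). c *s x)"
proof
  show "\<exists>K. \<forall>c (x :: complex^'m). norm (c *s x) \<le> norm c * norm x * K"
    by (intro exI[of _ 1]) (simp add: norm_vector_scalar_mult)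
qed (auto simp: vec_eq_iff algebra_simps)

lemmas continuous_on_vector_scalar_mult [continuous_intros] =
  bounded_bilinear.continuous_on[OF bounded_bilinear_vector_scalar_mult]

lemma matrix_vector_mult_scalar: "(J :: complex^'m^'k) *v (c *s x) = c *s (J *v x)"
  by (simp add: vec_eq_iff matrix_vector_mult_def sum_distrib_left algebra_simps)

text \<open>
  The derivative in a fixed direction is a Cauchy integral over a circle in that direction, and the
  Leibniz rule makes it holomorphic again.
\<close>

locale scalar_holo =
  fixes S :: "(complex^'m) set" and f :: "complex^'m \<Rightarrow> complex" and D
  assumes open_S: "open S"
    and deriv: "w \<in> S \<Longrightarrow> (f has_derivative D w) (at w)"
    and clinear: "w \<in> S \<Longrightarrow> D w (c *s x) = c * D w x"
begin

lemma continuous: "continuous_on S f"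
  using deriv has_derivative_continuous continuous_at_imp_continuous_on by blast

lemma line_deriv:
  assumes "w + \<zeta> *s v \<in> S"
  shows "((\<lambda>\<zeta>. f (w + \<zeta> *s v)) has_field_derivative D (w + \<zeta> *s v) v) (at \<zeta>)"
proof -
  have "((\<lambda>\<zeta>. f (w + \<zeta> *s v)) has_derivative (\<lambda>h. D (w + \<zeta> *s v) (h *s v))) (at \<zeta>)"
  proof (rule has_derivative_compose[of "\<lambda>\<zeta>. w + \<zeta> *s v" "\<lambda>h. h *s v" \<zeta> UNIV f])
    have "bounded_linear (\<lambda>h. h *s v)"
      by (rule bounded_bilinear.bounded_linear_left[OF bounded_bilinear_vector_scalar_mult])
    from bounded_linear_imp_has_derivative[OF this]
    show "((\<lambda>\<zeta>. w + \<zeta> *s v) has_derivative (\<lambda>h. h *s v)) (at \<zeta>)"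
      by (auto intro!: derivative_eq_intros)
  qed (use deriv assms in auto)
  then show ?thesis using clinear[OF assms] by (simp add: has_field_derivative_def mult_commute_abs)
qed

lemma deriv_eq_integral:
  assumes "0 < r" "\<And>\<zeta>. \<zeta> \<in> cball 0 r \<Longrightarrow> w + \<zeta> *s v \<in> S"
  shows "D w v = integral {0..1} (\<lambda>t. f (w + circlepath 0 r t *s v) / circlepath 0 r t)"
proof -
  let ?g = "\<lambda>\<zeta>. f (w + \<zeta> *s v)"
  have cancel: "x / (e - 0)\<^sup>2 * (c * e) = c * (x / e)" if "e \<noteq> 0" for x e c :: complex
    using that by (simp add: power2_eq_square)
  let ?I = "contour_integral (circlepath 0 r) (\<lambda>u. ?g u / (u - 0)\<^sup>2)"
  have der: "\<And>\<zeta>. \<zeta> \<in> cball 0 r \<Longrightarrow> (?g has_field_derivative D (w + \<zeta> *s v) v) (at \<zeta>)"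
    by (rule line_deriv[OF assms(2)])
  have "(?g has_field_derivative (1 / (2 * of_real pi * \<i>) * ?I)) (at 0)"
  proof (rule Cauchy_derivative_integral_circlepath(2))
    show "continuous_on (cball 0 r) ?g"
      by (rule DERIV_continuous_on[OF has_field_derivative_at_within[OF der]])
    show "?g holomorphic_on ball 0 r"
      unfolding holomorphic_on_def field_differentiable_def
    proof
      fix \<zeta> :: complex assume "\<zeta> \<in> ball 0 r"
      then have "(?g has_field_derivative D (w + \<zeta> *s v) v) (at \<zeta>)" by (intro der) auto
      then show "\<exists>g'. (?g has_field_derivative g') (at \<zeta> within ball 0 r)"
        using has_field_derivative_at_within by blast
    qed
  qed (use assms in auto)
  moreover have "(?g has_field_derivative D w v) (at 0)"
    using der[of 0] assms(1) by simp
  ultimately have "D w v = 1 / (2 * of_real pi * \<i>) * ?I"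
    by (rule DERIV_unique[rotated])
  also have "?I = integral {0..1} (\<lambda>t. ?g (circlepath 0 r t) / (circlepath 0 r t - 0)\<^sup>2 *
       vector_derivative (circlepath 0 r) (at t))"
    by (rule contour_integral_integral)
  \<comment> \<open>The velocity of a circle about 0 is \<open>2 * pi * \<i>\<close> times the
    circle itself, so it cancels one factor of the squared denominator and later the prefactor of
    Cauchy's formula.\<close>
  also have "\<dots> = integral {0..1} (\<lambda>t. (2 * of_real pi * \<i>) * (?g (circlepath 0 r t) / circlepath 0 r t))"
  proof (rule integral_cong)
    fix t :: real
    have vd: "vector_derivative (circlepath 0 r) (at t) = 2 * of_real pi * \<i> * circlepath 0 r t"
      using vector_derivative_circlepath[of 0 r t] by (simp add: circlepath)
    have nz: "circlepath 0 r t \<noteq> 0" using assms(1) by (simp add: circlepath)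
    show "?g (circlepath 0 r t) / (circlepath 0 r t - 0)\<^sup>2 *
       vector_derivative (circlepath 0 r) (at t) =
       (2 * of_real pi * \<i>) * (?g (circlepath 0 r t) / circlepath 0 r t)"
      unfolding vd by (rule cancel[OF nz])
  qed
  also have "\<dots> = (2 * of_real pi * \<i>) * integral {0..1} (\<lambda>t. ?g (circlepath 0 r t) / circlepath 0 r t)"
    by (rule integral_mult_right)
  finally show ?thesis by simp
qed

lemma disc_in_domain:
  assumes "w0 \<in> S"
  obtains \<delta> r where "0 < \<delta>" "0 < r" "\<And>w \<zeta>. w \<in> ball w0 \<delta> \<Longrightarrow> \<zeta> \<in> cball 0 r \<Longrightarrow> w + \<zeta> *s v \<in> S"
proof -
  obtain e where e: "e > 0" "ball w0 e \<subseteq> S" using open_S assms openE by blast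
  \<comment> \<open>The added 1 keeps the radius positive also for \<open>v = 0\<close>; the disc
    moves \<open>w\<close> by at most \<open>e / 2\<close>, and the other half of \<open>e\<close>
    is left for \<open>w\<close> itself.\<close>
  define r where "r = e / 2 / (norm v + 1)"
  have "w + \<zeta> *s v \<in> S" if "w \<in> ball w0 (e / 2)" "\<zeta> \<in> cball 0 r" for w \<zeta>
  proof -
    have "norm (\<zeta> *s v) \<le> r * (norm v + 1)"
      using that(2) e unfolding norm_vector_scalar_mult
      by (intro mult_mono) (auto simp: r_def)
    also have "\<dots> = e / 2"
      unfolding r_def using add_nonneg_pos[OF norm_ge_zero[of v] zero_less_one]
      by (metis less_irrefl nonzero_eq_divide_eq)
    finally have "dist w (w + \<zeta> *s v) \<le> e / 2" by (simp add: dist_norm)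
    moreover have "dist w0 w < e / 2" using that(1) by simp
    ultimately have "dist w0 (w + \<zeta> *s v) < e"
      using dist_triangle[of w0 "w + \<zeta> *s v" w] by linarith
    then show ?thesis using e by auto
  qed
  moreover have "0 < r" using e norm_ge_zero[of v] by (simp add: r_def add_nonneg_pos)
  ultimately show ?thesis using that[of "e / 2" r] e by simp
qed

lemma continuous_on_circle:
  fixes g :: "complex^'m \<Rightarrow> complex"
  assumes "0 < r" "\<And>w \<zeta>. w \<in> U \<Longrightarrow> \<zeta> \<in> cball 0 r \<Longrightarrow> w + \<zeta> *s v \<in> S" "continuous_on S g"
  shows "continuous_on (U \<times> cbox 0 1)
           (\<lambda>(w, t). g (w + circlepath 0 r t *s v) / circlepath 0 r t)"
proof -
  have *: "w + circlepath 0 r t *s v \<in> S" if "w \<in> U" for w and t :: real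
    by (rule assms(2)[OF that]) (use assms(1) in \<open>simp add: circlepath norm_mult\<close>)
  have "continuous_on (U \<times> cbox 0 1) (\<lambda>p. g (fst p + circlepath 0 r (snd p) *s v) / circlepath 0 r (snd p))"
    by (intro continuous_on_divide continuous_on_compose2[OF assms(3)] continuous_intros)
       (use * assms(1) in \<open>auto simp: circlepath intro!: continuous_intros\<close>)
  then show ?thesis by (simp add: case_prod_unfold)
qed

text \<open>Near \<open>w0\<close> one radius serves all \<open>w\<close>, so \<open>D w v\<close>
  is a parameter integral with continuous integrand. This has to precede
  \<open>differentiable_D\<close>: the Leibniz rule asks for a jointly continuous derivative of the
  integrand, and that derivative contains \<open>D\<close> itself.\<close>

lemma continuous_D: "continuous_on S (\<lambda>w. D w v)"
proof (rule continuous_at_imp_continuous_on, rule ballI)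
  fix w0 assume "w0 \<in> S"
  obtain \<delta> r where \<delta>: "0 < \<delta>" "0 < r"
    "\<And>w \<zeta>. w \<in> ball w0 \<delta> \<Longrightarrow> \<zeta> \<in> cball 0 r \<Longrightarrow> w + \<zeta> *s v \<in> S"
    using disc_in_domain[OF \<open>w0 \<in> S\<close>, of v] by blast
  have "continuous_on (ball w0 \<delta>)
     (\<lambda>w. integral (cbox 0 1) (\<lambda>t. f (w + circlepath 0 r t *s v) / circlepath 0 r t))"
    by (rule integral_continuous_on_param[OF continuous_on_circle[OF \<delta>(2,3) continuous]])
  then have "continuous_on (ball w0 \<delta>) (\<lambda>w. D w v)"
    by (rule continuous_on_eq) (use deriv_eq_integral[OF \<delta>(2)] \<delta>(3) in \<open>simp only: cbox_interval\<close>)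
  then show "isCont (\<lambda>w. D w v) w0" using \<delta>(1) by (simp add: continuous_on_eq_continuous_at)
qed

lemma differentiable_D:
  assumes "w0 \<in> S"
  shows "\<exists>E. ((\<lambda>w. D w v) has_derivative E) (at w0) \<and> (\<forall>c x. E (c *s x) = c * E x)"
proof -
  obtain \<delta> r where \<delta>: "0 < \<delta>" "0 < r"
    "\<And>w \<zeta>. w \<in> ball w0 \<delta> \<Longrightarrow> \<zeta> \<in> cball 0 r \<Longrightarrow> w + \<zeta> *s v \<in> S"
    using disc_in_domain[OF assms, of v] by blast
  let ?c = "circlepath 0 r"
  have in_S: "w + ?c t *s v \<in> S" if "w \<in> ball w0 \<delta>" for w and t :: real
    by (rule \<delta>(3)[OF that]) (use \<delta>(2) in \<open>simp add: circlepath norm_mult\<close>)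
  \<comment> \<open>The derivative of the integrand in \<open>w\<close>, packed as a bounded
    operator in the form that \<open>leibniz_rule\<close> expects.\<close>
  define fx where "fx w t = Blinfun (\<lambda>x. D (w + ?c t *s v) x / ?c t)" for w t
  have fx: "blinfun_apply (fx w t) = (\<lambda>x. D (w + ?c t *s v) x / ?c t)" if "w \<in> ball w0 \<delta>" for w t
    unfolding fx_def
    by (rule bounded_linear_Blinfun_apply, rule bounded_linear_compose[OF bounded_linear_divide],
        rule has_derivative_bounded_linear[OF deriv[OF in_S[OF that]]])
  have cfx: "continuous_on (ball w0 \<delta> \<times> cbox 0 1) (\<lambda>(w, t). fx w t)"
  proof (rule continuous_on_blinfun_componentwise)
    fix i :: "complex^'m"
    from continuous_on_circle[OF \<delta>(2,3) continuous_D[of i]]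
    show "continuous_on (ball w0 \<delta> \<times> cbox 0 1) (\<lambda>p. blinfun_apply (case p of (w, t) \<Rightarrow> fx w t) i)"
      by (rule continuous_on_eq) (auto simp: fx)
  qed
  have cf: "continuous_on (ball w0 \<delta> \<times> cbox 0 1) (\<lambda>(w, t). f (w + ?c t *s v) / ?c t)"
    by (rule continuous_on_circle[OF \<delta>(2,3) continuous])
  let ?E = "integral (cbox 0 1) (fx w0)"
  have "((\<lambda>w. integral (cbox 0 1) (\<lambda>t. f (w + ?c t *s v) / ?c t)) has_derivative ?E)
     (at w0 within ball w0 \<delta>)"
  proof (rule leibniz_rule[OF _ _ cfx])
    fix w and t :: real assume w: "w \<in> ball w0 \<delta>"
    have "((\<lambda>w. f (w + ?c t *s v)) has_derivative D (w + ?c t *s v)) (at w)"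
      by (rule has_derivative_compose[of "\<lambda>w. w + ?c t *s v" "\<lambda>h. h" w UNIV f, OF _ deriv[OF in_S[OF w]]])
         (auto intro!: derivative_eq_intros)
    then show "((\<lambda>w. f (w + ?c t *s v) / ?c t) has_derivative blinfun_apply (fx w t)) (at w within ball w0 \<delta>)"
      unfolding fx[OF w] by (rule has_derivative_at_withinI[OF bounded_linear.has_derivative[OF bounded_linear_divide]])
  next
    fix w assume w: "w \<in> ball w0 \<delta>"
    have "continuous_on (cbox 0 1) (\<lambda>t::real. (w, t))" by (intro continuous_intros)
    from continuous_on_compose2[OF cf this] w
    have "continuous_on (cbox 0 1) (\<lambda>t. f (w + ?c t *s v) / ?c t)" by (simp add: image_subset_iff)
    then show "(\<lambda>t. f (w + ?c t *s v) / ?c t) integrable_on cbox 0 1"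
      by (rule integrable_continuous)
  qed (use \<delta> in auto)
  then have "((\<lambda>w. integral (cbox 0 1) (\<lambda>t. f (w + ?c t *s v) / ?c t)) has_derivative ?E) (at w0)"
    using \<delta>(1) by (simp add: at_within_open[of w0 "ball w0 \<delta>"])
  then have 1: "((\<lambda>w. D w v) has_derivative ?E) (at w0)"
    by (rule has_derivative_transform_within_open[of _ _ _ _ "ball w0 \<delta>"])
       (use deriv_eq_integral[OF \<delta>(2)] \<delta> in \<open>simp_all only: cbox_interval open_ball centre_in_ball\<close>)
  have "continuous_on (cbox 0 1) (fx w0)"
  proof -
    have "continuous_on (cbox 0 1) (\<lambda>t::real. (w0, t))" by (intro continuous_intros)
    from continuous_on_compose2[OF cfx this] \<delta>(1) show ?thesis by (simp add: image_subset_iff)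
  qed
  then have int: "fx w0 integrable_on cbox 0 1" by (rule integrable_continuous)
  have w0: "w0 \<in> ball w0 \<delta>" using \<delta>(1) by simp
  \<comment> \<open>Complex linearity of \<open>D\<close> at every point of the circle lets the
    factor \<open>c\<close> leave the integral.\<close>
  have "blinfun_apply ?E (c *s x) = c * blinfun_apply ?E x" for c x
    unfolding blinfun_apply_integral[OF int] fx[OF w0] clinear[OF in_S[OF w0]]
    by (simp only: times_divide_eq_right[symmetric] integral_mult_right)
  with 1 show ?thesis by blast
qed

end

lemma holo_onE:
  fixes F :: "complex^'m \<Rightarrow> complex^'k"
  assumes "holo_on S F"
  obtains J where "\<And>w. w \<in> S \<Longrightarrow> (F has_derivative (\<lambda>x. J w *v x)) (at w)"
  using assms unfolding holo_on_def by metis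

lemma holo_on_subset: "holo_on S F \<Longrightarrow> T \<subseteq> S \<Longrightarrow> holo_on T F"
  unfolding holo_on_def by blast

lemma holo_on_imp_continuous_on: "holo_on S F \<Longrightarrow> continuous_on S F"
  unfolding holo_on_def using has_derivative_continuous continuous_at_imp_continuous_on by blast

lemma scalar_holo_component:
  fixes F :: "complex^'m \<Rightarrow> complex^'k"
  assumes "open S" "\<And>w. w \<in> S \<Longrightarrow> (F has_derivative (\<lambda>x. J w *v x)) (at w)"
  shows "scalar_holo S (\<lambda>w. F w $ k) (\<lambda>w x. (J w *v x) $ k)"
proof
  fix w assume "w \<in> S"
  from bounded_linear.has_derivative[OF bounded_linear_vec_nth assms(2)[OF this]]
  show "((\<lambda>w. F w $ k) has_derivative (\<lambda>x. (J w *v x) $ k)) (at w)" .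
qed (use assms in \<open>auto simp: matrix_vector_mult_scalar\<close>)

lemma clinear_eq_matrix:
  fixes L :: "complex^'m \<Rightarrow> complex^'k"
  assumes "bounded_linear L" "\<And>c x. L (c *s x) = c *s L x"
  shows "\<exists>J. L = (\<lambda>x. J *v x)"
proof -
  have "Vector_Spaces.linear (*s) (*s) L"
    by (intro Vector_Spaces.linear_iff[THEN iffD2])
       (use assms in \<open>auto simp: linear_simps vec.vector_space_axioms\<close>)
  then have "matrix L *v x = L x" for x by (rule matrix_works)
  then show ?thesis by metis
qed

text \<open>The derivative of a holomorphic map in a fixed direction is holomorphic again; this
  provides the second derivatives that \<open>C2_on\<close> demands from a holomorphic inner map.
  Components are treated separately and reassembled.\<close>

lemma holo_on_derivative:
  fixes F :: "complex^'m \<Rightarrow> complex^'k"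
  assumes "open S" "\<And>w. w \<in> S \<Longrightarrow> (F has_derivative (\<lambda>x. J w *v x)) (at w)"
  shows "holo_on S (\<lambda>w. J w *v v)"
  unfolding holo_on_def
proof
  fix w assume w: "w \<in> S"
  have "\<forall>k. \<exists>E. ((\<lambda>w. (J w *v v) $ k) has_derivative E) (at w) \<and> (\<forall>c x. E (c *s x) = c * E x)"
    using scalar_holo.differentiable_D[OF scalar_holo_component[OF assms] w] by blast
  then obtain E where E: "\<And>k. ((\<lambda>w. (J w *v v) $ k) has_derivative E k) (at w)"
    "\<And>k c x. E k (c *s x) = c * E k x" by metis
  have der: "((\<lambda>w. J w *v v) has_derivative (\<lambda>x. \<chi> k. E k x)) (at w)"
    by (subst has_derivative_componentwise_within)
       (auto simp: Basis_vec_def inner_axis intro!: has_derivative_inner_left E)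
  obtain J' where "(\<lambda>x. \<chi> k. E k x) = (\<lambda>x. J' *v x)"
    using clinear_eq_matrix[OF has_derivative_bounded_linear[OF der]] E(2)
    by (auto simp: vec_eq_iff)
  with der show "\<exists>J'. ((\<lambda>w. J w *v v) has_derivative (\<lambda>x. J' *v x)) (at w)"
    by (intro exI[of _ J']) simp
qed

text \<open>
  The Laplacian at \<open>0\<close> of \<open>f\<close> restricted to the complex line through \<open>w\<close> in direction \<open>x\<close>; it is four
  times the Levi form.
\<close>

definition line_laplacian :: "(complex^'m \<Rightarrow> real) \<Rightarrow> complex^'m \<Rightarrow> complex^'m \<Rightarrow> real" where
  "line_laplacian f w x =
     dir_deriv x (dir_deriv x f) w + dir_deriv (\<i> *s x) (dir_deriv (\<i> *s x) f) w"

lemma line_laplacian_eq: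
  assumes "C2_on S f" "open S" "w \<in> S"
    "has_d2 (\<lambda>t. f (w + t *\<^sub>R x)) a b" "has_d2 (\<lambda>t. f (w + t *\<^sub>R (\<i> *s x))) a' b'"
  shows "line_laplacian f w x = b + b'"
  using has_d2_unique(2)[OF C2_on_has_d2[OF assms(1-3)] assms(4)]
    has_d2_unique(2)[OF C2_on_has_d2[OF assms(1-3)] assms(5)]
  by (simp add: line_laplacian_def)

text \<open>Both claims rest on one Hessian: that of \<open>f\<close> evaluated along the Jacobian,
  plus the gradient of \<open>f\<close> applied to the second derivative of \<open>F\<close>. The
  latter is complex linear in both directions, so its values at \<open>(v, v)\<close> and
  \<open>(\<i> *s v, \<i> *s v)\<close> are opposite and drop out of the line Laplacian.\<close>

lemma C2_on_holo_compose_aux: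
  fixes F :: "complex^'m \<Rightarrow> complex^'k" and f :: "complex^'k \<Rightarrow> real"
  assumes f: "C2_on T f" and S: "open S" and F: "holo_on S F" "F ` S \<subseteq> T"
  shows "C2_on S (\<lambda>w. f (F w)) \<and>
     (open T \<longrightarrow> (\<forall>w\<in>S. \<forall>J v. (F has_derivative (\<lambda>x. J *v x)) (at w) \<longrightarrow>
         line_laplacian (\<lambda>w. f (F w)) w v = line_laplacian f (F w) (J *v v)))"
proof -
  obtain D :: "complex^'k \<Rightarrow> (complex^'k) \<Rightarrow>\<^sub>L real" and H where
    D: "\<And>x. x \<in> T \<Longrightarrow> (f has_derivative blinfun_apply (D x)) (at x)"
    and H: "\<And>x. x \<in> T \<Longrightarrow> (D has_derivative blinfun_apply (H x)) (at x)" and cH: "continuous_on T H"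
    using f unfolding C2_on_def by blast
  obtain J where J: "\<And>w. w \<in> S \<Longrightarrow> (F has_derivative (\<lambda>x. J w *v x)) (at w)"
    using holo_onE[OF F(1)] by blast
  have "\<forall>v. \<exists>J2. \<forall>w\<in>S. ((\<lambda>w. J w *v v) has_derivative (\<lambda>x. J2 w *v x)) (at w)"
    using holo_on_derivative[OF S J] unfolding holo_on_def by metis
  then obtain J2 where J2: "\<And>v w. w \<in> S \<Longrightarrow> ((\<lambda>w. J w *v v) has_derivative (\<lambda>x. J2 v w *v x)) (at w)"
    by metis
  have cJ: "continuous_on S (\<lambda>w. J w *v v)" for v
    by (rule holo_on_imp_continuous_on[OF holo_on_derivative[OF S J]])
  have cJ2: "continuous_on S (\<lambda>w. J2 v w *v u)" for u v
    by (rule holo_on_imp_continuous_on[OF holo_on_derivative[OF S J2]])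
  have cF: "continuous_on S F" by (rule holo_on_imp_continuous_on[OF F(1)])
  have FT: "F w \<in> T" if "w \<in> S" for w using F(2) that by blast
  have cDF: "continuous_on S (\<lambda>w. D (F w))"
    by (rule continuous_on_compose2[OF _ cF F(2)])
       (use H has_derivative_continuous in \<open>blast intro: continuous_at_imp_continuous_on\<close>)
  have cHF: "continuous_on S (\<lambda>w. H (F w))"
    by (rule continuous_on_compose2[OF cH cF F(2)])
  let ?D = "\<lambda>w v. D (F w) (J w *v v)"
  let ?H = "\<lambda>w u v. blinfun_apply (D (F w)) (J2 v w *v u) + blinfun_apply (H (F w) (J w *v u)) (J w *v v)"
  have hess: "C2_hess S (\<lambda>w. f (F w)) ?D ?H"
    unfolding C2_hess_def
  proof (intro conjI ballI allI)
    fix w assume w: "w \<in> S"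
    show "((\<lambda>w. f (F w)) has_derivative ?D w) (at w)"
      by (rule has_derivative_compose[OF J[OF w] D[OF FT[OF w]]])
    fix v
    have "((\<lambda>w. D (F w)) has_derivative (\<lambda>x. H (F w) (J w *v x))) (at w)"
      by (rule has_derivative_compose[OF J[OF w] H[OF FT[OF w]]])
    from bounded_bilinear.FDERIV[OF bounded_bilinear_blinfun_apply this J2[OF w]]
    show "((\<lambda>w. ?D w v) has_derivative (\<lambda>u. ?H w u v)) (at w)" .
  next
    fix u v
    show "continuous_on S (\<lambda>w. ?H w u v)" by (intro continuous_intros cDF cHF cJ cJ2)
  qed
  have "line_laplacian (\<lambda>w. f (F w)) w v = line_laplacian f (F w) (J' *v v)"
    if "open T" and w: "w \<in> S" and J': "(F has_derivative (\<lambda>x. J' *v x)) (at w)" for w J' v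
  proof -
    have hf: "C2_hess T f (\<lambda>x. blinfun_apply (D x)) (\<lambda>x u v. blinfun_apply (blinfun_apply (H x) u) v)"
      unfolding C2_hess_def
      by (auto intro!: D H derivative_eq_intros continuous_intros cH simp: blinfun.zero_right)
    have JJ: "J' *v x = J w *v x" for x
      using has_derivative_unique[OF J' J[OF w]] by metis
    \<comment> \<open>Complex linearity of the second derivative in the direction \<open>v\<close>,
      by uniqueness of the derivative; linearity in the other direction is built into the matrix
      \<open>J2 v w\<close>. The two factors \<open>\<i>\<close> produce the minus sign.\<close>
    have "((\<lambda>w. J w *v (\<i> *s v)) has_derivative (\<lambda>x. \<i> *s (J2 v w *v x))) (at w)"
      unfolding matrix_vector_mult_scalar
      by (rule bounded_linear.has_derivative[OF bounded_bilinear.bounded_linear_right[OF bounded_bilinear_vector_scalar_mult] J2[OF w]])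
    from has_derivative_unique[OF this J2[OF w]]
    have "J2 (\<i> *s v) w *v x = \<i> *s (J2 v w *v x)" for x by metis
    then have "J2 (\<i> *s v) w *v (\<i> *s v) = - (J2 v w *v v)"
      by (simp add: matrix_vector_mult_scalar vec_eq_iff)
    then show ?thesis
      unfolding line_laplacian_def C2_hess_dir_deriv(1)[OF hess S w]
        C2_hess_dir_deriv(1)[OF hf \<open>open T\<close> FT[OF w]] JJ matrix_vector_mult_scalar
      by (simp add: blinfun.minus_right)
  qed
  with C2_hess_imp_C2_on[OF hess S] show ?thesis by blast
qed

lemma C2_on_holo_compose:
  fixes F :: "complex^'m \<Rightarrow> complex^'k"
  assumes "C2_on T f" "open S" "holo_on S F" "F ` S \<subseteq> T"
  shows "C2_on S (\<lambda>w. f (F w))"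
  using C2_on_holo_compose_aux[OF assms] by blast

lemma line_laplacian_holo_compose:
  fixes F :: "complex^'m \<Rightarrow> complex^'k"
  assumes "C2_on T f" "open S" "holo_on S F" "F ` S \<subseteq> T" "open T" "w \<in> S"
    "(F has_derivative (\<lambda>x. J *v x)) (at w)"
  shows "line_laplacian (\<lambda>w. f (F w)) w v = line_laplacian f (F w) (J *v v)"
  using C2_on_holo_compose_aux[OF assms(1-4)] assms(5-7) by blast

lemma linear_axis_expansion:
  fixes L :: "complex^'m \<Rightarrow> 'b::real_vector"
  assumes "linear L"
  shows "L x = (\<Sum>j\<in>UNIV. Re (x $ j) *\<^sub>R L (axis j 1) + Im (x $ j) *\<^sub>R L (axis j \<i>))"
proof -
  have "x = (\<Sum>j\<in>UNIV. Re (x $ j) *\<^sub>R axis j 1 + Im (x $ j) *\<^sub>R axis j \<i>)"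
  proof (rule vec_eq_iff[THEN iffD2], rule allI)
    fix i
    have "(\<Sum>j\<in>UNIV. Re (x $ j) *\<^sub>R axis j (1::complex) + Im (x $ j) *\<^sub>R axis j \<i>) $ i =
        (\<Sum>j\<in>UNIV. if j = i then x $ j else 0)"
      unfolding sum_component by (intro sum.cong refl) (auto simp: axis_def complex_eq_iff)
    then show "x $ i = (\<Sum>j\<in>UNIV. Re (x $ j) *\<^sub>R axis j 1 + Im (x $ j) *\<^sub>R axis j \<i>) $ i" by simp
  qed
  then have "L x = L (\<Sum>j\<in>UNIV. Re (x $ j) *\<^sub>R axis j 1 + Im (x $ j) *\<^sub>R axis j \<i>)" by simp
  then show ?thesis
    by (simp add: linear_sum[OF assms] linear_add[OF assms] linear_cmul[OF assms])
qed

text \<open>A real-linear \<open>L\<close> splits into a complex-linear and a conjugate-linear part.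
  The two sums are twice these parts, evaluated at \<open>x\<close>.\<close>

lemma wirtinger_sums:
  fixes L :: "complex^'m \<Rightarrow> complex"
  assumes "linear L"
  shows "(\<Sum>j\<in>UNIV. x $ j * (L (axis j 1) - \<i> * L (axis j \<i>))) = L x - \<i> * L (\<i> *s x)"
    and "(\<Sum>j\<in>UNIV. cnj (x $ j) * (L (axis j 1) + \<i> * L (axis j \<i>))) = L x + \<i> * L (\<i> *s x)"
  by (subst (1 2) linear_axis_expansion[OF assms],
      simp add: sum_distrib_left sum.distrib[symmetric] sum_subtractf[symmetric],
      intro sum.cong, auto simp: complex_eq_iff algebra_simps scaleR_conv_of_real)+

text \<open>Contracting over \<open>j\<close> and then over \<open>k\<close> with
  \<open>wirtinger_sums\<close> turns the double sum into values of the real Hessian at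
  \<open>x\<close> and \<open>\<i> *s x\<close>. The mixed values carry a factor
  \<open>\<i>\<close>, so the real part retains the two diagonal ones.\<close>

lemma levi_form_eq_line_laplacian:
  fixes f :: "complex^'m \<Rightarrow> real"
  assumes "C2_on S f" "open S" "w \<in> S"
  shows "Re (levi_form f w x) = line_laplacian f w x / 4"
proof -
  obtain D :: "complex^'m \<Rightarrow> (complex^'m) \<Rightarrow>\<^sub>L real" and H where
    D: "\<And>x. x \<in> S \<Longrightarrow> (f has_derivative blinfun_apply (D x)) (at x)"
    and H: "\<And>x. x \<in> S \<Longrightarrow> (D has_derivative blinfun_apply (H x)) (at x)" and cH: "continuous_on S H"
    using assms unfolding C2_on_def by blast
  define h where "h u v = complex_of_real (H w u v)" for u v
  have hess: "C2_hess S f (\<lambda>x. blinfun_apply (D x)) (\<lambda>x u v. blinfun_apply (blinfun_apply (H x) u) v)"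
    unfolding C2_hess_def
    by (auto intro!: D H derivative_eq_intros continuous_intros cH simp: blinfun.zero_right)
  have dof: "((\<lambda>z. complex_of_real (f z)) has_derivative (\<lambda>u. complex_of_real (D z u))) (at z)" if "z \<in> S" for z
    by (rule has_derivative_of_real[OF D[OF that]])
  have zbar: "d_zbar k (\<lambda>z. complex_of_real (f z)) z =
     (complex_of_real (D z (axis k 1)) + \<i> * complex_of_real (D z (axis k \<i>))) / 2" if "z \<in> S" for k z
    unfolding d_zbar_def dir_deriv_eq[OF dof[OF that]] ..
  have dD: "((\<lambda>z. complex_of_real (D z v)) has_derivative (\<lambda>u. h u v)) (at w)" for v
    unfolding h_def by (intro has_derivative_of_real) (use hess assms in \<open>auto simp: C2_hess_def\<close>)
  have dd: "dir_deriv u (d_zbar k (\<lambda>z. complex_of_real (f z))) w = (h u (axis k 1) + \<i> * h u (axis k \<i>)) / 2"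
    for u k
  proof -
    have "\<forall>\<^sub>F z in nhds w. d_zbar k (\<lambda>z. complex_of_real (f z)) z =
      (complex_of_real (D z (axis k 1)) + \<i> * complex_of_real (D z (axis k \<i>))) / 2"
      using eventually_nhds_in_open[OF assms(2,3)] by eventually_elim (rule zbar)
    from dir_deriv_cong[OF this]
    have "dir_deriv u (d_zbar k (\<lambda>z. complex_of_real (f z))) w = dir_deriv u
      (\<lambda>z. (complex_of_real (D z (axis k 1)) + \<i> * complex_of_real (D z (axis k \<i>))) / 2) w" .
    also have "\<dots> = (h u (axis k 1) + \<i> * h u (axis k \<i>)) / 2"
      by (rule dir_deriv_eq)
         (rule bounded_linear.has_derivative[OF bounded_linear_divide has_derivative_add[OF dD
            has_derivative_mult_right[OF dD]]])
    finally show ?thesis .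
  qed
  have lin: "linear (\<lambda>u. h u v)" "linear (\<lambda>v. h u v)" for u v
    unfolding h_def by (auto intro!: linearI simp: blinfun.bilinear_simps scaleR_conv_of_real[where 'a = complex])
  have lin2: "linear (\<lambda>u. h u (axis k 1) + \<i> * h u (axis k \<i>))" for k
    unfolding h_def by (auto intro!: linearI simp: blinfun.bilinear_simps scaleR_conv_of_real[where 'a = complex] algebra_simps)
  have "levi_form f w x = (\<Sum>j\<in>UNIV. \<Sum>k\<in>UNIV. cnj (x $ k) * (x $ j * ((h (axis j 1) (axis k 1) + \<i> * h (axis j 1) (axis k \<i>))
       - \<i> * (h (axis j \<i>) (axis k 1) + \<i> * h (axis j \<i>) (axis k \<i>))))) / 4"
    unfolding levi_form_def d_z_def dd sum_divide_distrib
    by (intro sum.cong refl) (simp add: field_simps)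
  also have "\<dots> = (\<Sum>k\<in>UNIV. cnj (x $ k) * (\<Sum>j\<in>UNIV. x $ j * ((h (axis j 1) (axis k 1) + \<i> * h (axis j 1) (axis k \<i>))
       - \<i> * (h (axis j \<i>) (axis k 1) + \<i> * h (axis j \<i>) (axis k \<i>))))) / 4"
    unfolding sum_distrib_left by (subst sum.swap) rule
  also have "\<dots> = (\<Sum>k\<in>UNIV. cnj (x $ k) * ((h x (axis k 1) + \<i> * h x (axis k \<i>)) -
       \<i> * (h (\<i> *s x) (axis k 1) + \<i> * h (\<i> *s x) (axis k \<i>)))) / 4"
    unfolding wirtinger_sums(1)[OF lin2] ..
  also have "\<dots> = ((\<Sum>k\<in>UNIV. cnj (x $ k) * (h x (axis k 1) + \<i> * h x (axis k \<i>))) -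
       \<i> * (\<Sum>k\<in>UNIV. cnj (x $ k) * (h (\<i> *s x) (axis k 1) + \<i> * h (\<i> *s x) (axis k \<i>)))) / 4"
    by (simp add: sum_distrib_left sum_subtractf[symmetric] algebra_simps)
  also have "\<dots> = ((h x x + \<i> * h x (\<i> *s x)) - \<i> * (h (\<i> *s x) x + \<i> * h (\<i> *s x) (\<i> *s x))) / 4"
    unfolding wirtinger_sums(2)[OF lin(2)] ..
  finally have levi: "levi_form f w x =
    ((h x x + \<i> * h x (\<i> *s x)) - \<i> * (h (\<i> *s x) x + \<i> * h (\<i> *s x) (\<i> *s x))) / 4" .
  have "Re (levi_form f w x) = (H w x x + H w (\<i> *s x) (\<i> *s x)) / 4"
    unfolding levi by (simp add: h_def)
  then show ?thesis
    unfolding line_laplacian_def C2_hess_dir_deriv(1)[OF hess assms(2,3)] .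
qed

section \<open>Subharmonic functions in the viscosity sense\<close>

lemma harmonic_on_hess:
  assumes "harmonic_on S h" "open S"
  obtains D H where "C2_hess S h D H" "\<And>z. z \<in> S \<Longrightarrow> H z 1 1 + H z \<i> \<i> = 0"
proof -
  obtain D H where h: "C2_hess S h D H"
    using assms C2_on_imp_C2_hess unfolding harmonic_on_def by blast
  have "H z 1 1 + H z \<i> \<i> = 0" if "z \<in> S" for z
    using assms(1) that C2_hess_dir_deriv(1)[OF h assms(2) that] unfolding harmonic_on_def by metis
  with h that show ?thesis by blast
qed

text \<open>One closure rule for every modification of a test function made below: rescaling, adding
  a linear term, shifting. Padded terms such as \<open>1 * H \<tau>\<close> or
  \<open>inner 0 \<tau>\<close> in later functions are there to match it.\<close>

lemma harmonic_on_affine: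
  assumes "harmonic_on S h" "open S"
  shows "harmonic_on S (\<lambda>z. c * h z + inner b z + d)"
proof -
  obtain D H where h: "C2_hess S h D H" "\<And>z. z \<in> S \<Longrightarrow> H z 1 1 + H z \<i> \<i> = 0"
    using harmonic_on_hess[OF assms] by blast
  have h': "C2_hess S (\<lambda>z. c * h z + inner b z + d) (\<lambda>x v. c * D x v + inner b v) (\<lambda>x u v. c * H x u v)"
    using h(1) unfolding C2_hess_def by (auto intro!: derivative_eq_intros continuous_intros)
  have "c * H z 1 1 + c * H z \<i> \<i> = 0" if "z \<in> S" for z
    using h(2)[OF that] by (metis distrib_left mult_zero_right)
  then show ?thesis
    unfolding harmonic_on_def
    using C2_hess_imp_C2_on[OF h' assms(2)] C2_hess_dir_deriv(1)[OF h' assms(2)] by simp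
qed

lemma harmonic_on_subset:
  assumes "harmonic_on S h" "T \<subseteq> S"
  shows "harmonic_on T h"
  using assms C2_on_subset unfolding harmonic_on_def by blast

text \<open>Absence of touching, written positively: the test function, normalised to agree with
  \<open>u\<close> at \<open>p\<close>, is exceeded somewhere in every small disc. Only real values
  \<open>u p = ereal x\<close> are tested, so points of value \<open>-\<infinity>\<close> pass
  vacuously.\<close>

definition viscosity_sub :: "(complex \<Rightarrow> ereal) \<Rightarrow> complex \<Rightarrow> bool" where
  "viscosity_sub u p \<longleftrightarrow> (\<forall>x H \<rho> \<epsilon>. u p = ereal x \<and> 0 < \<rho> \<and> 0 < \<epsilon> \<and> harmonic_on (ball p \<rho>) H \<longrightarrow>
     (\<exists>\<tau>\<in>ball p \<rho>. ereal (x + H \<tau> - H p - \<epsilon> * (cmod (\<tau> - p))\<^sup>2) < u \<tau>))"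

text \<open>Raising \<open>u\<close> away from \<open>p\<close> only makes it harder to touch it
  from above at \<open>p\<close>.\<close>

lemma viscosity_sub_mono:
  assumes "viscosity_sub u p" "u p = u' p" "\<forall>\<^sub>F \<tau> in nhds p. u \<tau> \<le> u' \<tau>"
  shows "viscosity_sub u' p"
  unfolding viscosity_sub_def
proof (intro allI impI)
  fix x H \<rho> \<epsilon> assume h: "u' p = ereal x \<and> 0 < \<rho> \<and> (0::real) < \<epsilon> \<and> harmonic_on (ball p \<rho>) H"
  obtain d where d: "d > 0" "\<And>\<tau>. dist \<tau> p < d \<Longrightarrow> u \<tau> \<le> u' \<tau>"
    using assms(3) by (auto simp: eventually_nhds_metric)
  have "harmonic_on (ball p (min \<rho> d)) H"
    by (rule harmonic_on_subset[of "ball p \<rho>"]) (use h in auto)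
  then obtain \<tau> where "\<tau> \<in> ball p (min \<rho> d)" "ereal (x + H \<tau> - H p - \<epsilon> * (cmod (\<tau> - p))\<^sup>2) < u \<tau>"
    using assms(1,2) h d(1) unfolding viscosity_sub_def by (metis min_less_iff_conj)
  then show "\<exists>\<tau>\<in>ball p \<rho>. ereal (x + H \<tau> - H p - \<epsilon> * (cmod (\<tau> - p))\<^sup>2) < u' \<tau>"
    using d(2)[of \<tau>] by (intro bexI[of _ \<tau>]) (auto simp: dist_commute)
qed

text \<open>A minorant \<open>g\<close> that meets \<open>u\<close> at \<open>p\<close> is enough.
  If a test function touched \<open>u\<close>, then \<open>g - H\<close> plus
  \<open>\<epsilon>\<close> times the squared distance would have a local maximum at
  \<open>p\<close>; adding the second-order conditions in directions 1 and \<open>\<i>\<close>,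
  where those of \<open>H\<close> cancel, gives
  \<open>b + b' + 4 * \<epsilon> \<le> 0\<close>.\<close>

lemma viscosity_sub_if_has_d2:
  assumes "u p = ereal (g p)" "\<forall>\<^sub>F \<tau> in nhds p. ereal (g \<tau>) \<le> u \<tau>"
    and d1: "has_d2 (\<lambda>t. g (p + t *\<^sub>R 1)) a b" and di: "has_d2 (\<lambda>t. g (p + t *\<^sub>R \<i>)) a' b'"
    and "0 \<le> b + b'"
  shows "viscosity_sub u p"
  unfolding viscosity_sub_def
proof (intro allI impI, rule ccontr)
  fix x H \<rho> \<epsilon>
  assume h: "u p = ereal x \<and> 0 < \<rho> \<and> (0::real) < \<epsilon> \<and> harmonic_on (ball p \<rho>) H"
    and neg: "\<not> (\<exists>\<tau>\<in>ball p \<rho>. ereal (x + H \<tau> - H p - \<epsilon> * (cmod (\<tau> - p))\<^sup>2) < u \<tau>)"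
  have x: "x = g p" using h assms(1) by simp
  have "\<forall>\<^sub>F \<tau> in nhds p. \<tau> \<in> ball p \<rho>" using h by (intro eventually_nhds_in_open) auto
  with assms(2) have ev: "\<forall>\<^sub>F \<tau> in nhds p. g \<tau> \<le> g p + H \<tau> - H p - \<epsilon> * (cmod (\<tau> - p))\<^sup>2"
  proof eventually_elim
    case (elim \<tau>)
    then have "ereal (g \<tau>) \<le> ereal (x + H \<tau> - H p - \<epsilon> * (cmod (\<tau> - p))\<^sup>2)"
      using neg by (meson not_le order_trans)
    then show ?case by (simp add: x)
  qed
  obtain D K where K: "C2_hess (ball p \<rho>) H D K" "\<And>z. z \<in> ball p \<rho> \<Longrightarrow> K z 1 1 + K z \<i> \<i> = 0"
    by (rule harmonic_on_hess[of "ball p \<rho>" H]) (use h in auto)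
  have p: "p \<in> ball p \<rho>" using h by simp
  have *: "b'' - K p v v + 2 * \<epsilon> \<le> 0" if "has_d2 (\<lambda>t. g (p + t *\<^sub>R v)) a'' b''" "cmod v = 1" for v a'' b''
  proof -
    have "has_d2 (\<lambda>t. H (p + t *\<^sub>R v)) (D p v) (K p v v)"
      using C2_on_has_d2[OF C2_hess_imp_C2_on[OF K(1)] _ p, of v] C2_hess_dir_deriv[OF K(1) _ p] by simp
    from has_d2_add[OF has_d2_add[OF that(1) has_d2_cmult[OF this, of "-1"]] has_d2_quadratic[of 0 0 \<epsilon>]]
    have d: "has_d2 (\<lambda>t. g (p + t *\<^sub>R v) + - 1 * H (p + t *\<^sub>R v) + (0 + 0 * t + \<epsilon> * t\<^sup>2))
        (a'' + - 1 * D p v + 0) (b'' + - 1 * K p v v + 2 * \<epsilon>)" .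
    have "((\<lambda>t::real. p + t *\<^sub>R v) \<longlongrightarrow> p + 0 *\<^sub>R v) (nhds 0)"
      by (intro tendsto_intros filterlim_ident)
    then have "((\<lambda>t::real. p + t *\<^sub>R v) \<longlongrightarrow> p) (nhds 0)" by simp
    from eventually_compose_filterlim[OF ev this]
    have "\<forall>\<^sub>F t in nhds 0. g (p + t *\<^sub>R v) + - 1 * H (p + t *\<^sub>R v) + (0 + 0 * t + \<epsilon> * t\<^sup>2) \<le>
         g (p + 0 *\<^sub>R v) + - 1 * H (p + 0 *\<^sub>R v) + (0 + 0 * 0 + \<epsilon> * 0\<^sup>2)"
      by eventually_elim (use that(2) in \<open>simp add: algebra_simps\<close>)
    from has_d2_local_max[OF d this] show ?thesis by simp
  qed
  have "b - K p 1 1 + 2 * \<epsilon> \<le> 0" "b' - K p \<i> \<i> + 2 * \<epsilon> \<le> 0"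
    using *[OF d1] *[OF di] by auto
  then show False using K(2)[OF p] h assms(5) by linarith
qed

text \<open>On a circle about \<open>p\<close> the quadratic term of a test function is the constant
  \<open>\<epsilon> * r\<^sup>2\<close>, so a touching test function becomes a harmonic majorant
  there. Comparison on the disc then puts \<open>u p\<close> below its own value.\<close>

lemma subharmonic_imp_viscosity_sub:
  assumes "subharmonic_on D u" "open D" "p \<in> D"
  shows "viscosity_sub u p"
  unfolding viscosity_sub_def
proof (intro allI impI, rule ccontr)
  fix x H \<rho> \<epsilon>
  assume h: "u p = ereal x \<and> 0 < \<rho> \<and> (0::real) < \<epsilon> \<and> harmonic_on (ball p \<rho>) H"
    and neg: "\<not> (\<exists>\<tau>\<in>ball p \<rho>. ereal (x + H \<tau> - H p - \<epsilon> * (cmod (\<tau> - p))\<^sup>2) < u \<tau>)"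
  obtain e where e: "e > 0" "cball p e \<subseteq> D" using assms open_contains_cball by metis
  define r where "r = min e (\<rho> / 2)"
  have r: "0 < r" "cball p r \<subseteq> D" "cball p r \<subseteq> ball p \<rho>" "ball p r \<subseteq> ball p \<rho>"
    using e h by (auto simp: r_def)
  define k where "k \<tau> = 1 * H \<tau> + inner 0 \<tau> + (x - H p - \<epsilon> * r\<^sup>2)" for \<tau>
  have k: "harmonic_on (ball p \<rho>) k"
    unfolding k_def using h by (intro harmonic_on_affine) auto
  have "continuous_on (cball p r) k"
    using k by (intro continuous_on_subset[OF C2_on_imp_continuous_on r(3)]) (simp add: harmonic_on_def)
  moreover have "harmonic_on (ball p r) k" using harmonic_on_subset[OF k r(4)] .
  moreover have "u \<tau> \<le> ereal (k \<tau>)" if "\<tau> \<in> sphere p r" for \<tau>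
  proof -
    have "\<tau> \<in> ball p \<rho>" using that r by auto
    then have "u \<tau> \<le> ereal (x + H \<tau> - H p - \<epsilon> * (cmod (\<tau> - p))\<^sup>2)" using neg by (meson not_le)
    moreover have "cmod (\<tau> - p) = r" using that by (simp add: dist_norm norm_minus_commute)
    ultimately show ?thesis by (simp add: k_def algebra_simps)
  qed
  moreover have "(\<forall>c r h. 0 < r \<and> cball c r \<subseteq> D \<and> continuous_on (cball c r) h \<and> harmonic_on (ball c r) h \<and>
        (\<forall>\<tau>\<in>sphere c r. u \<tau> \<le> ereal (h \<tau>)) \<longrightarrow> (\<forall>\<tau>\<in>ball c r. u \<tau> \<le> ereal (h \<tau>)))"
    using assms(1) unfolding subharmonic_on_def by (elim conjE)
  from this[rule_format, of r p k p] have "0 < r \<and> cball p r \<subseteq> D \<and> continuous_on (cball p r) k \<and> harmonic_on (ball p r) k \<and>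
        (\<forall>\<tau>\<in>sphere p r. u \<tau> \<le> ereal (k \<tau>)) \<Longrightarrow> u p \<le> ereal (k p)" using r(1) by simp
  ultimately have "u p \<le> ereal (k p)" using r(1,2) by simp
  then have "x \<le> x - \<epsilon> * r\<^sup>2" using h by (simp add: k_def)
  moreover have "0 < \<epsilon> * r\<^sup>2" using h r(1) by simp
  ultimately show False by linarith
qed

text \<open>Without a maximum the open sets \<open>{z \<in> K. u z < u y}\<close> would cover
  \<open>K\<close>; among the finitely many \<open>y\<close> of a subcover, the one with the largest
  value would remain uncovered.\<close>

lemma usc_attains_max:
  fixes u :: "'a::topological_space \<Rightarrow> 'b::linorder"
  assumes "compact K" "K \<noteq> {}" "\<And>t. openin (top_of_set K) {z \<in> K. u z < t}"
  shows "\<exists>x\<in>K. \<forall>y\<in>K. u y \<le> u x"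
proof (rule ccontr)
  assume neg: "\<not> ?thesis"
  let ?\<U> = "(\<lambda>y. {z \<in> K. u z < u y}) ` K"
  have comp: "compactin (top_of_set K) K"
    using assms(1) by (simp add: compactin_subtopology)
  have cover: "K \<subseteq> \<Union>?\<U>"
  proof
    fix z assume z: "z \<in> K"
    with neg obtain y where "y \<in> K" "\<not> u y \<le> u z" by blast
    then have "y \<in> K" "z \<in> {z \<in> K. u z < u y}" using z by (auto simp: not_le)
    then show "z \<in> \<Union>?\<U>" by blast
  qed
  have "\<exists>\<F>. finite \<F> \<and> \<F> \<subseteq> ?\<U> \<and> K \<subseteq> \<Union>\<F>"
    by (rule compactinD[OF comp _ cover]) (use assms(3) in auto)
  then obtain \<F> where F: "finite \<F>" "\<F> \<subseteq> ?\<U>" "K \<subseteq> \<Union>\<F>" by blast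
  from finite_subset_image[OF F(1,2)]
  obtain Y where Y: "Y \<subseteq> K" "finite Y" "\<F> = (\<lambda>y. {z \<in> K. u z < u y}) ` Y" by blast
  have "Y \<noteq> {}" using F Y assms(2) by auto
  define m where "m = Max (u ` Y)"
  have "m \<in> u ` Y" unfolding m_def by (rule Max_in) (use Y(2) \<open>Y \<noteq> {}\<close> in auto)
  then obtain y where y: "y \<in> Y" "u y = m" by blast
  then obtain y' where y': "y' \<in> Y" "u y < u y'" using F(3) Y(1,3) by blast
  have "u y' \<le> m" unfolding m_def using y'(1) Y(2) by simp
  then show False using y y' by simp
qed

lemma usc_add_continuous:
  fixes u :: "'a::topological_space \<Rightarrow> ereal" and k :: "'a \<Rightarrow> real"
  assumes "\<And>t. openin (top_of_set K) {z \<in> K. u z < t}" "\<And>z. z \<in> K \<Longrightarrow> u z < \<infinity>" "continuous_on K k"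
  shows "openin (top_of_set K) {z \<in> K. u z + ereal (k z) < t}"
proof -
  have eq: "{z \<in> K. u z + ereal (k z) < t} =
     (\<Union>q. {z \<in> K. u z < ereal q} \<inter> {z \<in> K. ereal (q + k z) < t})" (is "?L = ?R")
  proof
    show "?L \<subseteq> ?R"
    proof
      fix z assume z: "z \<in> ?L"
      then obtain s where s: "u z + ereal (k z) < ereal s" "ereal s < t"
        using ereal_dense2 by blast
      then have "u z < ereal (s - k z)" by (cases "u z") auto
      then show "z \<in> ?R" using z s by (auto intro!: exI[of _ "s - k z"])
    qed
    show "?R \<subseteq> ?L"
    proof
      fix z assume "z \<in> ?R"
      then obtain q where z: "z \<in> K" "u z < ereal q" "ereal (q + k z) < t" by auto
      then have "u z + ereal (k z) < ereal (q + k z)" by (cases "u z") auto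
      then show "z \<in> ?L" using z by auto
    qed
  qed
  have op: "openin (top_of_set K) {z \<in> K. ereal (q + k z) < t}" for q
  proof -
    have "continuous_on K (\<lambda>z. ereal (q + k z))"
      using assms(3) by (intro continuous_on_ereal continuous_intros)
    from continuous_openin_preimage_gen[OF this, of "{..<t}"]
    show ?thesis by (simp add: vimage_def Int_def)
  qed
  show ?thesis
    unfolding eq by (intro openin_Union) (use openin_Int[OF assms(1) op] in blast)
qed

text \<open>
  If \<open>u - h\<close> were positive inside a disc, then \<open>u - h + \<epsilon>|\<tau> - c|\<^sup>2\<close> would attain its maximum inside, at
  \<open>p\<close> say; expanding the square around \<open>p\<close> changes \<open>h\<close> only by a harmonic affine term.
\<close>

lemma subharmonic_if_viscosity_sub:
  assumes fin: "\<And>\<tau>. \<tau> \<in> D \<Longrightarrow> u \<tau> < \<infinity>" and usc: "usc_on D u" and v: "\<And>p. p \<in> D \<Longrightarrow> viscosity_sub u p"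
  shows "subharmonic_on D u"
  unfolding subharmonic_on_def
proof (intro conjI ballI allI impI)
  fix c r h \<tau>0
  assume h: "0 < r \<and> cball c r \<subseteq> D \<and> continuous_on (cball c r) h \<and> harmonic_on (ball c r) h \<and>
        (\<forall>\<tau>\<in>sphere c r. u \<tau> \<le> ereal (h \<tau>))" and \<tau>0: "\<tau>0 \<in> ball c r"
  show "u \<tau>0 \<le> ereal (h \<tau>0)"
  proof (rule ccontr)
    assume "\<not> u \<tau>0 \<le> ereal (h \<tau>0)"
    moreover have "\<tau>0 \<in> D" using h \<tau>0 by (meson ball_subset_cball subsetD)
    then have "u \<tau>0 < \<infinity>" by (rule fin)
    ultimately obtain x0 where x0: "u \<tau>0 = ereal x0" "h \<tau>0 < x0" by (cases "u \<tau>0") auto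
    \<comment> \<open>Half of the violation at \<open>\<tau>0\<close>, spread over the disc: the
      perturbation stays below the violation, so the perturbed maximum cannot lie on the sphere,
      where \<open>u \<le> h\<close>.\<close>
    define \<epsilon> where "\<epsilon> = (x0 - h \<tau>0) / (2 * r\<^sup>2)"
    have \<epsilon>: "0 < \<epsilon>" "\<epsilon> * r\<^sup>2 < x0 - h \<tau>0" using x0 h by (auto simp: \<epsilon>_def)
    define k where "k \<tau> = \<epsilon> * (cmod (\<tau> - c))\<^sup>2 - h \<tau>" for \<tau>
    have ck: "continuous_on (cball c r) k" unfolding k_def using h by (intro continuous_intros) auto
    have usc': "openin (top_of_set (cball c r)) {z \<in> cball c r. u z < t}" for t
    proof -
      have "openin (top_of_set D) {z \<in> D. u z < t}" using usc unfolding usc_on_def by blast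
      then obtain T where "open T" "{z \<in> D. u z < t} = D \<inter> T" by (meson openin_open)
      moreover from this h have "{z \<in> cball c r. u z < t} = cball c r \<inter> T" by auto
      ultimately show ?thesis by (simp add: openin_open_Int)
    qed
    have "\<exists>p\<in>cball c r. \<forall>y\<in>cball c r. u y + ereal (k y) \<le> u p + ereal (k p)"
      by (rule usc_attains_max[OF _ _ usc_add_continuous[OF usc' _ ck]]) (use fin h in auto)
    then obtain p where p: "p \<in> cball c r" "\<And>y. y \<in> cball c r \<Longrightarrow> u y + ereal (k y) \<le> u p + ereal (k p)"
      by blast
    have "ereal (x0 + k \<tau>0) \<le> u p + ereal (k p)" using p(2)[of \<tau>0] \<tau>0 x0 by simp
    moreover have "u p < \<infinity>" using fin p(1) h by auto
    ultimately obtain x where x: "u p = ereal x" "x0 + k \<tau>0 \<le> x + k p" by (cases "u p") auto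
    have pb: "p \<in> ball c r"
    proof (rule ccontr)
      assume "p \<notin> ball c r"
      then have ps: "p \<in> sphere c r" using p(1) by simp
      then have "x \<le> h p" using h x(1) by (metis ereal_less_eq(3))
      moreover have "cmod (p - c) = r" using ps by (simp add: dist_norm norm_minus_commute)
      moreover have "0 \<le> \<epsilon> * (cmod (\<tau>0 - c))\<^sup>2" using \<epsilon>(1) by simp
      ultimately show False using x(2) \<epsilon>(2) by (simp add: k_def)
    qed
    then obtain \<rho> where \<rho>: "\<rho> > 0" "ball p \<rho> \<subseteq> ball c r" using open_ball openE by metis
    define H where "H \<tau> = 1 * h \<tau> + inner ((- 2 * \<epsilon>) *\<^sub>R (p - c)) \<tau> + 0" for \<tau>
    have "harmonic_on (ball p \<rho>) H"
      unfolding H_def using harmonic_on_subset[OF _ \<rho>(2)] h by (intro harmonic_on_affine) auto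
    moreover have "p \<in> D" using p(1) h by auto
    ultimately obtain \<tau> where \<tau>: "\<tau> \<in> ball p \<rho>" "ereal (x + H \<tau> - H p - \<epsilon> * (cmod (\<tau> - p))\<^sup>2) < u \<tau>"
      using v[of p] x(1) \<rho>(1) \<epsilon>(1) unfolding viscosity_sub_def by blast
    have "\<tau> \<in> cball c r" using \<tau>(1) \<rho>(2) by auto
    from p(2)[OF this] fin[of \<tau>] h this x(1) have le: "u \<tau> \<le> ereal (x + k p - k \<tau>)"
      by (cases "u \<tau>") auto
    have "(cmod (\<tau> - c))\<^sup>2 = (cmod (\<tau> - p))\<^sup>2 + 2 * inner (p - c) (\<tau> - p) + (cmod (p - c))\<^sup>2"
      unfolding power2_norm_eq_inner by (simp add: algebra_simps inner_commute)
    from arg_cong[OF this, of "(*) \<epsilon>"]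
    have "x + k p - k \<tau> = x + H \<tau> - H p - \<epsilon> * (cmod (\<tau> - p))\<^sup>2"
      by (simp add: k_def H_def algebra_simps)
    with le \<tau>(2) show False by simp
  qed
qed (use fin usc in auto)

text \<open>A test function for \<open>f\<close> with value \<open>x > 0\<close> at
  \<open>p\<close>, divided by \<open>x\<close>, tests \<open>log f\<close>; the tangent inequality
  \<open>ln t \<le> ln x + (t / x - 1)\<close> carries the conclusion back. At a zero of
  \<open>f\<close> the constant 0 is a minorant that meets \<open>f\<close>.\<close>

lemma viscosity_sub_exp:
  assumes v: "viscosity_sub (\<lambda>\<tau>. log_ereal (f \<tau>)) p" and nn: "\<forall>\<^sub>F \<tau> in nhds p. 0 \<le> f \<tau>"
  shows "viscosity_sub (\<lambda>\<tau>. ereal (f \<tau>)) p"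
proof (cases "f p = 0")
  case True
  then show ?thesis
    using nn by (intro viscosity_sub_if_has_d2[where g = "\<lambda>_. 0", OF _ _ has_d2_const has_d2_const]) auto
next
  case False
  obtain d where d: "d > 0" "\<And>\<tau>. dist \<tau> p < d \<Longrightarrow> 0 \<le> f \<tau>"
    using nn by (auto simp: eventually_nhds_metric)
  have fp: "0 < f p" using False d(2)[of p] d(1) by simp
  show ?thesis
    unfolding viscosity_sub_def
  proof (intro allI impI)
    fix x H \<rho> \<epsilon>
    assume h: "ereal (f p) = ereal x \<and> 0 < \<rho> \<and> (0::real) < \<epsilon> \<and> harmonic_on (ball p \<rho>) H"
    have "harmonic_on (ball p (min \<rho> d)) (\<lambda>z. (1 / x) * H z + inner 0 z + 0)"
      by (rule harmonic_on_affine, rule harmonic_on_subset[of "ball p \<rho>" H]) (use h in auto)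
    then obtain \<tau> where \<tau>: "\<tau> \<in> ball p (min \<rho> d)"
      "ereal (ln x + H \<tau> / x - H p / x - \<epsilon> / x * (cmod (\<tau> - p))\<^sup>2) < log_ereal (f \<tau>)"
      using v[unfolded viscosity_sub_def, rule_format, of "ln x" "min \<rho> d" "\<epsilon> / x" "\<lambda>z. (1 / x) * H z + inner 0 z + 0"]
        h d(1) fp by (auto simp: log_ereal_def)
    have "f \<tau> \<noteq> 0" using \<tau>(2) by (auto simp: log_ereal_def)
    moreover have "0 \<le> f \<tau>" using d(2)[of \<tau>] \<tau>(1) by (simp add: dist_commute)
    ultimately have f_pos: "0 < f \<tau>" by simp
    have x: "0 < x" using h fp by simp
    have "ln x + H \<tau> / x - H p / x - \<epsilon> / x * (cmod (\<tau> - p))\<^sup>2 < ln (f \<tau>)"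
      using \<tau>(2) f_pos by (simp add: log_ereal_def)
    also have "ln (f \<tau>) \<le> ln x + (f \<tau> / x - 1)"
      using ln_le_minus_one[of "f \<tau> / x"] x f_pos by (simp add: ln_div)
    finally have "(H \<tau> - H p - \<epsilon> * (cmod (\<tau> - p))\<^sup>2) / x < (f \<tau> - x) / x"
      using x by (simp add: diff_divide_distrib)
    then have "H \<tau> - H p - \<epsilon> * (cmod (\<tau> - p))\<^sup>2 < f \<tau> - x" using x by (simp add: divide_less_cancel)
    then show "\<exists>\<tau>\<in>ball p \<rho>. ereal (x + H \<tau> - H p - \<epsilon> * (cmod (\<tau> - p))\<^sup>2) < ereal (f \<tau>)"
      using \<tau>(1) by (intro bexI[of _ \<tau>]) auto
  qed
qed

text \<open>The tangent of \<open>X\<close> at \<open>f p\<close> is an increasing affine function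
  of \<open>f\<close>, for which the test merely rescales; the composition lies above it and meets
  it at \<open>p\<close>.\<close>

lemma viscosity_sub_increasing_convex:
  assumes v: "viscosity_sub (\<lambda>\<tau>. ereal (f \<tau>)) p" and "0 < m"
    and tangent: "\<forall>\<^sub>F \<tau> in nhds p. X (f p) + m * (f \<tau> - f p) \<le> X (f \<tau>)"
  shows "viscosity_sub (\<lambda>\<tau>. ereal (X (f \<tau>))) p"
proof -
  have "viscosity_sub (\<lambda>\<tau>. ereal (X (f p) + m * (f \<tau> - f p))) p"
    unfolding viscosity_sub_def
  proof (intro allI impI)
    fix x H \<rho> \<epsilon>
    assume h: "ereal (X (f p) + m * (f p - f p)) = ereal x \<and> 0 < \<rho> \<and> (0::real) < \<epsilon> \<and> harmonic_on (ball p \<rho>) H"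
    have "harmonic_on (ball p \<rho>) (\<lambda>z. (1 / m) * H z + inner 0 z + 0)"
      using h by (intro harmonic_on_affine) auto
    then obtain \<tau> where \<tau>: "\<tau> \<in> ball p \<rho>"
      "f p + H \<tau> / m - H p / m - \<epsilon> / m * (cmod (\<tau> - p))\<^sup>2 < f \<tau>"
      using v[unfolded viscosity_sub_def, rule_format, of "f p" \<rho> "\<epsilon> / m" "\<lambda>z. (1 / m) * H z + inner 0 z + 0"]
        h \<open>0 < m\<close> by auto
    have "m * (f p + H \<tau> / m - H p / m - \<epsilon> / m * (cmod (\<tau> - p))\<^sup>2) < m * f \<tau>"
      using \<tau>(2) \<open>0 < m\<close> by simp
    also have "m * (f p + H \<tau> / m - H p / m - \<epsilon> / m * (cmod (\<tau> - p))\<^sup>2) =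
      m * f p + H \<tau> - H p - \<epsilon> * (cmod (\<tau> - p))\<^sup>2"
      using \<open>0 < m\<close> by (simp add: algebra_simps)
    finally show "\<exists>\<tau>\<in>ball p \<rho>. ereal (x + H \<tau> - H p - \<epsilon> * (cmod (\<tau> - p))\<^sup>2)
        < ereal (X (f p) + m * (f \<tau> - f p))"
      using \<tau>(1) h by (intro bexI[of _ \<tau>]) (auto simp: algebra_simps)
  qed
  then show ?thesis by (rule viscosity_sub_mono) (use tangent in auto)
qed

section \<open>Plurisubharmonicity through the pointwise test on complex lines\<close>

lemma continuous_on_line: "continuous_on T (\<lambda>\<tau>. a + \<tau> *s (v :: complex^'m))"
  by (intro continuous_intros)

lemma psh_onI:
  fixes S :: "(complex^'m) set"
  assumes "\<And>z. z \<in> S \<Longrightarrow> u z < \<infinity>" "usc_on S u"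
    and "\<And>a v \<tau>. a + \<tau> *s v \<in> S \<Longrightarrow> viscosity_sub (\<lambda>\<tau>. u (a + \<tau> *s v)) \<tau>"
  shows "psh_on S u"
  unfolding psh_on_def
proof (intro conjI ballI allI subharmonic_if_viscosity_sub)
  fix a v
  show "usc_on {\<tau>. a + \<tau> *s v \<in> S} (\<lambda>\<tau>. u (a + \<tau> *s v))"
    unfolding usc_on_def
  proof
    fix t
    let ?L = "{\<tau>. a + \<tau> *s v \<in> S}"
    have "openin (top_of_set ?L) (?L \<inter> (\<lambda>\<tau>. a + \<tau> *s v) -` {z \<in> S. u z < t})"
      by (rule continuous_openin_preimage[OF continuous_on_line, where T = S])
         (use assms(2) in \<open>auto simp: usc_on_def\<close>)
    moreover have "?L \<inter> (\<lambda>\<tau>. a + \<tau> *s v) -` {z \<in> S. u z < t} = {z \<in> ?L. u (a + z *s v) < t}"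
      by auto
    ultimately show "openin (top_of_set ?L) {z \<in> ?L. u (a + z *s v) < t}" by simp
  qed
qed (use assms in auto)

lemma psh_on_imp_viscosity_sub:
  fixes S :: "(complex^'m) set"
  assumes "psh_on S u" "open S" "a + \<tau> *s v \<in> S"
  shows "viscosity_sub (\<lambda>\<tau>. u (a + \<tau> *s v)) \<tau>"
proof (rule subharmonic_imp_viscosity_sub[of "{\<tau>. a + \<tau> *s v \<in> S}"])
  show "open {\<tau>. a + \<tau> *s v \<in> S}"
    using open_vimage[OF assms(2) continuous_on_line] by (simp add: vimage_def)
qed (use assms in \<open>auto simp: psh_on_def\<close>)

text \<open>Directions 1 and \<open>\<i>\<close> in the parameter become \<open>v\<close> and
  \<open>\<i> *s v\<close>. Agreement of \<open>u\<close> and \<open>f\<close> is asked on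
  \<open>S\<close> only, so \<open>S\<close> may be the set where a logarithm is finite.\<close>

lemma viscosity_sub_if_line_laplacian_nonneg:
  fixes S :: "(complex^'m) set"
  assumes "C2_on S f" "open S" "a + \<tau> *s v \<in> S" "0 \<le> line_laplacian f (a + \<tau> *s v) v"
    "\<And>z. z \<in> S \<Longrightarrow> u z = ereal (f z)"
  shows "viscosity_sub (\<lambda>\<tau>. u (a + \<tau> *s v)) \<tau>"
proof (rule viscosity_sub_if_has_d2[where g = "\<lambda>\<tau>. f (a + \<tau> *s v)"])
  have 1: "a + (\<tau> + t *\<^sub>R 1) *s v = (a + \<tau> *s v) + t *\<^sub>R v" for t :: real
    by (simp add: vec_eq_iff algebra_simps)
  have i: "a + (\<tau> + t *\<^sub>R \<i>) *s v = (a + \<tau> *s v) + t *\<^sub>R (\<i> *s v)" for t :: real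
    by (simp add: vec_eq_iff algebra_simps)
  show "has_d2 (\<lambda>t. f (a + (\<tau> + t *\<^sub>R 1) *s v)) (dir_deriv v f (a + \<tau> *s v)) (dir_deriv v (dir_deriv v f) (a + \<tau> *s v))"
    unfolding 1 by (rule C2_on_has_d2[OF assms(1-3)])
  show "has_d2 (\<lambda>t. f (a + (\<tau> + t *\<^sub>R \<i>) *s v)) (dir_deriv (\<i> *s v) f (a + \<tau> *s v))
     (dir_deriv (\<i> *s v) (dir_deriv (\<i> *s v) f) (a + \<tau> *s v))"
    unfolding i by (rule C2_on_has_d2[OF assms(1-3)])
  have "open {\<tau>. a + \<tau> *s v \<in> S}"
    using open_vimage[OF assms(2) continuous_on_line] by (simp add: vimage_def)
  from eventually_nhds_in_open[OF this, of \<tau>]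
  show "\<forall>\<^sub>F \<tau> in nhds \<tau>. ereal (f (a + \<tau> *s v)) \<le> u (a + \<tau> *s v)"
    using assms(3,5) by (auto elim!: eventually_mono)
qed (use assms in \<open>auto simp: line_laplacian_def\<close>)

lemma usc_on_ereal:
  assumes "continuous_on S f"
  shows "usc_on S (\<lambda>z. ereal (f z))"
  unfolding usc_on_def
proof
  fix t
  have "continuous_on S (\<lambda>z. ereal (f z))" using assms by (rule continuous_on_ereal)
  from continuous_openin_preimage_gen[OF this, of "{..<t}"]
  show "openin (top_of_set S) {z \<in> S. ereal (f z) < t}" by (simp add: vimage_def Int_def)
qed

lemma usc_on_log_ereal:
  assumes "continuous_on S f" "\<And>z. z \<in> S \<Longrightarrow> 0 \<le> f z"
  shows "usc_on S (\<lambda>z. log_ereal (f z))"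
  unfolding usc_on_def
proof
  fix t
  have less: "log_ereal y < ereal s \<longleftrightarrow> y < exp s" if "0 \<le> y" for y s
  proof (cases "y = 0")
    case False
    then have "ln y < s \<longleftrightarrow> y < exp s" using that exp_less_cancel_iff[of "ln y" s] by simp
    then show ?thesis using False by (simp add: log_ereal_def)
  qed (simp add: log_ereal_def)
  show "openin (top_of_set S) {z \<in> S. log_ereal (f z) < t}"
  proof (cases t)
    case (real s)
    have "{z \<in> S. log_ereal (f z) < t} = S \<inter> f -` {..<exp s}"
      using less assms(2) real by auto
    then show ?thesis using continuous_openin_preimage_gen[OF assms(1), of "{..<exp s}"] by simp
  next
    case PInf
    then have "{z \<in> S. log_ereal (f z) < t} = S" by (auto simp: log_ereal_def)
    then show ?thesis by simp
  next
    case MInf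
    then have "{z \<in> S. log_ereal (f z) < t} = {}" by auto
    then show ?thesis by (simp only: openin_empty)
  qed
qed

section \<open>The log-plurisubharmonic bump\<close>

text \<open>At the junction both one-sided difference quotients tend to 0: the left one by
  \<open>g1 a = 0\<close>, the right one because that branch is constant. It serves for
  \<open>cutoff\<close> and again for \<open>cutoff1\<close>.\<close>

lemma has_real_derivative_glue_const:
  fixes g :: "real \<Rightarrow> real"
  assumes g: "\<And>t. (g has_real_derivative g1 t) (at t)" and "g a = c" "g1 a = 0"
  shows "((\<lambda>t. if t \<le> a then g t else c) has_real_derivative (if t \<le> a then g1 t else 0)) (at t)"
proof (cases t a rule: linorder_cases)
  case less
  have "\<forall>\<^sub>F s in nhds t. s < a" using less by (intro eventually_nhds_in_open[of "{..<a}", simplified]) auto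
  then have "\<forall>\<^sub>F s in nhds t. (if s \<le> a then g s else c) = g s" by eventually_elim auto
  from DERIV_cong_ev[OF refl this refl] g less show ?thesis by simp
next
  case greater
  have "\<forall>\<^sub>F s in nhds t. s > a" using greater by (intro eventually_nhds_in_open[of "{a<..}", simplified]) auto
  then have "\<forall>\<^sub>F s in nhds t. (if s \<le> a then g s else c) = c" by eventually_elim auto
  from DERIV_cong_ev[OF refl this refl] greater show ?thesis by simp
next
  case equal
  let ?f = "\<lambda>t. if t \<le> a then g t else c"
  have lim: "((\<lambda>y. (g y - g a) / (y - a)) \<longlongrightarrow> 0) (at a)"
    using g[of a] assms(3) by (simp add: has_field_derivative_iff)
  have "((\<lambda>y. (?f y - ?f a) / (y - a)) \<longlongrightarrow> 0) (at a)"
  proof (rule filterlim_split_at)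
    have "\<forall>\<^sub>F y in at_left a. (g y - g a) / (y - a) = (?f y - ?f a) / (y - a)"
      by (auto simp: eventually_at_filter)
    from Lim_transform_eventually[OF filterlim_mono[OF lim order_refl] this]
    show "((\<lambda>y. (?f y - ?f a) / (y - a)) \<longlongrightarrow> 0) (at_left a)" by (simp add: at_le)
    have "\<forall>\<^sub>F y in at_right a. 0 = (?f y - ?f a) / (y - a)"
      using assms(2) by (auto simp: eventually_at_filter)
    from Lim_transform_eventually[OF tendsto_const this]
    show "((\<lambda>y. (?f y - ?f a) / (y - a)) \<longlongrightarrow> 0) (at_right a)" .
  qed
  then show ?thesis using equal assms(3) by (simp add: has_field_derivative_iff)
qed

text \<open>
  The exponent is minus the second-order Taylor polynomial of \<open>ln\<close> at \<open>1\<close>, so that \<open>ln (cutoff t)\<close> vanishes to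
  third order at \<open>t = 1\<close> and has derivative \<open>(1 - t)\<^sup>2 / t\<close> before.
\<close>

definition cut_exp :: "real \<Rightarrow> real" where
  "cut_exp t = (1 - t) + (1 - t)\<^sup>2 / 2"

definition cutoff :: "real \<Rightarrow> real" where
  "cutoff t = (if t \<le> 1 then t * exp (cut_exp t) else 1)"

definition cutoff1 :: "real \<Rightarrow> real" where
  "cutoff1 t = (if t \<le> 1 then (1 - t)\<^sup>2 * exp (cut_exp t) else 0)"

definition cutoff2 :: "real \<Rightarrow> real" where
  "cutoff2 t = (if t \<le> 1 then (- 2 * (1 - t) + (1 - t)\<^sup>2 * (t - 2)) * exp (cut_exp t) else 0)"

lemma cut_exp_deriv: "(cut_exp has_real_derivative t - 2) (at t)"
  unfolding cut_exp_def[abs_def] by (auto intro!: derivative_eq_intros simp: field_simps)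

lemma cutoff_deriv: "(cutoff has_real_derivative cutoff1 t) (at t)"
  unfolding cutoff_def[abs_def] cutoff1_def
proof (rule has_real_derivative_glue_const)
  fix t :: real
  show "((\<lambda>t. t * exp (cut_exp t)) has_real_derivative (1 - t)\<^sup>2 * exp (cut_exp t)) (at t)"
    by (auto intro!: derivative_eq_intros cut_exp_deriv simp: algebra_simps power2_eq_square)
qed (auto simp: cut_exp_def)

lemma cutoff1_deriv: "(cutoff1 has_real_derivative cutoff2 t) (at t)"
  unfolding cutoff1_def[abs_def] cutoff2_def
  by (rule has_real_derivative_glue_const)
     (auto intro!: derivative_eq_intros cut_exp_deriv simp: algebra_simps)

lemma continuous_cutoff2: "continuous_on UNIV cutoff2"
proof -
  have "continuous_on {..1} (\<lambda>t::real. (- 2 * (1 - t) + (1 - t)\<^sup>2 * (t - 2)) * exp (cut_exp t))"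
    unfolding cut_exp_def by (intro continuous_intros) auto
  then have "continuous_on ({..1} \<union> {1..}) cutoff2"
    unfolding cutoff2_def[abs_def] by (intro continuous_on_cases) (auto intro: continuous_intros)
  moreover have "{..1} \<union> {1..} = (UNIV :: real set)" by auto
  ultimately show ?thesis by simp
qed

lemma cutoff_pos: "0 < t \<Longrightarrow> 0 < cutoff t"
  by (simp add: cutoff_def)

lemma cutoff_zero [simp]: "cutoff 0 = 0"
  by (simp add: cutoff_def)

lemma cutoff_eq_one: "1 \<le> t \<Longrightarrow> cutoff t = 1"
  by (cases "t = 1") (auto simp: cutoff_def cut_exp_def)

lemma cutoff_le_one: "cutoff t \<le> 1"
proof (cases "t \<le> 1")
  case True
  have "cutoff t \<le> cutoff 1"
    by (rule DERIV_nonneg_imp_nondecreasing[OF True]) (auto intro!: cutoff_deriv exI simp: cutoff1_def)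
  then show ?thesis by (simp add: cutoff_eq_one)
qed (simp add: cutoff_def)

definition lncut1 :: "real \<Rightarrow> real" where
  "lncut1 t = cutoff1 t / cutoff t"

definition lncut2 :: "real \<Rightarrow> real" where
  "lncut2 t = (cutoff2 t * cutoff t - cutoff1 t * cutoff1 t) / (cutoff t * cutoff t)"

lemma ln_cutoff_deriv: "0 < t \<Longrightarrow> ((\<lambda>t. ln (cutoff t)) has_real_derivative lncut1 t) (at t)"
  using cutoff_pos[of t] unfolding lncut1_def
  by (auto intro!: derivative_eq_intros cutoff_deriv)

lemma lncut1_deriv: "0 < t \<Longrightarrow> (lncut1 has_real_derivative lncut2 t) (at t)"
  using cutoff_pos[of t] unfolding lncut1_def[abs_def] lncut2_def
  by (intro DERIV_divide cutoff_deriv cutoff1_deriv) auto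

lemma lncut_values:
  assumes "0 < t" "t \<le> 1"
  shows "lncut1 t = (1 - t)\<^sup>2 / t" "lncut2 t = (t\<^sup>2 - 1) / t\<^sup>2"
proof -
  show "lncut1 t = (1 - t)\<^sup>2 / t" using assms by (simp add: lncut1_def cutoff1_def cutoff_def)
  define E where "E = exp (cut_exp t)"
  have E: "E \<noteq> 0" by (simp add: E_def)
  have "lncut2 t = ((- 2 * (1 - t) + (1 - t)\<^sup>2 * (t - 2)) * t - (1 - t)\<^sup>2 * (1 - t)\<^sup>2) * (E * E) / (t * t * (E * E))"
    using assms by (simp add: lncut2_def cutoff1_def cutoff2_def cutoff_def E_def[symmetric] algebra_simps)
  also have "\<dots> = ((- 2 * (1 - t) + (1 - t)\<^sup>2 * (t - 2)) * t - (1 - t)\<^sup>2 * (1 - t)\<^sup>2) / (t * t)"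
    using E by simp
  also have "(- 2 * (1 - t) + (1 - t)\<^sup>2 * (t - 2)) * t - (1 - t)\<^sup>2 * (1 - t)\<^sup>2 = t\<^sup>2 - 1"
    by algebra
  finally show "lncut2 t = (t\<^sup>2 - 1) / t\<^sup>2" by (simp add: power2_eq_square)
qed

text \<open>Up to a factor, the third quantity is the line Laplacian of
  \<open>ln (cutoff ((norm z)\<^sup>2))\<close> in the worst direction, that of \<open>z\<close>
  itself. For \<open>t \<le> 1\<close> it is the derivative of
  \<open>t * lncut1 t = (1 - t)\<^sup>2\<close>, namely \<open>2 * t - 2\<close>; beyond 1 it
  vanishes.\<close>

lemma lncut_bounds:
  assumes "0 < t"
  shows "0 \<le> lncut1 t" "lncut2 t \<le> 0" "- 2 \<le> lncut1 t + t * lncut2 t"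
proof -
  have "0 \<le> lncut1 t \<and> lncut2 t \<le> 0 \<and> - 2 \<le> lncut1 t + t * lncut2 t"
  proof (cases "t \<le> 1")
    case True
    have "t\<^sup>2 \<le> 1" using True assms by (simp add: power_le_one)
    then have "lncut2 t \<le> 0" using lncut_values(2)[OF assms True] by (simp add: divide_nonpos_nonneg)
    moreover have "lncut1 t + t * lncut2 t = 2 * t - 2"
      using assms unfolding lncut_values[OF assms True] by (simp add: field_simps power2_eq_square)
    ultimately show ?thesis using assms unfolding lncut_values(1)[OF assms True] by simp
  next
    case False
    then show ?thesis by (simp add: lncut1_def lncut2_def cutoff1_def cutoff2_def)
  qed
  then show "0 \<le> lncut1 t" "lncut2 t \<le> 0" "- 2 \<le> lncut1 t + t * lncut2 t" by auto
qed

section \<open>The squared norm and its logarithm along complex lines\<close>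

lemma inner_imaginary_self: "inner (x :: complex^'m) (\<i> *s x) = 0"
  by (simp add: inner_vec_def inner_complex_def)

lemma norm_imaginary: "norm (\<i> *s (x :: complex^'m)) = norm x"
  by (simp add: norm_vector_scalar_mult)

text \<open>As \<open>x\<close> and \<open>\<i> *s x\<close> are orthogonal of equal length, this is
  Bessel's inequality for two real directions, that is, Cauchy-Schwarz for the Hermitian product.
  The square expanded in the proof is that of \<open>n\<close> times the component of
  \<open>z\<close> orthogonal to both.\<close>

lemma complex_bessel:
  fixes x z :: "complex^'m"
  shows "(inner z x)\<^sup>2 + (inner z (\<i> *s x))\<^sup>2 \<le> (norm z)\<^sup>2 * (norm x)\<^sup>2"
proof (cases "x = 0")
  case False
  define y where "y = \<i> *s x"
  define n where "n = (norm x)\<^sup>2"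
  have n: "0 < n" using False by (simp add: n_def)
  have i: "inner x y = 0" "inner y x = 0" "inner x x = n" "inner y y = n"
    unfolding y_def n_def using inner_imaginary_self[of x] norm_imaginary[of x]
    by (auto simp: power2_norm_eq_inner[symmetric] inner_commute)
  define a where "a = inner z x"
  define b where "b = inner z y"
  have ab: "inner z x = a" "inner x z = a" "inner z y = b" "inner y z = b"
    by (simp_all add: a_def b_def inner_commute)
  have "0 \<le> (norm (n *\<^sub>R z - a *\<^sub>R x - b *\<^sub>R y))\<^sup>2" by simp
  also have "\<dots> = n * (n * (norm z)\<^sup>2 - (a\<^sup>2 + b\<^sup>2))"
    unfolding power2_norm_eq_inner
    by (simp add: inner_diff_left inner_diff_right i ab) (simp add: algebra_simps power2_eq_square)
  finally have "0 \<le> n * (norm z)\<^sup>2 - (a\<^sup>2 + b\<^sup>2)" using n by (simp add: zero_le_mult_iff)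
  then show ?thesis by (simp add: n_def y_def[symmetric] ab mult.commute)
qed simp

lemma has_d2_norm_square:
  fixes z x :: "complex^'m"
  shows "has_d2 (\<lambda>t. (norm (z + t *\<^sub>R x))\<^sup>2) (2 * inner z x) (2 * (norm x)\<^sup>2)"
proof -
  have "(norm (z + t *\<^sub>R x))\<^sup>2 = (norm z)\<^sup>2 + 2 * inner z x * t + (norm x)\<^sup>2 * t\<^sup>2" for t
    unfolding power2_norm_eq_inner by (simp add: algebra_simps inner_commute power2_eq_square)
  then show ?thesis using has_d2_quadratic[of "(norm z)\<^sup>2" "2 * inner z x" "(norm x)\<^sup>2"] by simp
qed

lemma C2_on_norm_square: "open S \<Longrightarrow> C2_on S (\<lambda>z :: complex^'m. (norm z)\<^sup>2)"
proof -
  have "C2_hess UNIV (\<lambda>z :: complex^'m. (norm z)\<^sup>2) (\<lambda>z v. 2 * inner z v) (\<lambda>z u v. 2 * inner u v)"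
    unfolding C2_hess_def power2_norm_eq_inner
    by (auto intro!: derivative_eq_intros continuous_intros simp: inner_commute)
  from C2_hess_imp_C2_on[OF this] show ?thesis using C2_on_subset[of UNIV] by simp
qed

lemma C2_on_ln_norm_square: "C2_on (- {0}) (\<lambda>z :: complex^'m. ln ((norm z)\<^sup>2))"
  by (rule C2_on_compose_real[OF C2_on_norm_square, where T = "{0<..}" and ?h1.0 = inverse
        and ?h2.0 = "\<lambda>y. - (inverse y ^ 2)"])
     (auto intro!: derivative_eq_intros continuous_intros simp: field_simps power2_eq_square)

text \<open>With \<open>q\<close> and \<open>n\<close> the squared norms of \<open>z\<close> and
  \<open>x\<close>, the line Laplacian is \<open>4 / q\<^sup>2\<close> times the defect in
  \<open>complex_bessel\<close>.\<close>

lemma line_laplacian_ln_norm_square: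
  fixes z :: "complex^'m"
  assumes "z \<noteq> 0"
  shows "0 \<le> line_laplacian (\<lambda>z. ln ((norm z)\<^sup>2)) z x"
proof -
  let ?q = "(norm z)\<^sup>2"
  have q: "0 < ?q" using assms by simp
  have square: "(- (i ^ 2) * (2 * a)\<^sup>2 + i * (2 * n)) + (- (i ^ 2) * (2 * b)\<^sup>2 + i * (2 * n)) =
     4 * i ^ 2 * (q * n - (a\<^sup>2 + b\<^sup>2))" if "i * q = 1" for i q n a b :: real
    using that by algebra
  have d: "has_d2 (\<lambda>t. ln ((norm (z + t *\<^sub>R x))\<^sup>2)) (inverse ?q * (2 * inner z x))
     (- (inverse ?q ^ 2) * (2 * inner z x)\<^sup>2 + inverse ?q * (2 * (norm x)\<^sup>2))" for x
  proof -
    have "\<forall>\<^sub>F y in nhds ?q. 0 < y" using q by (intro eventually_nhds_in_open[of "{0<..}", simplified]) auto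
    then have "\<forall>\<^sub>F y in nhds ?q. (ln has_real_derivative inverse y) (at y)"
      by eventually_elim (auto intro!: derivative_eq_intros simp: field_simps)
    moreover have "(inverse has_real_derivative - (inverse ?q ^ 2)) (at ?q)"
      using q by (auto intro!: derivative_eq_intros simp: field_simps power2_eq_square)
    ultimately show ?thesis
      by (intro has_d2_compose_at[OF has_d2_norm_square]) simp_all
  qed
  have "line_laplacian (\<lambda>z. ln ((norm z)\<^sup>2)) z x =
    (- (inverse ?q ^ 2) * (2 * inner z x)\<^sup>2 + inverse ?q * (2 * (norm x)\<^sup>2)) +
    (- (inverse ?q ^ 2) * (2 * inner z (\<i> *s x))\<^sup>2 + inverse ?q * (2 * (norm (\<i> *s x))\<^sup>2))"
    by (rule line_laplacian_eq[OF C2_on_ln_norm_square _ _ d d]) (use assms in auto)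
  also have "\<dots> = 4 * inverse ?q ^ 2 * (?q * (norm x)\<^sup>2 - ((inner z x)\<^sup>2 + (inner z (\<i> *s x))\<^sup>2))"
    unfolding norm_imaginary by (rule square) (use q in simp)
  also have "\<dots> \<ge> 0" using complex_bessel[of z x] by simp
  finally show ?thesis .
qed

text \<open>Completing the square after multiplication by \<open>q\<close>; \<open>q = 0\<close>
  forces \<open>s1 = s2 = 0\<close>. In the application \<open>q\<close> and \<open>n\<close> are
  squared norms of the point and of the direction, \<open>s1, s2\<close> their inner products, and
  \<open>y1, y2\<close> multiples of derivatives of the exponent.\<close>

lemma quadratic_form_nonneg:
  fixes q n :: real
  assumes "0 \<le> q" "0 \<le> n" "s1\<^sup>2 + s2\<^sup>2 \<le> q * n"
  shows "0 \<le> 4 * n + 4 * (s1 * y1 + s2 * y2) + q * (y1\<^sup>2 + y2\<^sup>2)"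
proof (cases "q = 0")
  case True
  then have "s1\<^sup>2 + s2\<^sup>2 = 0" using assms(3) sum_power2_ge_zero[of s1 s2] by simp
  then have "s1 = 0" "s2 = 0" by (auto simp: sum_power2_eq_zero_iff)
  then show ?thesis using assms True by simp
next
  case False
  have "0 \<le> (2 * s1 + q * y1)\<^sup>2 + (2 * s2 + q * y2)\<^sup>2" by simp
  also have "\<dots> = 4 * (s1\<^sup>2 + s2\<^sup>2) + q * (4 * (s1 * y1 + s2 * y2) + q * (y1\<^sup>2 + y2\<^sup>2))"
    by (simp add: power2_eq_square algebra_simps)
  also have "\<dots> \<le> q * (4 * n + 4 * (s1 * y1 + s2 * y2) + q * (y1\<^sup>2 + y2\<^sup>2))"
    using assms(3) by (simp add: algebra_simps)
  finally show ?thesis using False assms(1) by (simp add: zero_le_mult_iff)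
qed

text \<open>\<open>12 = 8 + 4\<close>: the cutoff costs the Laplacian at most \<open>4 * 2\<close>
  times the squared norm of the direction, and 4 are kept as the surplus that
  \<open>line_laplacian_bump\<close> lives on.\<close>

definition bump_K :: "real \<Rightarrow> real" where
  "bump_K \<sigma> = 12 / \<sigma>"

text \<open>A constant by which the Laplacian of the exponent dominates its squared gradient. With
  \<open>a\<close> the squared gradient of \<open>F\<close>, the former is at least
  \<open>4 * n + 2 * a\<close>, the latter at most \<open>32 * n + 2 * (K + 2)\<^sup>2 * a\<close>;
  the denominator is a factor that covers both coefficients.\<close>

definition bump_gap :: "real \<Rightarrow> real" where
  "bump_gap \<sigma> = 1 / (8 + (bump_K \<sigma> + 2)\<^sup>2)"

text \<open>The exponential bounds the exponential factor of the bump from below on the unit ball.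
  The second factor is what completing the square leaves of \<open>4\<close> when the squared
  gradient of the exponent carries the weight \<open>1 + bump_gap \<sigma>\<close>.\<close>

definition bump_levi :: "real \<Rightarrow> real" where
  "bump_levi \<sigma> = exp (- (bump_K \<sigma> + 1)) * (4 * bump_gap \<sigma> / (1 + bump_gap \<sigma>))"

lemma bump_gap_pos: "0 < bump_gap \<sigma>"
  unfolding bump_gap_def using zero_le_power2[of "bump_K \<sigma> + 2"] by (simp add: add_pos_nonneg)

lemma bump_levi_pos: "0 < bump_levi \<sigma>"
  using bump_gap_pos[of \<sigma>] by (simp add: bump_levi_def)

text \<open>\<open>F\<close> is to be \<open>\<phi> \<circ> \<Phi>\<close> in a doubled coordinate.
  The radius 2 leaves an annulus beyond \<open>norm z = 1\<close>, where the cutoff is constant and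
  the bump can be continued by a function of \<open>\<phi>\<close> alone.\<close>

locale squeezing_bump =
  fixes F :: "complex^'m \<Rightarrow> real" and \<sigma> :: real
  assumes C2: "C2_on (ball 0 2) F" and range: "z \<in> ball 0 2 \<Longrightarrow> F z \<in> {0..1}"
    and \<sigma>: "0 < \<sigma>" and levi: "z \<in> ball 0 2 \<Longrightarrow> \<sigma> * (norm x)\<^sup>2 \<le> line_laplacian F z x"
begin

abbreviation K :: real where "K \<equiv> bump_K \<sigma>"

text \<open>The constant makes it vanish at 1, so that it is nonpositive on \<open>{0..1}\<close>
  and the bump does not exceed 1.\<close>

definition weight :: "real \<Rightarrow> real" where
  "weight y = K * y + y\<^sup>2 - (K + 1)"

definition bump :: "complex^'m \<Rightarrow> real" where
  "bump z = cutoff ((norm z)\<^sup>2) * exp (weight (F z))"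

lemma K_pos: "0 < K"
  using \<sigma> by (simp add: bump_K_def)

lemma weight_deriv: "(weight has_real_derivative K + 2 * y) (at y)"
  unfolding weight_def[abs_def] by (auto intro!: derivative_eq_intros)

lemma weight_deriv2: "((\<lambda>y. K + 2 * y) has_real_derivative 2) (at y)"
  by (auto intro!: derivative_eq_intros)

lemma C2_on_weight:
  fixes f :: "complex^'k \<Rightarrow> real"
  assumes "C2_on S f" "open S"
  shows "C2_on S (\<lambda>z. weight (f z))"
  by (rule C2_on_compose_real[OF assms, where T = UNIV, OF _ weight_deriv weight_deriv2]) auto

lemma C2_on_exp_weight:
  fixes f :: "complex^'k \<Rightarrow> real"
  assumes "C2_on S f" "open S"
  shows "C2_on S (\<lambda>z. exp (weight (f z)))"
  by (rule C2_on_compose_real[OF C2_on_weight[OF assms] assms(2), where T = UNIV and ?h1.0 = exp and ?h2.0 = exp])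
     (auto intro!: continuous_intros derivative_eq_intros)

lemma C2_on_bump: "C2_on (ball 0 2) bump"
  unfolding bump_def[abs_def]
proof (intro C2_on_mult C2_on_exp_weight C2)
  show "C2_on (ball 0 2) (\<lambda>z :: complex^'m. cutoff ((norm z)\<^sup>2))"
    by (rule C2_on_compose_real[OF C2_on_norm_square _ _ cutoff_deriv cutoff1_deriv continuous_cutoff2]) auto
qed auto

lemma bump_pos: "z \<noteq> 0 \<Longrightarrow> 0 < bump z"
  by (simp add: bump_def cutoff_pos)

lemma has_d2_weight:
  assumes "z \<in> ball 0 2"
  shows "has_d2 (\<lambda>t. weight (F (z + t *\<^sub>R x))) ((K + 2 * F z) * dir_deriv x F z)
    (2 * (dir_deriv x F z)\<^sup>2 + (K + 2 * F z) * dir_deriv x (dir_deriv x F) z)"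
  by (rule has_d2_compose_at[OF C2_on_has_d2[OF C2 open_ball assms] _ _ weight_deriv2])
     (simp_all add: weight_deriv)

lemma weight_laplacian:
  assumes "z \<in> ball 0 2"
  shows "12 * (norm x)\<^sup>2 \<le> (K + 2 * F z) * line_laplacian F z x"
proof -
  have "12 * (norm x)\<^sup>2 = K * (\<sigma> * (norm x)\<^sup>2)" using \<sigma> by (simp add: bump_K_def)
  also have "\<dots> \<le> (K + 2 * F z) * line_laplacian F z x"
    using range[OF assms] K_pos \<sigma> levi[OF assms] by (intro mult_mono) auto
  finally show ?thesis .
qed

lemma C2_on_ln_bump: "C2_on (ball 0 2 - {0}) (\<lambda>z. ln (bump z))"
  by (rule C2_on_compose_real[OF C2_on_subset[OF C2_on_bump], where T = "{0<..}" and ?h1.0 = inverse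
        and ?h2.0 = "\<lambda>y. - (inverse y ^ 2)"])
     (auto intro!: derivative_eq_intros continuous_intros bump_pos simp: field_simps power2_eq_square)

text \<open>Three contributions: the cutoff gives at least \<open>-8\<close> times the squared norm
  of \<open>x\<close>, where \<open>lncut2 \<le> 0\<close> allows \<open>complex_bessel\<close> to
  be inserted; the square in \<open>weight\<close> gives squared derivatives of \<open>F\<close>;
  the Levi bound of \<open>F\<close> gives at least 12.\<close>

lemma line_laplacian_ln_bump:
  assumes z: "z \<in> ball 0 2" "z \<noteq> 0"
  shows "0 \<le> line_laplacian (\<lambda>z. ln (bump z)) z x"
proof -
  let ?q = "(norm z)\<^sup>2"
  have q: "0 < ?q" using z by simp
  have ln_bump: "ln (cutoff ((norm z)\<^sup>2)) + weight (F z) = ln (bump z)" if "z \<noteq> 0" for z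
    using that cutoff_pos[of "(norm z)\<^sup>2"] by (simp add: bump_def ln_mult)
  have d: "has_d2 (\<lambda>t. ln (bump (z + t *\<^sub>R x))) (lncut1 ?q * (2 * inner z x) + (K + 2 * F z) * dir_deriv x F z)
     ((lncut2 ?q * (2 * inner z x)\<^sup>2 + lncut1 ?q * (2 * (norm x)\<^sup>2)) +
      (2 * (dir_deriv x F z)\<^sup>2 + (K + 2 * F z) * dir_deriv x (dir_deriv x F) z))" for x
  proof (rule has_d2_cong[OF has_d2_add[OF _ has_d2_weight[OF z(1)]]])
    have "\<forall>\<^sub>F y in nhds ?q. 0 < y" using q by (intro eventually_nhds_in_open[of "{0<..}", simplified]) auto
    then have "\<forall>\<^sub>F y in nhds ?q. ((\<lambda>t. ln (cutoff t)) has_real_derivative lncut1 y) (at y)"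
      by eventually_elim (rule ln_cutoff_deriv)
    from has_d2_compose_at[OF has_d2_norm_square[of z x] _ this lncut1_deriv[OF q]]
    show "has_d2 (\<lambda>t. ln (cutoff ((norm (z + t *\<^sub>R x))\<^sup>2))) (lncut1 ?q * (2 * inner z x))
       (lncut2 ?q * (2 * inner z x)\<^sup>2 + lncut1 ?q * (2 * (norm x)\<^sup>2))" by simp
    have "((\<lambda>t. z + t *\<^sub>R x) \<longlongrightarrow> z + 0 *\<^sub>R x) (nhds 0)"
      by (intro tendsto_intros filterlim_ident)
    then have "\<forall>\<^sub>F t in nhds 0. z + t *\<^sub>R x \<noteq> 0"
      using tendsto_imp_eventually_ne z(2) by (metis add.right_neutral scale_zero_left)
    then show "\<forall>\<^sub>F t in nhds 0. ln (cutoff ((norm (z + t *\<^sub>R x))\<^sup>2)) + weight (F (z + t *\<^sub>R x)) = ln (bump (z + t *\<^sub>R x))"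
      by eventually_elim (rule ln_bump)
  qed
  let ?s = "(inner z x)\<^sup>2 + (inner z (\<i> *s x))\<^sup>2"
  have "line_laplacian (\<lambda>z. ln (bump z)) z x =
     ((lncut2 ?q * (2 * inner z x)\<^sup>2 + lncut1 ?q * (2 * (norm x)\<^sup>2)) +
      (2 * (dir_deriv x F z)\<^sup>2 + (K + 2 * F z) * dir_deriv x (dir_deriv x F) z)) +
     ((lncut2 ?q * (2 * inner z (\<i> *s x))\<^sup>2 + lncut1 ?q * (2 * (norm (\<i> *s x))\<^sup>2)) +
      (2 * (dir_deriv (\<i> *s x) F z)\<^sup>2 + (K + 2 * F z) * dir_deriv (\<i> *s x) (dir_deriv (\<i> *s x) F) z))"
    by (rule line_laplacian_eq[OF C2_on_ln_bump _ _ d d]) (use z in auto)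
  also have "\<dots> = 4 * (lncut2 ?q * ?s + lncut1 ?q * (norm x)\<^sup>2) +
     2 * ((dir_deriv x F z)\<^sup>2 + (dir_deriv (\<i> *s x) F z)\<^sup>2) + (K + 2 * F z) * line_laplacian F z x"
    unfolding line_laplacian_def norm_imaginary by (simp add: algebra_simps power_mult_distrib)
  also have "\<dots> \<ge> 4 * (- 2 * (norm x)\<^sup>2) + 0 + 12 * (norm x)\<^sup>2"
  proof (intro add_mono weight_laplacian[OF z(1)])
    have "- 2 * (norm x)\<^sup>2 \<le> (lncut1 ?q + ?q * lncut2 ?q) * (norm x)\<^sup>2"
      using lncut_bounds(3)[OF q] by (intro mult_right_mono) auto
    also have "\<dots> = lncut2 ?q * (?q * (norm x)\<^sup>2) + lncut1 ?q * (norm x)\<^sup>2" by (simp add: algebra_simps)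
    also have "\<dots> \<le> lncut2 ?q * ?s + lncut1 ?q * (norm x)\<^sup>2"
      using mult_left_mono_neg[OF complex_bessel[of z x] lncut_bounds(2)[OF q]] by simp
    finally show "4 * (- 2 * (norm x)\<^sup>2) \<le> 4 * (lncut2 ?q * ?s + lncut1 ?q * (norm x)\<^sup>2)" by simp
  qed auto
  finally show ?thesis using zero_le_power2[of "norm x"] by linarith
qed

text \<open>On the unit ball the bump is the squared norm times \<open>exp (\<rho> z)\<close>, a
  form that includes \<open>z = 0\<close>. Its Laplacian is a quadratic form in the derivatives
  \<open>R\<close> of the exponent; bounding \<open>T x + T y\<close> by
  \<open>bump_gap \<sigma>\<close> times the squares of \<open>R\<close> raises their coefficient
  from \<open>q\<close> to \<open>(1 + bump_gap \<sigma>) * q\<close>, and completing the square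
  then leaves a fixed part of \<open>4 * n\<close>.\<close>

lemma line_laplacian_bump:
  assumes z: "norm z < 1"
  shows "bump_levi \<sigma> * (norm x)\<^sup>2 \<le> line_laplacian bump z x"
proof -
  let ?q = "(norm z)\<^sup>2"
  define n where "n = (norm x)\<^sup>2"
  have z2: "z \<in> ball 0 2" using z by simp
  have q: "0 \<le> ?q" "?q \<le> 1" using z by (auto intro: power_le_one)
  define \<rho> where "\<rho> z = cut_exp ((norm z)\<^sup>2) + weight (F z)" for z
  define s where "s x = inner z x" for x
  define A where "A x = dir_deriv x F z" for x
  define B where "B x = dir_deriv x (dir_deriv x F) z" for x
  define R where "R x = (?q - 2) * (2 * s x) + (K + 2 * F z) * A x" for x
  define T where "T x = (1 * (2 * s x)\<^sup>2 + (?q - 2) * (2 * (norm x)\<^sup>2)) + (2 * (A x)\<^sup>2 + (K + 2 * F z) * B x)" for x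
  have d\<rho>: "has_d2 (\<lambda>t. \<rho> (z + t *\<^sub>R x)) (R x) (T x)" for x
    unfolding \<rho>_def R_def T_def A_def B_def s_def
  proof (rule has_d2_add[OF _ has_d2_weight[OF z2]])
    have "((\<lambda>t::real. t - 2) has_real_derivative 1) (at ?q)" by (auto intro!: derivative_eq_intros)
    from has_d2_compose_at[OF has_d2_norm_square[of z x] _ always_eventually[OF allI[OF cut_exp_deriv]] this]
    show "has_d2 (\<lambda>t. cut_exp ((norm (z + t *\<^sub>R x))\<^sup>2)) ((?q - 2) * (2 * inner z x))
        (1 * (2 * inner z x)\<^sup>2 + (?q - 2) * (2 * (norm x)\<^sup>2))" by simp
  qed
  have d: "has_d2 (\<lambda>t. bump (z + t *\<^sub>R x)) (2 * s x * exp (\<rho> z) + ?q * (exp (\<rho> z) * R x))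
     (2 * (norm x)\<^sup>2 * exp (\<rho> z) + 2 * (2 * s x) * (exp (\<rho> z) * R x) + ?q * (exp (\<rho> z) * (R x)\<^sup>2 + exp (\<rho> z) * T x))" for x
  proof (rule has_d2_cong)
    have "has_d2 (\<lambda>t. exp (\<rho> (z + t *\<^sub>R x))) (exp (\<rho> z) * R x) (exp (\<rho> z) * (R x)\<^sup>2 + exp (\<rho> z) * T x)"
      by (rule has_d2_compose_at[OF d\<rho> _ _ DERIV_exp]) (simp_all add: DERIV_exp)
    from has_d2_mult[OF has_d2_norm_square[of z x] this]
    show "has_d2 (\<lambda>t. (norm (z + t *\<^sub>R x))\<^sup>2 * exp (\<rho> (z + t *\<^sub>R x))) (2 * s x * exp (\<rho> z) + ?q * (exp (\<rho> z) * R x))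
     (2 * (norm x)\<^sup>2 * exp (\<rho> z) + 2 * (2 * s x) * (exp (\<rho> z) * R x) + ?q * (exp (\<rho> z) * (R x)\<^sup>2 + exp (\<rho> z) * T x))"
      by (simp add: s_def)
    have "((\<lambda>t. norm (z + t *\<^sub>R x)) \<longlongrightarrow> norm (z + 0 *\<^sub>R x)) (nhds 0)"
      by (intro tendsto_intros filterlim_ident)
    then have "\<forall>\<^sub>F t in nhds 0. norm (z + t *\<^sub>R x) < 1"
      using order_tendstoD(2)[of "\<lambda>t. norm (z + t *\<^sub>R x)" _ "nhds 0" 1] z by simp
    then show "\<forall>\<^sub>F t in nhds 0. (norm (z + t *\<^sub>R x))\<^sup>2 * exp (\<rho> (z + t *\<^sub>R x)) = bump (z + t *\<^sub>R x)"
    proof eventually_elim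
      case (elim t)
      then have "(norm (z + t *\<^sub>R x))\<^sup>2 \<le> 1" by (intro power_le_one) auto
      then show ?case by (simp add: bump_def \<rho>_def cutoff_def exp_add)
    qed
  qed
  define y where "y = \<i> *s x"
  have ny: "(norm y)\<^sup>2 = n" by (simp add: y_def n_def norm_imaginary)
  have lap: "line_laplacian bump z x = exp (\<rho> z) *
      (4 * n + 4 * (s x * R x + s y * R y) + ?q * ((R x)\<^sup>2 + (R y)\<^sup>2 + (T x + T y)))"
  proof -
    have "line_laplacian bump z x =
     (2 * (norm x)\<^sup>2 * exp (\<rho> z) + 2 * (2 * s x) * (exp (\<rho> z) * R x) + ?q * (exp (\<rho> z) * (R x)\<^sup>2 + exp (\<rho> z) * T x)) +
     (2 * (norm y)\<^sup>2 * exp (\<rho> z) + 2 * (2 * s y) * (exp (\<rho> z) * R y) + ?q * (exp (\<rho> z) * (R y)\<^sup>2 + exp (\<rho> z) * T y))"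
      unfolding y_def by (rule line_laplacian_eq[OF C2_on_bump _ z2 d d]) auto
    then show ?thesis unfolding ny n_def[symmetric] by (simp add: algebra_simps)
  qed
  have bessel: "(s x)\<^sup>2 + (s y)\<^sup>2 \<le> ?q * n"
    using complex_bessel[of z x] by (simp add: s_def y_def n_def)
  have n: "0 \<le> n" by (simp add: n_def)
  \<comment> \<open>Laplacian of the exponent: 12 from the Levi bound of \<open>F\<close>, at worst
    \<open>-8\<close> from \<open>cut_exp\<close>, and the squared gradient of \<open>F\<close> from
    the square in \<open>weight\<close>, the only term that can control \<open>R\<close>.\<close>
  have T: "4 * n + 2 * ((A x)\<^sup>2 + (A y)\<^sup>2) \<le> T x + T y"
  proof -
    have arith: "t = 4 * S + P + 2 * a + X \<Longrightarrow> 12 * n \<le> X \<Longrightarrow> - 2 * (4 * n) \<le> P \<Longrightarrow> 0 \<le> S \<Longrightarrow>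
      4 * n + 2 * a \<le> t" for t S P a X :: real by linarith
    have "T x + T y = 4 * ((s x)\<^sup>2 + (s y)\<^sup>2) + (?q - 2) * (4 * n) + 2 * ((A x)\<^sup>2 + (A y)\<^sup>2) + (K + 2 * F z) * (B x + B y)"
      unfolding T_def ny n_def[symmetric] by (simp add: algebra_simps power_mult_distrib)
    moreover have "12 * n \<le> (K + 2 * F z) * (B x + B y)"
      using weight_laplacian[OF z2, of x] by (simp add: B_def line_laplacian_def y_def n_def)
    moreover have "- 2 * (4 * n) \<le> (?q - 2) * (4 * n)" using q n by (intro mult_right_mono) auto
    moreover have "0 \<le> (s x)\<^sup>2 + (s y)\<^sup>2" by simp
    ultimately show ?thesis by (rule arith)
  qed
  have R: "bump_gap \<sigma> * ((R x)\<^sup>2 + (R y)\<^sup>2) \<le> T x + T y"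
  proof -
    have R1: "(R v)\<^sup>2 \<le> 32 * (s v)\<^sup>2 + 2 * (K + 2)\<^sup>2 * (A v)\<^sup>2" for v
    proof -
      have "(R v)\<^sup>2 \<le> 2 * ((?q - 2) * (2 * s v))\<^sup>2 + 2 * ((K + 2 * F z) * A v)\<^sup>2"
        unfolding R_def using sum_squares_bound[of "(?q - 2) * (2 * s v)" "(K + 2 * F z) * A v"]
        by (simp add: power2_sum)
      also have "\<dots> = 8 * (?q - 2)\<^sup>2 * (s v)\<^sup>2 + 2 * (K + 2 * F z)\<^sup>2 * (A v)\<^sup>2"
        by (simp add: power_mult_distrib)
      also have "\<dots> \<le> 32 * (s v)\<^sup>2 + 2 * (K + 2)\<^sup>2 * (A v)\<^sup>2"
      proof -
        have "(?q - 2)\<^sup>2 \<le> 2\<^sup>2" using q by (intro power2_le_iff_abs_le[THEN iffD2]) auto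
        moreover have "(K + 2 * F z)\<^sup>2 \<le> (K + 2)\<^sup>2" using range[OF z2] K_pos by (intro power_mono) auto
        ultimately show ?thesis by (intro add_mono mult_right_mono) auto
      qed
      finally show ?thesis .
    qed
    have "(s x)\<^sup>2 + (s y)\<^sup>2 \<le> n" using bessel q n mult_right_mono[of ?q 1 n] by simp
    then have "(R x)\<^sup>2 + (R y)\<^sup>2 \<le> 32 * n + 2 * (K + 2)\<^sup>2 * ((A x)\<^sup>2 + (A y)\<^sup>2)"
      using R1[of x] R1[of y] by (simp add: algebra_simps)
    also have "\<dots> \<le> (8 + (K + 2)\<^sup>2) * (4 * n + 2 * ((A x)\<^sup>2 + (A y)\<^sup>2))"
      using n by (simp add: algebra_simps add_nonneg_nonneg)
    also have "\<dots> \<le> (8 + (K + 2)\<^sup>2) * (T x + T y)"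
      using T by (intro mult_left_mono) auto
    finally show ?thesis
      unfolding bump_gap_def using zero_le_power2[of "K + 2"] by (simp add: field_simps add_pos_nonneg)
  qed
  have main: "4 * bump_gap \<sigma> / (1 + bump_gap \<sigma>) * n \<le>
      4 * n + 4 * (s x * R x + s y * R y) + ?q * ((R x)\<^sup>2 + (R y)\<^sup>2 + (T x + T y))"
  proof -
    \<comment> \<open>The form is taken at \<open>(1 + bump_gap \<sigma>)\<close> times
      \<open>R\<close>; dividing by that factor leaves
      \<open>4 * n - 4 * n / (1 + bump_gap \<sigma>)\<close>.\<close>
    have "0 \<le> 4 * n + 4 * (s x * ((1 + bump_gap \<sigma>) * R x) + s y * ((1 + bump_gap \<sigma>) * R y)) +
        ?q * (((1 + bump_gap \<sigma>) * R x)\<^sup>2 + ((1 + bump_gap \<sigma>) * R y)\<^sup>2)"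
      by (rule quadratic_form_nonneg[OF q(1) n bessel])
    then have "4 * bump_gap \<sigma> * n \<le> (1 + bump_gap \<sigma>) * (4 * n + 4 * (s x * R x + s y * R y) + ?q * ((1 + bump_gap \<sigma>) * ((R x)\<^sup>2 + (R y)\<^sup>2)))"
      by (simp add: algebra_simps power2_eq_square)
    then have "4 * bump_gap \<sigma> / (1 + bump_gap \<sigma>) * n \<le> 4 * n + 4 * (s x * R x + s y * R y) + ?q * ((1 + bump_gap \<sigma>) * ((R x)\<^sup>2 + (R y)\<^sup>2))"
      using bump_gap_pos[of \<sigma>] by (simp add: field_simps)
    also have "\<dots> \<le> 4 * n + 4 * (s x * R x + s y * R y) + ?q * ((R x)\<^sup>2 + (R y)\<^sup>2 + (T x + T y))"
      using mult_left_mono[OF R q(1)] by (simp add: algebra_simps)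
    finally show ?thesis .
  qed
  have "- (K + 1) \<le> \<rho> z"
  proof -
    have "0 \<le> K * F z" using range[OF z2] K_pos by simp
    moreover have "0 \<le> (F z)\<^sup>2" "0 \<le> (1 - ?q)\<^sup>2 / 2" by auto
    ultimately show ?thesis using q unfolding \<rho>_def weight_def cut_exp_def by linarith
  qed
  then have "exp (- (K + 1)) * (4 * bump_gap \<sigma> / (1 + bump_gap \<sigma>) * n) \<le> line_laplacian bump z x"
    unfolding lap using main bump_gap_pos[of \<sigma>] n by (intro mult_mono) auto
  then show ?thesis by (simp add: bump_levi_def n_def)
qed

end

section \<open>Embedded balls in complex manifolds\<close>

lemma open_unit_ball: "open unit_ball"
  by (simp add: unit_ball_def)

lemma sum_cmod_squares: "(\<Sum>j\<in>UNIV. (cmod (x $ j))\<^sup>2) = (norm (x :: complex^'m))\<^sup>2"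
  by (simp add: norm_vec_def L2_set_def sum_nonneg)

lemma levi_ge_iff:
  fixes f :: "complex^'m \<Rightarrow> real"
  assumes "C2_on S f" "open S"
  shows "levi_ge S f c \<longleftrightarrow> (\<forall>w\<in>S. \<forall>x. 4 * c * (norm x)\<^sup>2 \<le> line_laplacian f w x)"
proof -
  have "c * (norm x)\<^sup>2 \<le> Re (levi_form f w x) \<longleftrightarrow> 4 * c * (norm x)\<^sup>2 \<le> line_laplacian f w x"
    if "w \<in> S" for w x
    unfolding levi_form_eq_line_laplacian[OF assms that] by auto
  then show ?thesis unfolding levi_ge_def sum_cmod_squares by blast
qed

lemma mat_of_real_mult: "mat (complex_of_real r) *v x = r *\<^sub>R (x :: complex^'m)"
proof -
  have "(mat (complex_of_real r) *v x) $ i = (\<Sum>j\<in>UNIV. if j = i then of_real r * x $ j else 0)" for i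
    unfolding matrix_vector_mult_def mat_def vec_lambda_beta by (intro sum.cong) auto
  then have "(mat (complex_of_real r) *v x) $ i = of_real r * x $ i" for i by (simp only: sum.delta) simp
  then show ?thesis unfolding vec_eq_iff by (simp add: scaleR_conv_of_real[where 'a = complex])
qed

lemma has_derivative_scaleR_matrix:
  "((\<lambda>w :: complex^'m. r *\<^sub>R w) has_derivative (\<lambda>x. mat (complex_of_real r) *v x)) (at w)"
  unfolding mat_of_real_mult by (auto intro!: derivative_eq_intros)

lemma holo_on_scaleR: "holo_on S (\<lambda>w :: complex^'m. r *\<^sub>R w)"
  unfolding holo_on_def using has_derivative_scaleR_matrix by blast

lemma line_laplacian_scaleR:
  fixes f :: "complex^'m \<Rightarrow> real"
  assumes "C2_on T f" "open T" "r *\<^sub>R w \<in> T"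
  shows "line_laplacian (\<lambda>w. f (r *\<^sub>R w)) w x = line_laplacian f (r *\<^sub>R w) (r *\<^sub>R x)"
proof -
  have "open ((\<lambda>w. r *\<^sub>R w) -` T)" by (intro open_vimage assms(2) continuous_intros)
  from line_laplacian_holo_compose[OF assms(1) this holo_on_scaleR _ assms(2) _ has_derivative_scaleR_matrix, where w = w and v = x]
  show ?thesis using assms(3) by (auto simp: mat_of_real_mult)
qed

lemma line_laplacian_cong:
  fixes f :: "complex^'m \<Rightarrow> real"
  assumes "C2_on S f" "open S" "\<And>z. z \<in> S \<Longrightarrow> f z = g z" "w \<in> S"
  shows "line_laplacian f w x = line_laplacian g w x"
proof -
  have "\<forall>\<^sub>F z in nhds w. dir_deriv v f z = dir_deriv v g z" for v
    using eventually_nhds_in_open[OF assms(2,4)]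
  proof eventually_elim
    case (elim z)
    have "\<forall>\<^sub>F y in nhds z. f y = g y"
      using eventually_nhds_in_open[OF assms(2) elim] by eventually_elim (rule assms(3))
    then show ?case by (rule dir_deriv_cong)
  qed
  then have "dir_deriv v (dir_deriv v f) w = dir_deriv v (dir_deriv v g) w" for v
    by (rule dir_deriv_cong)
  then show ?thesis unfolding line_laplacian_def by presburger
qed

text \<open>Equal dimensions make an injective \<open>J\<close> invertible, and the strong inverse
  function theorem then differentiates the given left inverse.\<close>

lemma holo_inverse:
  fixes f g :: "complex^'m \<Rightarrow> complex^'m"
  assumes "open S" "\<And>w. w \<in> S \<Longrightarrow> \<exists>J. (f has_derivative (\<lambda>x. J *v x)) (at w) \<and> inj (\<lambda>x. J *v x)"
    "\<And>w. w \<in> S \<Longrightarrow> g (f w) = w" "w \<in> S"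
  shows "\<exists>J. (g has_derivative (\<lambda>x. J *v x)) (at (f w)) \<and> inj (\<lambda>x. J *v x)"
proof -
  obtain J where J: "(f has_derivative (\<lambda>x. J *v x)) (at w)" "inj (\<lambda>x. J *v x)"
    using assms(2,4) by blast
  obtain J' where J': "J' ** J = mat 1"
    using J(2) matrix_left_invertible_injective[of J] by blast
  then have "J ** J' = mat 1" by (simp add: matrix_left_right_inverse)
  then have id: "(\<lambda>x. J *v x) \<circ> (\<lambda>x. J' *v x) = id"
    by (auto simp: fun_eq_iff matrix_vector_mul_assoc)
  have "continuous_on S f"
    using assms(2) has_derivative_continuous continuous_at_imp_continuous_on by blast
  from has_derivative_inverse_strong[OF assms(1,4) this assms(3) J(1) id]
  have "(g has_derivative (\<lambda>x. J' *v x)) (at (f w))" by blast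
  moreover have "inj (\<lambda>x. J' *v x)" using id by (metis inj_on_id inj_on_imageI2)
  ultimately show ?thesis by blast
qed

text \<open>At zeros of \<open>f\<close> the logarithm is \<open>-\<infinity>\<close> and the
  pointwise test is vacuous.\<close>

lemma psh_on_logI:
  fixes S :: "(complex^'m) set"
  assumes "continuous_on S f" "\<And>z. z \<in> S \<Longrightarrow> 0 \<le> f z"
    and "\<And>a v \<tau>. a + \<tau> *s v \<in> S \<Longrightarrow> 0 < f (a + \<tau> *s v) \<Longrightarrow> viscosity_sub (\<lambda>\<tau>. log_ereal (f (a + \<tau> *s v))) \<tau>"
  shows "psh_on S (\<lambda>z. log_ereal (f z))"
proof (rule psh_onI)
  show "usc_on S (\<lambda>z. log_ereal (f z))" by (rule usc_on_log_ereal[OF assms(1,2)])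
  fix a v \<tau> assume z: "a + \<tau> *s v \<in> S"
  show "viscosity_sub (\<lambda>\<tau>. log_ereal (f (a + \<tau> *s v))) \<tau>"
  proof (cases "f (a + \<tau> *s v) = 0")
    case True
    then show ?thesis by (simp add: viscosity_sub_def log_ereal_def)
  next
    case False
    then have "0 < f (a + \<tau> *s v)" using assms(2)[OF z] by simp
    then show ?thesis by (rule assms(3)[OF z])
  qed
qed (simp add: log_ereal_def)

lemma open_line_preimage: "open S \<Longrightarrow> open {\<tau>. a + \<tau> *s (v :: complex^'m) \<in> S}"
  using open_vimage[OF _ continuous_on_line, of S a v] by (simp add: vimage_def)

lemma psh_on_exp:
  fixes S :: "(complex^'m) set"
  assumes "psh_on S (\<lambda>z. log_ereal (f z))" "open S" "continuous_on S f" "\<And>z. z \<in> S \<Longrightarrow> 0 \<le> f z"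
  shows "psh_on S (\<lambda>z. ereal (f z))"
proof (rule psh_onI)
  show "usc_on S (\<lambda>z. ereal (f z))" by (rule usc_on_ereal[OF assms(3)])
  fix a v \<tau> assume z: "a + \<tau> *s v \<in> S"
  have "\<forall>\<^sub>F \<tau> in nhds \<tau>. a + \<tau> *s v \<in> S"
    using eventually_nhds_in_open[OF open_line_preimage[OF assms(2), of a v], of \<tau>] z by simp
  then have "\<forall>\<^sub>F \<tau> in nhds \<tau>. 0 \<le> f (a + \<tau> *s v)" by eventually_elim (rule assms(4))
  with psh_on_imp_viscosity_sub[OF assms(1,2) z] show "viscosity_sub (\<lambda>\<tau>. ereal (f (a + \<tau> *s v))) \<tau>" by (rule viscosity_sub_exp)
qed simp

text \<open>\<open>holo_embedding\<close> of the ball with its one-chart atlas unfolded and with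
  injectivity in place of the topological embedding condition; equality of dimensions reconciles the
  two in \<open>holo_embedding_ball_iff\<close>.\<close>

definition ball_embedding :: "'a topology \<Rightarrow> ('a, 'm::finite) chart set \<Rightarrow> (complex^'m \<Rightarrow> 'a) \<Rightarrow> bool" where
  "ball_embedding M A \<Phi> \<longleftrightarrow> continuous_map (top_of_set unit_ball) M \<Phi> \<and> inj_on \<Phi> unit_ball \<and>
     (\<forall>(U, \<kappa>)\<in>A. \<forall>w\<in>unit_ball. \<Phi> w \<in> U \<longrightarrow>
        (\<exists>J. ((\<lambda>z. \<kappa> (\<Phi> z)) has_derivative (\<lambda>x. J *v x)) (at w) \<and> inj (\<lambda>x. J *v x)))"

locale cmanifold =
  fixes M :: "'a topology" and A :: "('a, 'm::finite) chart set"
  assumes manifold: "complex_manifold M A"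
begin

lemma Hausdorff: "Hausdorff_space M"
  using manifold by (simp add: complex_manifold_def)

lemma chart_at:
  assumes "p \<in> topspace M"
  obtains U \<kappa> where "(U, \<kappa>) \<in> A" "p \<in> U"
proof -
  have "p \<in> (\<Union>(U, \<kappa>)\<in>A. U)" using assms manifold by (simp add: complex_manifold_def)
  then show ?thesis using that by blast
qed

context
  fixes U \<kappa> assumes chart: "(U, \<kappa>) \<in> A"
begin

lemma chart_props:
  "openin M U" "open (\<kappa> ` U)" "homeomorphic_map (subtopology M U) (top_of_set (\<kappa> ` U)) \<kappa>"
proof -
  have "\<forall>(U, \<kappa>)\<in>A. openin M U \<and> open (\<kappa> ` U) \<and>
        homeomorphic_map (subtopology M U) (top_of_set (\<kappa> ` U)) \<kappa>"
    using manifold unfolding complex_manifold_def by (elim conjE)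
  from bspec[OF this chart]
  show "openin M U" "open (\<kappa> ` U)" "homeomorphic_map (subtopology M U) (top_of_set (\<kappa> ` U)) \<kappa>"
    by simp_all
qed

lemma chart_subset: "U \<subseteq> topspace M"
  using chart_props(1) openin_subset by blast

lemma chart_inj: "inj_on \<kappa> U"
  using homeomorphic_imp_injective_map[OF chart_props(3)] chart_subset by (simp add: inf.absorb2)

lemma chart_inv: "p \<in> U \<Longrightarrow> inv_into U \<kappa> (\<kappa> p) = p"
  using chart_inj by (rule inv_into_f_f)

lemma chart_inv_in: "z \<in> \<kappa> ` U \<Longrightarrow> inv_into U \<kappa> z \<in> U"
  by (rule inv_into_into)

lemma chart_open:
  assumes "openin M V"
  shows "open (\<kappa> ` (U \<inter> V))"
proof -
  have "openin (subtopology M U) (U \<inter> V)"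
    using chart_props(1) assms by (simp add: openin_open_subtopology openin_Int)
  then have "openin (top_of_set (\<kappa> ` U)) (\<kappa> ` (U \<inter> V))"
    using homeomorphic_imp_open_map[OF chart_props(3)] unfolding open_map_def by blast
  then show ?thesis by (simp add: openin_open_eq[OF chart_props(2)])
qed

lemma chart_preimage:
  assumes "open T"
  shows "openin M {p \<in> U. \<kappa> p \<in> T}"
proof -
  have "continuous_map (subtopology M U) (top_of_set (\<kappa> ` U)) \<kappa>"
    using homeomorphic_imp_continuous_map[OF chart_props(3)] .
  moreover have "openin (top_of_set (\<kappa> ` U)) (\<kappa> ` U \<inter> T)" using assms by (simp add: openin_open_Int)
  ultimately have "openin (subtopology M U) {p \<in> topspace (subtopology M U). \<kappa> p \<in> \<kappa> ` U \<inter> T}"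
    by (rule openin_continuous_map_preimage)
  moreover have "{p \<in> topspace (subtopology M U). \<kappa> p \<in> \<kappa> ` U \<inter> T} = {p \<in> U. \<kappa> p \<in> T}"
    using chart_subset by auto
  ultimately have "openin (subtopology M U) {p \<in> U. \<kappa> p \<in> T}" by simp
  then show ?thesis using chart_props(1) by (rule openin_trans_full)
qed

end

lemma open_ball_preimage:
  assumes "ball_embedding M A \<Phi>" "openin M V"
  shows "open {w \<in> unit_ball. \<Phi> w \<in> V}"
proof -
  have "openin (top_of_set unit_ball) {w \<in> topspace (top_of_set unit_ball). \<Phi> w \<in> V}"
    using assms by (intro openin_continuous_map_preimage) (auto simp: ball_embedding_def)
  then have "openin (top_of_set unit_ball) {w \<in> unit_ball. \<Phi> w \<in> V}" by simp
  then show ?thesis by (simp add: openin_open_eq[OF open_unit_ball])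
qed

lemma ball_embedding_continuous_chart:
  assumes "ball_embedding M A \<Phi>" "(U, \<kappa>) \<in> A"
  shows "continuous_on {w \<in> unit_ball. \<Phi> w \<in> U} (\<lambda>z. \<kappa> (\<Phi> z))"
proof (rule continuous_at_imp_continuous_on, rule ballI)
  fix w assume "w \<in> {w \<in> unit_ball. \<Phi> w \<in> U}"
  then obtain J where "((\<lambda>z. \<kappa> (\<Phi> z)) has_derivative (\<lambda>x. J *v x)) (at w)"
    using assms unfolding ball_embedding_def by blast
  then show "isCont (\<lambda>z. \<kappa> (\<Phi> z)) w" by (rule has_derivative_continuous)
qed

lemma ball_embedding_range: "ball_embedding M A \<Phi> \<Longrightarrow> w \<in> unit_ball \<Longrightarrow> \<Phi> w \<in> topspace M"
  unfolding ball_embedding_def continuous_map_def by auto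

text \<open>Invariance of domain: \<open>\<kappa> \<circ> \<Phi>\<close> is continuous and injective
  between spaces of equal dimension, so its images are open and the chart pulls them back to
  \<open>M\<close>.\<close>

lemma ball_embedding_open:
  assumes e: "ball_embedding M A \<Phi>" and V: "open V" "V \<subseteq> unit_ball"
  shows "openin M (\<Phi> ` V)"
proof (rule openin_subopen[THEN iffD2], rule ballI)
  fix p assume "p \<in> \<Phi> ` V"
  then obtain w where w: "w \<in> V" "p = \<Phi> w" by blast
  then have "p \<in> topspace M" using ball_embedding_range[OF e] V by blast
  then obtain U \<kappa> where c: "(U, \<kappa>) \<in> A" "p \<in> U" by (rule chart_at)
  let ?W = "V \<inter> {w \<in> unit_ball. \<Phi> w \<in> U}"
  have oW: "open ?W" by (rule open_Int[OF V(1) open_ball_preimage[OF e chart_props(1)[OF c(1)]]])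
  have cW: "continuous_on ?W (\<lambda>z. \<kappa> (\<Phi> z))"
    by (rule continuous_on_subset[OF ball_embedding_continuous_chart[OF e c(1)]]) simp
  have iW: "inj_on (\<lambda>z. \<kappa> (\<Phi> z)) ?W"
  proof (rule inj_onI)
    fix z z' assume z: "z \<in> ?W" "z' \<in> ?W" "\<kappa> (\<Phi> z) = \<kappa> (\<Phi> z')"
    then have "\<Phi> z = \<Phi> z'" using inj_onD[OF chart_inj[OF c(1)]] by simp
    moreover have "inj_on \<Phi> unit_ball" using e by (simp add: ball_embedding_def)
    ultimately show "z = z'" using z by (simp add: inj_onD)
  qed
  from chart_preimage[OF c(1) invariance_of_domain[OF cW oW iW]]
  have "openin M {p \<in> U. \<kappa> p \<in> (\<lambda>z. \<kappa> (\<Phi> z)) ` ?W}" .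
  moreover have "p \<in> {p \<in> U. \<kappa> p \<in> (\<lambda>z. \<kappa> (\<Phi> z)) ` ?W}" using c w V by auto
  moreover have "{p \<in> U. \<kappa> p \<in> (\<lambda>z. \<kappa> (\<Phi> z)) ` ?W} \<subseteq> \<Phi> ` V"
  proof
    fix p' assume "p' \<in> {p \<in> U. \<kappa> p \<in> (\<lambda>z. \<kappa> (\<Phi> z)) ` ?W}"
    then obtain z where z: "p' \<in> U" "\<kappa> p' = \<kappa> (\<Phi> z)" "z \<in> V" "\<Phi> z \<in> U" by auto
    then have "p' = \<Phi> z" using inj_onD[OF chart_inj[OF c(1)]] by simp
    then show "p' \<in> \<Phi> ` V" using z by blast
  qed
  ultimately show "\<exists>T. openin M T \<and> p \<in> T \<and> T \<subseteq> \<Phi> ` V" by blast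
qed

text \<open>From right to left the point is \<open>embedding_map\<close>: a continuous injective
  open map is an embedding, and openness is \<open>ball_embedding_open\<close>.\<close>

lemma holo_embedding_ball_iff:
  "holo_embedding (top_of_set unit_ball) (std_atlas unit_ball) M A \<Phi> \<longleftrightarrow> ball_embedding M A \<Phi>"
proof -
  have inv: "inv_into unit_ball id z = z" if "z \<in> unit_ball" for z :: "complex^'m"
    using inv_into_f_f[of id unit_ball z] that by simp
  have der: "((\<kappa> \<circ> \<Phi> \<circ> inv_into unit_ball id) has_derivative D) (at w) \<longleftrightarrow>
     ((\<lambda>z. \<kappa> (\<Phi> z)) has_derivative D) (at w)" if "w \<in> unit_ball"
    for \<kappa> :: "'a \<Rightarrow> complex^'m" and D w
  proof
    assume "((\<kappa> \<circ> \<Phi> \<circ> inv_into unit_ball id) has_derivative D) (at w)"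
    then show "((\<lambda>z. \<kappa> (\<Phi> z)) has_derivative D) (at w)"
      by (rule has_derivative_transform_within_open[OF _ open_unit_ball that]) (simp add: inv)
  next
    assume "((\<lambda>z. \<kappa> (\<Phi> z)) has_derivative D) (at w)"
    then show "((\<kappa> \<circ> \<Phi> \<circ> inv_into unit_ball id) has_derivative D) (at w)"
      by (rule has_derivative_transform_within_open[OF _ open_unit_ball that]) (simp add: inv)
  qed
  define regular where "regular \<kappa> w \<longleftrightarrow>
     (\<exists>J. ((\<lambda>z. \<kappa> (\<Phi> z)) has_derivative (\<lambda>x. J *v x)) (at w) \<and> inj (\<lambda>x. J *v x))"
    for \<kappa> :: "'a \<Rightarrow> complex^'m" and w
  have reg: "(\<exists>J. ((\<kappa> \<circ> \<Phi> \<circ> inv_into unit_ball id) has_derivative (\<lambda>x. J *v x)) (at w) \<and> inj (\<lambda>x. J *v x))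
     \<longleftrightarrow> regular \<kappa> w" if "w \<in> unit_ball" for \<kappa> :: "'a \<Rightarrow> complex^'m" and w
    unfolding regular_def der[OF that] ..
  have emb: "ball_embedding M A \<Phi> \<longleftrightarrow> continuous_map (top_of_set unit_ball) M \<Phi> \<and> inj_on \<Phi> unit_ball \<and>
     (\<forall>c\<in>A. \<forall>w\<in>unit_ball \<inter> \<Phi> -` fst c. regular (snd c) w)"
    unfolding ball_embedding_def regular_def[symmetric] by (simp add: case_prod_unfold Ball_def imp_conjL)
  have imm: "holo_immersion (top_of_set unit_ball) (std_atlas unit_ball) M A \<Phi> \<longleftrightarrow>
     holo_map (top_of_set unit_ball) (std_atlas unit_ball) M A \<Phi> \<and>
     (\<forall>c\<in>A. \<forall>w\<in>unit_ball \<inter> \<Phi> -` fst c. regular (snd c) w)"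
    unfolding holo_immersion_def std_atlas_def case_prod_unfold by (simp add: reg)
  show ?thesis
  proof
    assume h: "holo_embedding (top_of_set unit_ball) (std_atlas unit_ball) M A \<Phi>"
    have "continuous_map (top_of_set unit_ball) M \<Phi>"
      using h unfolding holo_embedding_def imm holo_map_def by (elim conjE)
    moreover have "homeomorphic_map (top_of_set unit_ball) (subtopology M (\<Phi> ` unit_ball)) \<Phi>"
      using h unfolding holo_embedding_def embedding_map_def by simp
    then have "inj_on \<Phi> unit_ball" using homeomorphic_imp_injective_map by fastforce
    ultimately show "ball_embedding M A \<Phi>"
      using h unfolding emb holo_embedding_def imm by (elim conjE) (intro conjI)
  next
    assume e: "ball_embedding M A \<Phi>"
    have "regular \<kappa> w \<Longrightarrow> \<exists>J. ((\<lambda>z. \<kappa> (\<Phi> z)) has_derivative (\<lambda>x. J *v x)) (at w)"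
      for \<kappa> :: "'a \<Rightarrow> complex^'m" and w
      unfolding regular_def by blast
    then have "holo_map (top_of_set unit_ball) (std_atlas unit_ball) M A \<Phi>"
      using e unfolding emb holo_map_def std_atlas_def holo_on_def case_prod_unfold by (simp add: der)
    then have "holo_immersion (top_of_set unit_ball) (std_atlas unit_ball) M A \<Phi>"
      using e unfolding imm emb by (elim conjE) (intro conjI)
    moreover have "embedding_map (top_of_set unit_ball) M \<Phi>"
    proof (rule injective_open_imp_embedding_map)
      show "open_map (top_of_set unit_ball) M \<Phi>"
        unfolding open_map_def openin_open_eq[OF open_unit_ball] using ball_embedding_open[OF e] by simp
    qed (use e in \<open>auto simp: ball_embedding_def\<close>)
    ultimately show "holo_embedding (top_of_set unit_ball) (std_atlas unit_ball) M A \<Phi>"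
      unfolding holo_embedding_def by (rule conjI)
  qed
qed

lemma ball_embedding_scaleR:
  assumes e: "ball_embedding M A \<Phi>" and r: "0 < r" "r \<le> 1"
  shows "ball_embedding M A (\<lambda>w. \<Phi> (r *\<^sub>R w))"
proof -
  have in_ball: "r *\<^sub>R w \<in> unit_ball" if "w \<in> unit_ball" for w :: "complex^'m"
    using that r mult_le_one[of r "norm w"] by (auto simp: unit_ball_def intro: le_less_trans[OF mult_left_le_one_le])
  have "continuous_map (top_of_set unit_ball) (top_of_set unit_ball) (\<lambda>w :: complex^'m. r *\<^sub>R w)"
    using in_ball by (auto intro!: continuous_intros)
  moreover have "continuous_map (top_of_set unit_ball) M \<Phi>" using e by (simp add: ball_embedding_def)
  ultimately have "continuous_map (top_of_set unit_ball) M (\<Phi> \<circ> (\<lambda>w. r *\<^sub>R w))"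
    by (rule continuous_map_compose)
  moreover have "inj_on (\<lambda>w. \<Phi> (r *\<^sub>R w)) unit_ball"
  proof (rule inj_onI)
    fix w w' assume w: "w \<in> unit_ball" "w' \<in> unit_ball" "\<Phi> (r *\<^sub>R w) = \<Phi> (r *\<^sub>R w')"
    then have "r *\<^sub>R w = r *\<^sub>R w'" using e in_ball unfolding ball_embedding_def by (meson inj_onD)
    then show "w = w'" using r by simp
  qed
  moreover have "\<exists>J. ((\<lambda>z. \<kappa> (\<Phi> (r *\<^sub>R z))) has_derivative (\<lambda>x. J *v x)) (at w) \<and> inj (\<lambda>x. J *v x)"
    if c: "(U, \<kappa>) \<in> A" and w: "w \<in> unit_ball" "\<Phi> (r *\<^sub>R w) \<in> U" for U \<kappa> w
  proof -
    obtain J where J: "((\<lambda>z. \<kappa> (\<Phi> z)) has_derivative (\<lambda>x. J *v x)) (at (r *\<^sub>R w))" "inj (\<lambda>x. J *v x)"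
      using e c w in_ball[OF w(1)] unfolding ball_embedding_def by blast
    have "((\<lambda>z. \<kappa> (\<Phi> (r *\<^sub>R z))) has_derivative (\<lambda>x. (J ** mat (complex_of_real r)) *v x)) (at w)"
      using has_derivative_compose[OF has_derivative_scaleR_matrix J(1)]
      by (simp add: matrix_vector_mul_assoc)
    moreover have "inj (\<lambda>x. (J ** mat (complex_of_real r)) *v x)"
    proof (rule injI)
      fix x y assume "(J ** mat (complex_of_real r)) *v x = (J ** mat (complex_of_real r)) *v y"
      then have "J *v (r *\<^sub>R x) = J *v (r *\<^sub>R y)"
        by (simp add: matrix_vector_mul_assoc[symmetric] mat_of_real_mult)
      from injD[OF J(2) this] show "x = y" using r by simp
    qed
    ultimately show ?thesis by blast
  qed
  ultimately show ?thesis unfolding ball_embedding_def by (auto simp: comp_def)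
qed


lemma C2_funD: "C2_fun A \<phi> \<Longrightarrow> (U, \<kappa>) \<in> A \<Longrightarrow> C2_on (\<kappa> ` U) (\<lambda>z. \<phi> (inv_into U \<kappa> z))"
  unfolding C2_fun_def by (fastforce simp: comp_def)

lemma C2_funI:
  "(\<And>U \<kappa>. (U, \<kappa>) \<in> A \<Longrightarrow> C2_on (\<kappa> ` U) (\<lambda>z. \<phi> (inv_into U \<kappa> z))) \<Longrightarrow> C2_fun A \<phi>"
  unfolding C2_fun_def by (auto simp: comp_def)

lemma psh_funD: "psh_fun A u \<Longrightarrow> (U, \<kappa>) \<in> A \<Longrightarrow> psh_on (\<kappa> ` U) (\<lambda>z. u (inv_into U \<kappa> z))"
  unfolding psh_fun_def by (fastforce simp: comp_def)

lemma psh_funI: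
  "(\<And>U \<kappa>. (U, \<kappa>) \<in> A \<Longrightarrow> psh_on (\<kappa> ` U) (\<lambda>z. u (inv_into U \<kappa> z))) \<Longrightarrow> psh_fun A u"
  unfolding psh_fun_def by (auto simp: comp_def)

lemma chart_inv_topspace: "(U, \<kappa>) \<in> A \<Longrightarrow> z \<in> \<kappa> ` U \<Longrightarrow> inv_into U \<kappa> z \<in> topspace M"
  using chart_subset chart_inv_in by blast

text \<open>\<open>wsq\<close> speaks of \<open>log \<phi>\<close>, \<open>wHHR\<close> of
  \<open>\<phi>\<close> itself; this is the passage between them.\<close>

lemma psh_fun_exp:
  assumes "C2_fun A \<phi>" "\<phi> ` topspace M \<subseteq> {0..1}" "psh_fun A (\<lambda>p. log_ereal (\<phi> p))"
  shows "psh_fun A (\<lambda>p. ereal (\<phi> p))"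
proof (rule psh_funI, rule psh_on_exp)
  fix U \<kappa> assume c: "(U, \<kappa>) \<in> A"
  show "psh_on (\<kappa> ` U) (\<lambda>z. log_ereal (\<phi> (inv_into U \<kappa> z)))" by (rule psh_funD[OF assms(3) c])
  show "open (\<kappa> ` U)" by (rule chart_props(2)[OF c])
  show "continuous_on (\<kappa> ` U) (\<lambda>z. \<phi> (inv_into U \<kappa> z))"
    by (rule C2_on_imp_continuous_on[OF C2_funD[OF assms(1) c]])
  fix z assume "z \<in> \<kappa> ` U"
  then have "\<phi> (inv_into U \<kappa> z) \<in> {0..1}"
    using assms(2) chart_inv_topspace[OF c] by blast
  then show "0 \<le> \<phi> (inv_into U \<kappa> z)" by simp
qed

definition squeezed :: "'a \<Rightarrow> real \<Rightarrow> bool" where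
  "squeezed \<zeta> s \<longleftrightarrow> (\<exists>(\<Phi> :: complex^'m \<Rightarrow> 'a) \<phi>.
          holo_embedding (top_of_set unit_ball) (std_atlas unit_ball) M A \<Phi> \<and>
          C2_fun A \<phi> \<and> \<phi> ` topspace M \<subseteq> {0..1} \<and>
          \<Phi> 0 = \<zeta> \<and> \<phi> \<zeta> = 0 \<and> psh_fun A (\<lambda>p. log_ereal (\<phi> p)) \<and>
          levi_ge unit_ball (\<phi> \<circ> \<Phi>) (s\<^sup>2))"

lemma wsq_eq: "wsq M A \<zeta> = Sup {ereal s | s. 0 \<le> s \<and> s \<le> 1 \<and> squeezed \<zeta> s}"
  unfolding wsq_def squeezed_def ..

section \<open>Comparison with the squeezing function\<close>

lemma embedding_into_ball_regular:
  fixes f :: "'a \<Rightarrow> complex^'m"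
  assumes f: "holo_embedding M A (top_of_set unit_ball) (std_atlas unit_ball) f"
    and c: "(U, \<kappa>) \<in> A" and z: "z \<in> \<kappa> ` U"
  shows "\<exists>J. ((\<lambda>z. f (inv_into U \<kappa> z)) has_derivative (\<lambda>x. J *v x)) (at z) \<and> inj (\<lambda>x. J *v x)"
proof -
  have "continuous_map M (top_of_set unit_ball) f"
    using f unfolding holo_embedding_def holo_immersion_def holo_map_def by (elim conjE)
  then have "f p \<in> unit_ball" if "p \<in> U" for p
    using chart_subset[OF c] that by (auto simp: continuous_map_def)
  then have "z \<in> \<kappa> ` (U \<inter> f -` unit_ball)" using z by auto
  moreover have "\<forall>(U, \<kappa>)\<in>A. \<forall>(V, \<psi>)\<in>std_atlas unit_ball. \<forall>w\<in>\<kappa> ` (U \<inter> f -` V).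
        \<exists>J. ((\<psi> \<circ> f \<circ> inv_into U \<kappa>) has_derivative (\<lambda>x. J *v x)) (at w) \<and> inj (\<lambda>x. J *v x)"
    using f unfolding holo_embedding_def holo_immersion_def by (elim conjE)
  from bspec[OF this c]
  have "\<forall>w\<in>\<kappa> ` (U \<inter> f -` unit_ball).
     \<exists>J. ((id \<circ> f \<circ> inv_into U \<kappa>) has_derivative (\<lambda>x. J *v x)) (at w) \<and> inj (\<lambda>x. J *v x)"
    by (simp add: std_atlas_def)
  ultimately show ?thesis unfolding comp_def id_apply by (rule bspec[rotated])
qed

lemma squeezed_if_embedding:
  fixes f :: "'a \<Rightarrow> complex^'m"
  assumes f: "holo_embedding M A (top_of_set unit_ball) (std_atlas unit_ball) f"
    and \<zeta>: "\<zeta> \<in> topspace M" "f \<zeta> = 0" and r: "0 < r" "(*\<^sub>R) r ` unit_ball \<subseteq> f ` topspace M"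
  shows "r \<le> 1 \<and> squeezed \<zeta> r"
proof -
  have cf: "continuous_map M (top_of_set unit_ball) f"
    using f unfolding holo_embedding_def holo_immersion_def holo_map_def by (elim conjE)
  have f_ball: "f p \<in> unit_ball" if "p \<in> topspace M" for p
    using cf that by (auto simp: continuous_map_def)
  have hf: "homeomorphic_map M (subtopology (top_of_set unit_ball) (f ` topspace M)) f"
    using f unfolding holo_embedding_def embedding_map_def by simp
  have sub: "subtopology (top_of_set unit_ball) (f ` topspace M) = top_of_set (f ` topspace M)"
    using f_ball by (auto simp: subtopology_subtopology intro!: arg_cong2[where f = subtopology])
  have inj: "inj_on f (topspace M)" by (rule homeomorphic_imp_injective_map[OF hf])
  define g where "g = inv_into (topspace M) f"
  have gf: "g (f p) = p" if "p \<in> topspace M" for p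
    unfolding g_def using inj that by (rule inv_into_f_f)
  \<comment> \<open>The homeomorphism comes with some continuous inverse; it agrees with
    \<open>g\<close> on the image, which makes \<open>g\<close> continuous there.\<close>
  obtain g' where g': "homeomorphic_maps M (top_of_set (f ` topspace M)) f g'"
    using hf unfolding sub homeomorphic_map_maps by blast
  have cg: "continuous_map (top_of_set (f ` topspace M)) M g"
  proof (rule continuous_map_eq)
    show "continuous_map (top_of_set (f ` topspace M)) M g'" using g' by (simp add: homeomorphic_maps_def)
    fix x assume "x \<in> topspace (top_of_set (f ` topspace M))"
    then obtain p where "p \<in> topspace M" "x = f p" by auto
    then show "g' x = g x" using g' gf by (simp add: homeomorphic_maps_def)
  qed
  define \<Phi> where "\<Phi> w = g (r *\<^sub>R w)" for w
  have rw: "r *\<^sub>R w \<in> f ` topspace M" if "w \<in> unit_ball" for w using r(2) that by blast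
  have f\<Phi>: "f (\<Phi> w) = r *\<^sub>R w" if "w \<in> unit_ball" for w
    using f_inv_into_f[OF rw[OF that]] by (simp add: \<Phi>_def g_def)
  have emb: "ball_embedding M A \<Phi>"
    unfolding ball_embedding_def
  proof (intro conjI)
    have "continuous_map (top_of_set unit_ball) (top_of_set (f ` topspace M)) (\<lambda>w. r *\<^sub>R w)"
      using rw by (auto intro!: continuous_intros)
    from continuous_map_compose[OF this cg] show "continuous_map (top_of_set unit_ball) M \<Phi>"
      by (simp add: comp_def \<Phi>_def[abs_def])
    show "inj_on \<Phi> unit_ball"
    proof (rule inj_onI)
      fix w w' assume w: "w \<in> unit_ball" "w' \<in> unit_ball" "\<Phi> w = \<Phi> w'"
      then have "r *\<^sub>R w = r *\<^sub>R w'" using f\<Phi>[OF w(1)] f\<Phi>[OF w(2)] by metis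
      then show "w = w'" using r(1) by simp
    qed
    have "\<exists>J. ((\<lambda>z. \<kappa> (\<Phi> z)) has_derivative (\<lambda>x. J *v x)) (at w) \<and> inj (\<lambda>x. J *v x)"
      if c: "(U, \<kappa>) \<in> A" and w: "w \<in> unit_ball" "\<Phi> w \<in> U" for U \<kappa> w
    proof -
      have "\<exists>J. ((\<lambda>y. \<kappa> (g y)) has_derivative (\<lambda>x. J *v x)) (at (f (inv_into U \<kappa> (\<kappa> (\<Phi> w))))) \<and> inj (\<lambda>x. J *v x)"
      proof (rule holo_inverse[where f = "\<lambda>z. f (inv_into U \<kappa> z)", OF chart_props(2)[OF c]
            embedding_into_ball_regular[OF f c]])
        fix z assume "z \<in> \<kappa> ` U"
        then show "\<kappa> (g (f (inv_into U \<kappa> z))) = z"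
          by (simp add: gf chart_inv_topspace[OF c] f_inv_into_f)
      qed (use w in auto)
      then obtain J where J: "((\<lambda>y. \<kappa> (g y)) has_derivative (\<lambda>x. J *v x)) (at (r *\<^sub>R w))" "inj (\<lambda>x. J *v x)"
        unfolding chart_inv[OF c w(2)] f\<Phi>[OF w(1)] by blast
      have "((\<lambda>z. \<kappa> (\<Phi> z)) has_derivative (\<lambda>x. (J ** mat (complex_of_real r)) *v x)) (at w)"
        using has_derivative_compose[OF has_derivative_scaleR_matrix J(1)]
        by (simp add: matrix_vector_mul_assoc \<Phi>_def)
      moreover have "inj (\<lambda>x. (J ** mat (complex_of_real r)) *v x)"
      proof (rule injI)
        fix x y assume "(J ** mat (complex_of_real r)) *v x = (J ** mat (complex_of_real r)) *v y"
        then have "J *v (r *\<^sub>R x) = J *v (r *\<^sub>R y)"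
          by (simp add: matrix_vector_mul_assoc[symmetric] mat_of_real_mult)
        from injD[OF J(2) this] show "x = y" using r by simp
      qed
      ultimately show ?thesis by blast
    qed
    then show "\<forall>(U, \<kappa>)\<in>A. \<forall>w\<in>unit_ball. \<Phi> w \<in> U \<longrightarrow>
        (\<exists>J. ((\<lambda>z. \<kappa> (\<Phi> z)) has_derivative (\<lambda>x. J *v x)) (at w) \<and> inj (\<lambda>x. J *v x))" by blast
  qed
  have f_holo: "holo_on (\<kappa> ` U) (\<lambda>z. f (inv_into U \<kappa> z))" if c: "(U, \<kappa>) \<in> A" for U \<kappa>
    unfolding holo_on_def using embedding_into_ball_regular[OF f c] by blast
  define \<phi> where "\<phi> p = (norm (f p))\<^sup>2" for p
  have "r \<le> 1"
  proof (rule ccontr)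
    assume "\<not> r \<le> 1"
    then have r1: "1 < r" by simp
    \<comment> \<open>Any unit vector would do: for \<open>r > 1\<close> the point
      \<open>(1 / r) *\<^sub>R e\<close> is in the ball, so \<open>e\<close> would be a value of
      \<open>f\<close> of norm 1.\<close>
    define e :: "complex^'m" where "e = axis undefined 1"
    have e: "norm e = 1" by (simp add: e_def)
    have "(1 / r) *\<^sub>R e \<in> unit_ball" using r1 e by (simp add: unit_ball_def)
    from rw[OF this] have "e \<in> f ` topspace M" using r(1) by simp
    then obtain p where p: "p \<in> topspace M" "f p = e" by auto
    show False using f_ball[OF p(1)] p(2) e by (simp add: unit_ball_def)
  qed
  moreover have "C2_fun A \<phi>"
    unfolding \<phi>_def[abs_def]
    by (rule C2_funI, rule C2_on_holo_compose[OF C2_on_norm_square[OF open_UNIV] _ f_holo])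
       (auto simp: chart_props)
  moreover have "\<phi> ` topspace M \<subseteq> {0..1}"
  proof (rule image_subsetI)
    fix p assume "p \<in> topspace M"
    then have "norm (f p) \<le> 1" using f_ball by (auto simp: unit_ball_def less_imp_le)
    then show "\<phi> p \<in> {0..1}" by (simp add: \<phi>_def power_le_one)
  qed
  moreover have "\<Phi> 0 = \<zeta>" using gf[OF \<zeta>(1)] \<zeta>(2) by (simp add: \<Phi>_def)
  moreover have "\<phi> \<zeta> = 0" using \<zeta> by (simp add: \<phi>_def)
  moreover have "psh_fun A (\<lambda>p. log_ereal (\<phi> p))"
  proof (rule psh_funI)
    fix U \<kappa> assume c: "(U, \<kappa>) \<in> A"
    let ?f = "\<lambda>z. f (inv_into U \<kappa> z)"
    show "psh_on (\<kappa> ` U) (\<lambda>z. log_ereal (\<phi> (inv_into U \<kappa> z)))"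
    proof (rule psh_on_logI)
      show "continuous_on (\<kappa> ` U) (\<lambda>z. \<phi> (inv_into U \<kappa> z))"
        unfolding \<phi>_def by (intro continuous_intros holo_on_imp_continuous_on[OF f_holo[OF c]])
      fix a v \<tau>
      assume z: "a + \<tau> *s v \<in> \<kappa> ` U" and pos: "0 < \<phi> (inv_into U \<kappa> (a + \<tau> *s v))"
      \<comment> \<open>With the zeros of \<open>f\<close> removed the logarithm is of class C2, and
        its line Laplacian is pulled back from \<open>C^m\<close> minus the origin.\<close>
      let ?S = "{z \<in> \<kappa> ` U. ?f z \<in> - {0}}"
      have "openin (top_of_set (\<kappa> ` U)) (\<kappa> ` U \<inter> ?f -` (- {0}))"
        by (rule continuous_openin_preimage_gen[OF holo_on_imp_continuous_on[OF f_holo[OF c]]]) auto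
      then have oS: "open ?S"
        using openin_open_eq[OF chart_props(2)[OF c]] by (simp add: vimage_def Int_def)
      have holo: "holo_on ?S ?f" by (rule holo_on_subset[OF f_holo[OF c]]) auto
      have zS: "a + \<tau> *s v \<in> ?S" using z pos by (auto simp: \<phi>_def)
      obtain J where J: "(?f has_derivative (\<lambda>x. J *v x)) (at (a + \<tau> *s v))"
        using embedding_into_ball_regular[OF f c z] by blast
      have C2ln: "C2_on (- {0}) (\<lambda>z :: complex^'m. ln ((norm z)\<^sup>2))" by (rule C2_on_ln_norm_square)
      show "viscosity_sub (\<lambda>\<tau>. log_ereal (\<phi> (inv_into U \<kappa> (a + \<tau> *s v)))) \<tau>"
      proof (rule viscosity_sub_if_line_laplacian_nonneg[where u = "\<lambda>z. log_ereal (\<phi> (inv_into U \<kappa> z))"])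
        show "C2_on ?S (\<lambda>z. ln ((norm (?f z))\<^sup>2))"
          by (rule C2_on_holo_compose[OF C2ln oS holo]) auto
        have "line_laplacian (\<lambda>z. ln ((norm (?f z))\<^sup>2)) (a + \<tau> *s v) v =
            line_laplacian (\<lambda>z. ln ((norm z)\<^sup>2)) (?f (a + \<tau> *s v)) (J *v v)"
          by (rule line_laplacian_holo_compose[OF C2ln oS holo _ _ zS J]) auto
        also have "\<dots> \<ge> 0" using zS by (intro line_laplacian_ln_norm_square) auto
        finally show "0 \<le> line_laplacian (\<lambda>z. ln ((norm (?f z))\<^sup>2)) (a + \<tau> *s v) v" .
      qed (use oS zS in \<open>auto simp: log_ereal_def \<phi>_def\<close>)
    qed (simp add: \<phi>_def)
  qed
  moreover have "levi_ge unit_ball (\<phi> \<circ> \<Phi>) (r\<^sup>2)"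
  proof -
    \<comment> \<open>As \<open>f (\<Phi> w) = r *\<^sub>R w\<close>, this is
      \<open>\<phi> \<circ> \<Phi>\<close>, whose Levi form is exactly \<open>r\<^sup>2\<close>
      times the Euclidean metric.\<close>
    let ?h = "\<lambda>w. (norm (r *\<^sub>R w :: complex^'m))\<^sup>2"
    have C2: "C2_on unit_ball ?h"
      by (rule C2_on_holo_compose[OF C2_on_norm_square[OF open_UNIV] open_unit_ball holo_on_scaleR]) auto
    have eq: "?h w = (\<phi> \<circ> \<Phi>) w" if "w \<in> unit_ball" for w
      using f\<Phi>[OF that] by (simp add: \<phi>_def)
    have "line_laplacian (\<phi> \<circ> \<Phi>) w x = 4 * r\<^sup>2 * (norm x)\<^sup>2" if w: "w \<in> unit_ball" for w x
    proof -
      have "line_laplacian (\<phi> \<circ> \<Phi>) w x = line_laplacian ?h w x"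
        by (rule line_laplacian_cong[where g = "\<phi> \<circ> \<Phi>", OF C2 open_unit_ball eq w, symmetric])
      also have "\<dots> = line_laplacian (\<lambda>z. (norm z)\<^sup>2) (r *\<^sub>R w) (r *\<^sub>R x)"
        by (rule line_laplacian_scaleR[OF C2_on_norm_square[OF open_UNIV]]) auto
      also have "\<dots> = 2 * (norm (r *\<^sub>R x))\<^sup>2 + 2 * (norm (\<i> *s (r *\<^sub>R x)))\<^sup>2"
        by (rule line_laplacian_eq[OF C2_on_norm_square[OF open_UNIV] _ _ has_d2_norm_square has_d2_norm_square]) auto
      finally show ?thesis by (simp add: norm_imaginary power_mult_distrib)
    qed
    then show ?thesis
      by (subst levi_ge_iff[OF C2_on_cong[OF C2 open_unit_ball eq] open_unit_ball]) auto
  qed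
  ultimately show ?thesis
    using emb unfolding squeezed_def holo_embedding_ball_iff
    by (intro conjI exI[of _ \<Phi>] exI[of _ \<phi>])
qed

lemma sq_le_wsq:
  assumes "\<zeta> \<in> topspace M"
  shows "sq M A \<zeta> \<le> wsq M A \<zeta>"
proof -
  have "Sup {ereal r | r. 0 < r \<and>
             (\<exists>f :: 'a \<Rightarrow> complex^'m.
                holo_embedding M A (top_of_set unit_ball) (std_atlas unit_ball) f \<and>
                f \<zeta> = 0 \<and> (*\<^sub>R) r ` unit_ball \<subseteq> f ` topspace M)} \<le> wsq M A \<zeta>"
  proof (rule Sup_least)
    fix y assume "y \<in> {ereal r | r. 0 < r \<and>
             (\<exists>f :: 'a \<Rightarrow> complex^'m.
                holo_embedding M A (top_of_set unit_ball) (std_atlas unit_ball) f \<and>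
                f \<zeta> = 0 \<and> (*\<^sub>R) r ` unit_ball \<subseteq> f ` topspace M)}"
    then obtain r f where r: "y = ereal r" "0 < r"
      "holo_embedding M A (top_of_set unit_ball) (std_atlas unit_ball) (f :: 'a \<Rightarrow> complex^'m)"
      "f \<zeta> = 0" "(*\<^sub>R) r ` unit_ball \<subseteq> f ` topspace M" by blast
    from squeezed_if_embedding[OF r(3) assms r(4) r(2) r(5)]
    show "y \<le> wsq M A \<zeta>" unfolding wsq_eq r(1) using r(2) by (intro Sup_upper) auto
  qed
  then show ?thesis unfolding sq_def by simp
qed

lemma wHHR_if_wsq:
  assumes "0 < c" "\<And>z. z \<in> topspace M \<Longrightarrow> ereal c \<le> wsq M A z"
  shows "wHHR M A"
  unfolding wHHR_def
\<comment> \<open>The supremum in \<open>wsq\<close> need not be attained, so a smaller constant is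
  taken to obtain an actual witness \<open>s\<close>.\<close>
proof (intro exI[of _ "c / 2"] conjI ballI)
  fix \<zeta> assume "\<zeta> \<in> topspace M"
  have "ereal (c / 2) < ereal c" using assms(1) by simp
  also have "\<dots> \<le> wsq M A \<zeta>" by (rule assms(2)[OF \<open>\<zeta> \<in> topspace M\<close>])
  finally have "ereal (c / 2) < wsq M A \<zeta>" .
  then obtain y where "y \<in> {ereal s | s. 0 \<le> s \<and> s \<le> 1 \<and> squeezed \<zeta> s}" "ereal (c / 2) < y"
    unfolding wsq_eq less_Sup_iff by (elim bexE)
  then obtain s where s: "c / 2 < s" "squeezed \<zeta> s" by auto
  then obtain \<Phi> :: "complex^'m \<Rightarrow> 'a" and \<phi> where h:
    "holo_embedding (top_of_set unit_ball) (std_atlas unit_ball) M A \<Phi>"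
    "C2_fun A \<phi>" "\<phi> ` topspace M \<subseteq> {0..1}" "\<Phi> 0 = \<zeta>" "psh_fun A (\<lambda>p. log_ereal (\<phi> p))"
    "levi_ge unit_ball (\<phi> \<circ> \<Phi>) (s\<^sup>2)"
    unfolding squeezed_def by blast
  have "(c / 2)\<^sup>2 \<le> s\<^sup>2" using s assms(1) by (intro power_mono) auto
  have "levi_ge unit_ball (\<phi> \<circ> \<Phi>) ((c / 2)\<^sup>2)"
    unfolding levi_ge_def
  proof (intro ballI allI)
    fix w x assume "w \<in> (unit_ball :: (complex^'m) set)"
    then have "s\<^sup>2 * (\<Sum>j\<in>UNIV. (cmod (x $ j))\<^sup>2) \<le> Re (levi_form (\<phi> \<circ> \<Phi>) w x)"
      using h(6) unfolding levi_ge_def by simp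
    moreover have "(c / 2)\<^sup>2 * (\<Sum>j\<in>UNIV. (cmod (x $ j))\<^sup>2) \<le> s\<^sup>2 * (\<Sum>j\<in>UNIV. (cmod (x $ j))\<^sup>2)"
      by (intro mult_right_mono \<open>(c / 2)\<^sup>2 \<le> s\<^sup>2\<close> sum_nonneg) auto
    ultimately show "(c / 2)\<^sup>2 * (\<Sum>j\<in>UNIV. (cmod (x $ j))\<^sup>2) \<le> Re (levi_form (\<phi> \<circ> \<Phi>) w x)" by linarith
  qed
  with h psh_fun_exp[OF h(2,3,5)]
  show "\<exists>(\<Phi> :: complex^'m \<Rightarrow> 'a) \<phi>.
        holo_embedding (top_of_set unit_ball) (std_atlas unit_ball) M A \<Phi> \<and>
        C2_fun A \<phi> \<and> psh_fun A (\<lambda>p. ereal (\<phi> p)) \<and> \<phi> ` topspace M \<subseteq> {0..1} \<and>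
        \<Phi> 0 = \<zeta> \<and> levi_ge unit_ball (\<phi> \<circ> \<Phi>) ((c / 2)\<^sup>2)"
    by (intro exI[of _ \<Phi>] exI[of _ \<phi>] conjI)
qed (use assms in simp)


section \<open>From wHHR to the weak squeezing function: gluing the bump into the manifold\<close>

lemma C2_on_ball_pullback:
  assumes e: "ball_embedding M A \<Phi>" and \<phi>: "C2_fun A \<phi>"
  shows "C2_on unit_ball (\<lambda>w. \<phi> (\<Phi> w))"
proof (rule C2_on_locally[OF open_unit_ball])
  fix w :: "complex^'m" assume w: "w \<in> unit_ball"
  obtain U \<kappa> where c: "(U, \<kappa>) \<in> A" "\<Phi> w \<in> U" by (rule chart_at[OF ball_embedding_range[OF e w]])
  let ?T = "{w \<in> unit_ball. \<Phi> w \<in> U}"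
  have oT: "open ?T" by (rule open_ball_preimage[OF e chart_props(1)[OF c(1)]])
  have holo: "holo_on ?T (\<lambda>z. \<kappa> (\<Phi> z))"
    using e c(1) unfolding holo_on_def ball_embedding_def by blast
  have "C2_on ?T (\<lambda>w. \<phi> (inv_into U \<kappa> (\<kappa> (\<Phi> w))))"
    by (rule C2_on_holo_compose[OF C2_funD[OF \<phi> c(1)] oT holo]) auto
  then have "C2_on ?T (\<lambda>w. \<phi> (\<Phi> w))"
    by (rule C2_on_cong[OF _ oT]) (simp add: chart_inv[OF c(1)])
  with oT w c(2) show "\<exists>T. open T \<and> w \<in> T \<and> C2_on T (\<lambda>w. \<phi> (\<Phi> w))"
    by (intro exI[of _ ?T]) simp
qed

text \<open>The two formulas for \<open>\<psi>\<close> agree off the image of the closed half ball.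
  This gives an open cover \<open>V\<close>, \<open>V'\<close> of \<open>M\<close> on whose members
  smoothness and plurisubharmonicity are checked separately. The bound on \<open>c\<close> involves
  \<open>s\<close> alone, which is the uniformity in \<open>\<zeta>\<close> that is wanted.\<close>

lemma squeezed_if_psh:
  fixes \<Phi> :: "complex^'m \<Rightarrow> 'a"
  assumes s: "0 < s" and emb: "holo_embedding (top_of_set unit_ball) (std_atlas unit_ball) M A \<Phi>"
    and \<phi>: "C2_fun A \<phi>" and psh: "psh_fun A (\<lambda>p. ereal (\<phi> p))" and rng: "\<phi> ` topspace M \<subseteq> {0..1}"
    and \<zeta>: "\<Phi> 0 = \<zeta>" and levi: "levi_ge unit_ball (\<phi> \<circ> \<Phi>) (s\<^sup>2)"
    and c: "c\<^sup>2 \<le> bump_levi (s\<^sup>2) / 16"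
  shows "squeezed \<zeta> c"
proof -
  have e: "ball_embedding M A \<Phi>" using emb by (simp add: holo_embedding_ball_iff)
  have inj: "inj_on \<Phi> unit_ball" using e by (simp add: ball_embedding_def)
  define f where "f w = \<phi> (\<Phi> w)" for w
  have f_eq: "\<phi> \<circ> \<Phi> = f" by (auto simp: f_def)
  have C2f: "C2_on unit_ball f" unfolding f_def by (rule C2_on_ball_pullback[OF e \<phi>])
  have f_levi: "4 * s\<^sup>2 * (norm x)\<^sup>2 \<le> line_laplacian f w x" if "w \<in> unit_ball" for w x
    using levi that unfolding f_eq levi_ge_iff[OF C2f open_unit_ball] by blast
  have \<phi>_rng: "\<phi> p \<in> {0..1}" if "p \<in> topspace M" for p using rng that by blast
  \<comment> \<open>Doubling the coordinate ends the cutoff at half the radius of the embedded ball.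
    The Laplacian bound \<open>4 * s\<^sup>2\<close> loses a factor 4, which is why the locale is
    used with \<open>s\<^sup>2\<close>.\<close>
  define F where "F z = f ((1/2) *\<^sub>R z)" for z
  have half: "(1/2) *\<^sub>R z \<in> unit_ball" if "z \<in> ball 0 2" for z :: "complex^'m"
    using that by (simp add: unit_ball_def)
  have double: "2 *\<^sub>R w \<in> ball 0 2" if "w \<in> unit_ball" for w :: "complex^'m"
    using that by (simp add: unit_ball_def)
  interpret squeezing_bump F "s\<^sup>2"
  proof
    show "C2_on (ball 0 2) F"
      unfolding F_def by (rule C2_on_holo_compose[OF C2f open_ball holo_on_scaleR]) (use half in auto)
    fix z x :: "complex^'m" assume z: "z \<in> ball 0 2"
    show "F z \<in> {0..1}" unfolding F_def f_def by (rule \<phi>_rng[OF ball_embedding_range[OF e half[OF z]]])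
    have "line_laplacian F z x = line_laplacian f ((1/2) *\<^sub>R z) ((1/2) *\<^sub>R x)"
      unfolding F_def by (rule line_laplacian_scaleR[OF C2f open_unit_ball half[OF z]])
    with f_levi[OF half[OF z], of "(1/2) *\<^sub>R x"]
    show "s\<^sup>2 * (norm x)\<^sup>2 \<le> line_laplacian F z x" by (simp add: power_divide)
  qed (use s in simp)
  define W where "W p = 2 *\<^sub>R inv_into unit_ball \<Phi> p" for p
  define \<psi> where "\<psi> p = (if p \<in> \<Phi> ` unit_ball then bump (W p) else exp (weight (\<phi> p)))" for p
  define V where "V = \<Phi> ` unit_ball"
  \<comment> \<open>Open because a compact set in a Hausdorff space is closed; the outer formula for
    \<open>\<psi>\<close> holds on all of it, including the part inside the embedded ball.\<close>
  define V' where "V' = topspace M - \<Phi> ` cball 0 (1/2)"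
  have oV: "openin M V" unfolding V_def by (rule ball_embedding_open[OF e open_unit_ball order_refl])
  have oV': "openin M V'"
  proof -
    have "cball 0 (1/2) \<subseteq> (unit_ball :: (complex^'m) set)" by (auto simp: unit_ball_def)
    then have "compactin (top_of_set unit_ball) (cball 0 (1/2) :: (complex^'m) set)"
      by (simp add: compactin_subtopology)
    moreover have "continuous_map (top_of_set unit_ball) M \<Phi>" using e by (simp add: ball_embedding_def)
    ultimately have "compactin M (\<Phi> ` cball 0 (1/2))" by (rule image_compactin)
    from compactin_imp_closedin[OF Hausdorff this] show ?thesis unfolding V'_def by (rule openin_diff[OF openin_topspace])
  qed
  have W\<Phi>: "W (\<Phi> w) = 2 *\<^sub>R w" if "w \<in> unit_ball" for w
    unfolding W_def using inj that by (simp add: inv_into_f_f)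
  have \<psi>\<Phi>: "\<psi> (\<Phi> w) = bump (2 *\<^sub>R w)" if "w \<in> unit_ball" for w
    unfolding \<psi>_def using that W\<Phi>[OF that] by simp
  have \<psi>_V': "\<psi> p = exp (weight (\<phi> p))" if "p \<in> V'" for p
  proof (cases "p \<in> \<Phi> ` unit_ball")
    case True
    then obtain w where w: "w \<in> unit_ball" "p = \<Phi> w" by blast
    then have "w \<notin> cball 0 (1/2)" using that by (auto simp: V'_def)
    then have "1 \<le> norm (2 *\<^sub>R w)" by simp
    then have "1 \<le> (norm (2 *\<^sub>R w))\<^sup>2" by (rule one_le_power)
    then have "bump (2 *\<^sub>R w) = exp (weight (F (2 *\<^sub>R w)))"
      unfolding bump_def by (simp only: cutoff_eq_one mult_1)
    then show ?thesis using \<psi>\<Phi>[OF w(1)] w(2) by (simp add: F_def f_def)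
  qed (simp add: \<psi>_def)
  have weight_nonpos: "weight y \<le> 0" if "y \<in> {0..1}" for y
  proof -
    have "K * y \<le> K" using that K_pos by simp
    moreover have "y\<^sup>2 \<le> 1" using that by (simp add: power_le_one)
    ultimately show ?thesis by (simp add: weight_def)
  qed
  have \<psi>_rng: "\<psi> p \<in> {0..1}" if p: "p \<in> topspace M" for p
  proof (cases "p \<in> \<Phi> ` unit_ball")
    case True
    then obtain w where w: "w \<in> unit_ball" "p = \<Phi> w" by blast
    let ?z = "2 *\<^sub>R w"
    have "0 \<le> bump ?z" using bump_pos[of ?z] by (cases "?z = 0") (auto simp: bump_def)
    moreover have "cutoff ((norm ?z)\<^sup>2) * exp (weight (F ?z)) \<le> 1 * 1"
      using cutoff_le_one weight_nonpos[OF range[OF double[OF w(1)]]] by (intro mult_mono) auto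
    ultimately show ?thesis using \<psi>\<Phi>[OF w(1)] w(2) by (simp add: bump_def)
  next
    case False
    then show ?thesis using weight_nonpos[OF \<phi>_rng[OF p]] by (simp add: \<psi>_def)
  qed
  have cover: "p \<in> V \<or> p \<in> V'" if "p \<in> topspace M" for p
  proof -
    have "cball 0 (1/2) \<subseteq> (unit_ball :: (complex^'m) set)" by (auto simp: unit_ball_def)
    then show ?thesis using that by (auto simp: V_def V'_def)
  qed
  have chart_W: "holo_on (\<kappa> ` (U \<inter> V)) (\<lambda>z. W (inv_into U \<kappa> z))"
    if ch: "(U, \<kappa>) \<in> A" for U \<kappa>
    unfolding holo_on_def
  proof
    fix z assume "z \<in> \<kappa> ` (U \<inter> V)"
    then obtain w where w: "w \<in> unit_ball" "\<Phi> w \<in> U" "z = \<kappa> (\<Phi> w)" unfolding V_def by blast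
    have "\<exists>J. ((\<lambda>z. inv_into unit_ball \<Phi> (inv_into U \<kappa> z)) has_derivative (\<lambda>x. J *v x)) (at (\<kappa> (\<Phi> w))) \<and> inj (\<lambda>x. J *v x)"
    proof (rule holo_inverse[where f = "\<lambda>w. \<kappa> (\<Phi> w)", OF open_ball_preimage[OF e chart_props(1)[OF ch]]])
      fix w assume "w \<in> {w \<in> unit_ball. \<Phi> w \<in> U}"
      then have w: "w \<in> unit_ball" "\<Phi> w \<in> U" by auto
      show "\<exists>J. ((\<lambda>w. \<kappa> (\<Phi> w)) has_derivative (\<lambda>x. J *v x)) (at w) \<and> inj (\<lambda>x. J *v x)"
        using e ch w unfolding ball_embedding_def by blast
      show "inv_into unit_ball \<Phi> (inv_into U \<kappa> (\<kappa> (\<Phi> w))) = w"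
        using chart_inv[OF ch w(2)] inv_into_f_f[OF inj w(1)] by simp
    qed (use w in simp)
    then obtain J where J: "((\<lambda>z. inv_into unit_ball \<Phi> (inv_into U \<kappa> z)) has_derivative (\<lambda>x. J *v x)) (at z)"
      unfolding w(3) by blast
    have "((\<lambda>z. W (inv_into U \<kappa> z)) has_derivative (\<lambda>x. (mat (complex_of_real 2) ** J) *v x)) (at z)"
      unfolding W_def matrix_vector_mul_assoc[symmetric]
      by (rule has_derivative_compose[OF J has_derivative_scaleR_matrix])
    then show "\<exists>J. ((\<lambda>z. W (inv_into U \<kappa> z)) has_derivative (\<lambda>x. J *v x)) (at z)" by blast
  qed
  have W_range: "W (inv_into U \<kappa> z) \<in> ball 0 2 \<and> \<psi> (inv_into U \<kappa> z) = bump (W (inv_into U \<kappa> z))"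
    if ch: "(U, \<kappa>) \<in> A" and z: "z \<in> \<kappa> ` (U \<inter> V)" for U \<kappa> z
  proof -
    obtain w where w: "w \<in> unit_ball" "\<Phi> w \<in> U" "z = \<kappa> (\<Phi> w)" using z unfolding V_def by blast
    then show ?thesis
      using chart_inv[OF ch w(2)] W\<Phi>[OF w(1)] \<psi>\<Phi>[OF w(1)] double[OF w(1)] by simp
  qed
  have V'_val: "\<psi> (inv_into U \<kappa> z) = exp (weight (\<phi> (inv_into U \<kappa> z)))"
    if ch: "(U, \<kappa>) \<in> A" and z: "z \<in> \<kappa> ` (U \<inter> V')" for U \<kappa> z
    using z chart_inv[OF ch] \<psi>_V' by auto
  have chart_cover: "z \<in> \<kappa> ` (U \<inter> V) \<or> z \<in> \<kappa> ` (U \<inter> V')" if ch: "(U, \<kappa>) \<in> A" and z: "z \<in> \<kappa> ` U" for U \<kappa> z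
    using z cover chart_subset[OF ch] by blast
  have C2\<psi>: "C2_fun A \<psi>"
  proof (rule C2_funI, rule C2_on_locally)
    fix U \<kappa> assume ch: "(U, \<kappa>) \<in> A"
    show "open (\<kappa> ` U)" by (rule chart_props(2)[OF ch])
    fix z assume z: "z \<in> \<kappa> ` U"
    have 1: "C2_on (\<kappa> ` (U \<inter> V)) (\<lambda>z. \<psi> (inv_into U \<kappa> z))"
    proof (rule C2_on_cong[OF C2_on_holo_compose[OF C2_on_bump chart_open[OF ch oV] chart_W[OF ch]] chart_open[OF ch oV]])
    qed (use W_range[OF ch] in auto)
    have 2: "C2_on (\<kappa> ` (U \<inter> V')) (\<lambda>z. \<psi> (inv_into U \<kappa> z))"
    proof (rule C2_on_cong[OF C2_on_exp_weight[OF C2_on_subset[OF C2_funD[OF \<phi> ch]]]])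
      fix z assume "z \<in> \<kappa> ` (U \<inter> V')"
      then show "exp (weight (\<phi> (inv_into U \<kappa> z))) = \<psi> (inv_into U \<kappa> z)" using V'_val[OF ch] by simp
    qed (use chart_open[OF ch oV'] in auto)
    from chart_cover[OF ch z] show "\<exists>T. open T \<and> z \<in> T \<and> C2_on T (\<lambda>z. \<psi> (inv_into U \<kappa> z))"
      using 1 2 chart_open[OF ch oV] chart_open[OF ch oV'] by blast
  qed
  have psh\<psi>: "psh_fun A (\<lambda>p. log_ereal (\<psi> p))"
  proof (rule psh_funI, rule psh_on_logI)
    fix U \<kappa> assume ch: "(U, \<kappa>) \<in> A"
    show "continuous_on (\<kappa> ` U) (\<lambda>z. \<psi> (inv_into U \<kappa> z))"
      by (rule C2_on_imp_continuous_on[OF C2_funD[OF C2\<psi> ch]])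
    show "0 \<le> \<psi> (inv_into U \<kappa> z)" if "z \<in> \<kappa> ` U" for z
      using \<psi>_rng[OF chart_inv_topspace[OF ch that]] by simp
    fix a v \<tau> assume z: "a + \<tau> *s v \<in> \<kappa> ` U" and pos: "0 < \<psi> (inv_into U \<kappa> (a + \<tau> *s v))"
    let ?W = "\<lambda>z. W (inv_into U \<kappa> z)"
    from chart_cover[OF ch z]
    show "viscosity_sub (\<lambda>\<tau>. log_ereal (\<psi> (inv_into U \<kappa> (a + \<tau> *s v)))) \<tau>"
    proof
      \<comment> \<open>On the embedded ball C2 calculus suffices: \<open>ln (bump z)\<close> is
        pulled back by the holomorphic coordinate \<open>W\<close>, away from the zero of
        \<open>W\<close>.\<close>
      assume zV: "a + \<tau> *s v \<in> \<kappa> ` (U \<inter> V)"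
      let ?S = "{z \<in> \<kappa> ` (U \<inter> V). ?W z \<in> - {0}}"
      have "openin (top_of_set (\<kappa> ` (U \<inter> V))) (\<kappa> ` (U \<inter> V) \<inter> ?W -` (- {0}))"
        by (rule continuous_openin_preimage_gen[OF holo_on_imp_continuous_on[OF chart_W[OF ch]]]) auto
      then have oS: "open ?S"
        using openin_open_eq[OF chart_open[OF ch oV]] by (simp add: vimage_def Int_def)
      have holo: "holo_on ?S ?W" by (rule holo_on_subset[OF chart_W[OF ch]]) auto
      have zS: "a + \<tau> *s v \<in> ?S"
        using zV pos W_range[OF ch zV] by (auto simp: bump_def)
      obtain J where J: "(?W has_derivative (\<lambda>x. J *v x)) (at (a + \<tau> *s v))"
        using holo zS unfolding holo_on_def by blast
      have WS: "?W ` ?S \<subseteq> ball 0 2 - {0}" using W_range[OF ch] by auto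
      show ?thesis
      proof (rule viscosity_sub_if_line_laplacian_nonneg[where u = "\<lambda>z. log_ereal (\<psi> (inv_into U \<kappa> z))"])
        show "C2_on ?S (\<lambda>z. ln (bump (?W z)))"
          by (rule C2_on_holo_compose[OF C2_on_ln_bump oS holo WS])
        have "line_laplacian (\<lambda>z. ln (bump (?W z))) (a + \<tau> *s v) v =
            line_laplacian (\<lambda>z. ln (bump z)) (?W (a + \<tau> *s v)) (J *v v)"
          by (rule line_laplacian_holo_compose[OF C2_on_ln_bump oS holo WS _ zS J]) auto
        also have "\<dots> \<ge> 0" using zS WS by (intro line_laplacian_ln_bump) blast+
        finally show "0 \<le> line_laplacian (\<lambda>z. ln (bump (?W z))) (a + \<tau> *s v) v" .
        fix z assume zz: "z \<in> ?S"
        then have "0 < bump (?W z)" by (intro bump_pos) auto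
        then show "log_ereal (\<psi> (inv_into U \<kappa> z)) = ereal (ln (bump (?W z)))"
          using W_range[OF ch, of z] zz by (simp add: log_ereal_def)
      qed (use oS zS in auto)
    next
      \<comment> \<open>No strict Levi bound is available here in general; \<open>log \<psi>\<close>
        is \<open>weight\<close> of the plurisubharmonic \<open>\<phi>\<close>, with positive slope
        since \<open>\<phi> \<ge> 0\<close>, and convexity of \<open>weight\<close> gives the
        tangent inequality.\<close>
      assume zV': "a + \<tau> *s v \<in> \<kappa> ` (U \<inter> V')"
      let ?p = "\<lambda>\<tau>. \<phi> (inv_into U \<kappa> (a + \<tau> *s v))"
      have v: "viscosity_sub (\<lambda>\<tau>. ereal (?p \<tau>)) \<tau>"
        using psh_on_imp_viscosity_sub[OF psh_funD[OF psh ch] chart_props(2)[OF ch] z] .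
      have "0 \<le> ?p \<tau>" using \<phi>_rng[OF chart_inv_topspace[OF ch z]] by simp
      then have m: "0 < K + 2 * ?p \<tau>" using K_pos by simp
      have tangent: "weight x + (K + 2 * x) * (y - x) \<le> weight y" for x y
      proof -
        have "weight y - (weight x + (K + 2 * x) * (y - x)) = (y - x)\<^sup>2" unfolding weight_def by algebra
        then show ?thesis using zero_le_power2[of "y - x"] by linarith
      qed
      have v_weight: "viscosity_sub (\<lambda>\<tau>. ereal (weight (?p \<tau>))) \<tau>"
        by (rule viscosity_sub_increasing_convex[OF v m always_eventually[OF allI[OF tangent]]])
      have ev: "log_ereal (\<psi> (inv_into U \<kappa> (a + \<sigma> *s v))) = ereal (weight (?p \<sigma>))"
        if "a + \<sigma> *s v \<in> \<kappa> ` (U \<inter> V')" for \<sigma>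
        using V'_val[OF ch that] by (simp add: log_ereal_def)
      have "\<forall>\<^sub>F \<sigma> in nhds \<tau>. a + \<sigma> *s v \<in> \<kappa> ` (U \<inter> V')"
        using eventually_nhds_in_open[OF open_line_preimage[OF chart_open[OF ch oV']], of \<tau> a v] zV' by simp
      then have "\<forall>\<^sub>F \<sigma> in nhds \<tau>. ereal (weight (?p \<sigma>)) \<le> log_ereal (\<psi> (inv_into U \<kappa> (a + \<sigma> *s v)))"
        by eventually_elim (simp add: ev)
      from viscosity_sub_mono[OF v_weight _ this] ev[OF zV'] show ?thesis by simp
    qed
  qed
  \<comment> \<open>Along \<open>\<Psi>\<close> the coordinate \<open>W\<close> is
    \<open>w / 2\<close>, inside the region of \<open>line_laplacian_bump\<close>. The chain rule
    costs a factor 4 and the passage from Laplacian to Levi form another 4, whence the 16 in the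
    bound on \<open>c\<close>.\<close>
  define \<Psi> where "\<Psi> w = \<Phi> ((1/4) *\<^sub>R w)" for w
  have emb\<Psi>: "ball_embedding M A \<Psi>"
    unfolding \<Psi>_def by (rule ball_embedding_scaleR[OF e]) auto
  have levi\<Psi>: "levi_ge unit_ball (\<psi> \<circ> \<Psi>) (c\<^sup>2)"
  proof -
    have quarter: "(1/2) *\<^sub>R w \<in> ball 0 2" "norm ((1/2) *\<^sub>R w) < 1" "(1/4) *\<^sub>R w \<in> unit_ball"
      if "w \<in> unit_ball" for w :: "complex^'m"
      using that by (auto simp: unit_ball_def)
    have eq: "bump ((1/2) *\<^sub>R w) = (\<psi> \<circ> \<Psi>) w" if "w \<in> unit_ball" for w
      using \<psi>\<Phi>[OF quarter(3)[OF that]] by (simp add: \<Psi>_def)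
    have C2b: "C2_on unit_ball (\<lambda>w. bump ((1/2) *\<^sub>R w))"
      by (rule C2_on_holo_compose[OF C2_on_bump open_unit_ball holo_on_scaleR]) (use quarter in auto)
    have "4 * c\<^sup>2 * (norm x)\<^sup>2 \<le> line_laplacian (\<psi> \<circ> \<Psi>) w x" if w: "w \<in> unit_ball" for w x
    proof -
      have "line_laplacian (\<psi> \<circ> \<Psi>) w x = line_laplacian (\<lambda>w. bump ((1/2) *\<^sub>R w)) w x"
        by (rule line_laplacian_cong[where g = "\<psi> \<circ> \<Psi>", OF C2b open_unit_ball eq w, symmetric])
      also have "\<dots> = line_laplacian bump ((1/2) *\<^sub>R w) ((1/2) *\<^sub>R x)"
        by (rule line_laplacian_scaleR[OF C2_on_bump open_ball quarter(1)[OF w]])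
      finally have "bump_levi (s\<^sup>2) * (norm ((1/2) *\<^sub>R x))\<^sup>2 \<le> line_laplacian (\<psi> \<circ> \<Psi>) w x"
        using line_laplacian_bump[OF quarter(2)[OF w], of "(1/2) *\<^sub>R x"] by simp
      moreover have "4 * c\<^sup>2 * (norm x)\<^sup>2 \<le> 4 * (bump_levi (s\<^sup>2) / 16) * (norm x)\<^sup>2"
        using c by (intro mult_right_mono) auto
      moreover have "4 * (bump_levi (s\<^sup>2) / 16) * (norm x)\<^sup>2 = bump_levi (s\<^sup>2) * (norm ((1/2) *\<^sub>R x))\<^sup>2"
        by (simp add: power_divide)
      ultimately show ?thesis by linarith
    qed
    then show ?thesis
      by (subst levi_ge_iff[OF C2_on_cong[OF C2b open_unit_ball eq] open_unit_ball]) auto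
  qed
  have "\<Psi> 0 = \<zeta>" using \<zeta> by (simp add: \<Psi>_def)
  moreover have "\<psi> \<zeta> = 0" using \<psi>\<Phi>[of 0] \<zeta> by (simp add: unit_ball_def bump_def)
  moreover have "\<psi> ` topspace M \<subseteq> {0..1}" using \<psi>_rng by blast
  ultimately show ?thesis
    using emb\<Psi> C2\<psi> psh\<psi> levi\<Psi> unfolding squeezed_def holo_embedding_ball_iff
    by (intro exI[of _ \<Psi>] exI[of _ \<psi>] conjI)
qed

lemma wsq_if_wHHR:
  assumes "wHHR M A"
  shows "\<exists>c. 0 < c \<and> (\<forall>z\<in>topspace M. ereal c \<le> wsq M A z)"
proof -
  obtain s where s: "0 < s" "\<forall>\<zeta>\<in>topspace M. \<exists>(\<Phi> :: complex^'m \<Rightarrow> 'a) \<phi>.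
        holo_embedding (top_of_set unit_ball) (std_atlas unit_ball) M A \<Phi> \<and>
        C2_fun A \<phi> \<and> psh_fun A (\<lambda>p. ereal (\<phi> p)) \<and> \<phi> ` topspace M \<subseteq> {0..1} \<and>
        \<Phi> 0 = \<zeta> \<and> levi_ge unit_ball (\<phi> \<circ> \<Phi>) (s\<^sup>2)"
    using assms unfolding wHHR_def by (elim exE conjE)
  \<comment> \<open>The supremum in \<open>wsq\<close> runs over numbers up to 1 only, hence the
    minimum; the root is taken because \<open>levi_ge\<close> is used with
    \<open>c\<^sup>2\<close>.\<close>
  define c where "c = min 1 (sqrt (bump_levi (s\<^sup>2) / 16))"
  have c: "0 < c" "c \<le> 1" using bump_levi_pos[of "s\<^sup>2"] by (auto simp: c_def)
  have "c\<^sup>2 \<le> (sqrt (bump_levi (s\<^sup>2) / 16))\<^sup>2" using c by (intro power_mono) (auto simp: c_def)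
  also have "\<dots> = bump_levi (s\<^sup>2) / 16"
    using bump_levi_pos[of "s\<^sup>2"] by (intro real_sqrt_pow2) simp
  finally have c2: "c\<^sup>2 \<le> bump_levi (s\<^sup>2) / 16" .
  have "ereal c \<le> wsq M A \<zeta>" if "\<zeta> \<in> topspace M" for \<zeta>
  proof -
    from bspec[OF s(2) that] have "squeezed \<zeta> c"
      by (elim exE conjE) (rule squeezed_if_psh[OF s(1) _ _ _ _ _ _ c2])
    then show ?thesis unfolding wsq_eq using c by (intro Sup_upper) auto
  qed
  with c(1) show ?thesis by blast
qed

lemma wsq_le_1: "wsq M A z \<le> 1"
  unfolding wsq_eq by (intro Sup_least) (auto simp: one_ereal_def)

end

theorem proposition1p10:
  fixes M :: "'a topology" and A :: "('a, 'm::finite) chart set"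
  assumes "complex_manifold M A"
  shows "(\<forall>z\<^sub>0\<in>topspace M. sq M A z\<^sub>0 \<le> wsq M A z\<^sub>0 \<and> wsq M A z\<^sub>0 \<le> 1) \<and>
         (wHHR M A \<longleftrightarrow> (\<exists>c::real. 0 < c \<and> (\<forall>z\<in>topspace M. ereal c \<le> wsq M A z)))"
proof -
  interpret cmanifold M A by (rule cmanifold.intro[OF assms])
  show ?thesis using sq_le_wsq wsq_le_1 wsq_if_wHHR wHHR_if_wsq by blast
qed

end
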